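(* Fix an integer $\kappa\ge1$ and let $2<p<\infty$. Then almost surely the limit $L_p(t)=\lim_{N\to\infty}L_{N,p}(t)$ exists for every $t>0$. Moreover, with probability one, $$L_p(t)=\sup_{D\in\Gamma_\kappa}L_{p,D}(t)=\sup_{D\in\Gamma_\kappa^+}L_{p,D}(t)\qquad\text{for every } t>0.$$
   Context: Let $(g_{ij})_{i,j\ge1}$ be independent standard Gaussian random variables. For $\sigma=(\sigma_1,\dots,\sigma_N)\in(\mathbb{R}^\kappa)^N$ put $$H_N(\sigma)=\frac1{\sqrt N}\sum_{i,j=1}^N g_{ij}(\sigma_i,\sigma_j),\qquad \|\sigma\|_{p,2}^p=\sum_{i=1}^N\|\sigma_i\|_2^p,\qquad H_{N,p,t}(\sigma)=H_N(\sigma)-t\|\sigma\|_{p,2}^p\quad(t>0),$$ where $(\cdot,\cdot)$ and $\|\cdot\|_2$ are the Euclidean inner product and norm on $\mathbb{R}^\kappa$. The unconstrained Lagrangian is $L_{N,p}(t)=\frac1N\max_{\sigma\in(\mathbb{R}^\kappa)^N}H_{N,p,t}(\sigma)$. Let $\Gamma_\kappa$ be the set of symmetric non-negative definite $\kappa\times\kappa$ real matrices and $\Gamma_\kappa^+$ the subset of positive definite ones. The self-overlap is $R(\sigma,\sigma)=\frac1N\sum_{i=1}^N\sigma_i\sigma_i^T\in\Gamma_\kappa$. For $D\in\Gamma_\kappa$ let $\Sigma_N(D)=\{\sigma\in(\mathbb{R}^\kappa)^N: R(\sigma,\sigma)=D\}$ (non-empty for $N\ge\kappa$) and $L_{N,p,D}(t)=\frac1N\max_{\sigma\in\Sigma_N(D)}H_{N,p,t}(\sigma)$.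 The deterministic quantity $L_{p,D}(t)$ is $L_{p,D}(t)=\lim_{N\to\infty}\mathbb{E}L_{N,p,D}(t)$; this limit exists and is also the almost sure limit of $L_{N,p,D}(t)$. *)

theory Defs
  imports "HOL-Probability.Probability" "HOL-Real_Asymp.Real_Asymp"
begin

text \<open>
  Vectors in \<open>\<real>\<^sup>\<kappa>\<close> are \<open>real ^ 'k\<close>. Spin configurations with \<open>N\<close> sites, \<open>N\<close> being a number that
  later tends to infinity, are extensional functions on the index set \<open>{1..N}\<close>.
\<close>

definition configs :: "nat \<Rightarrow> (nat \<Rightarrow> real ^ 'k) set" where
  "configs N = {1..N} \<rightarrow>\<^sub>E UNIV"

definition hamiltonian :: "(nat \<Rightarrow> nat \<Rightarrow> real) \<Rightarrow> nat \<Rightarrow> (nat \<Rightarrow> real ^ 'k) \<Rightarrow> real" where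
  "hamiltonian g N \<sigma> = 1 / sqrt (real N) * (\<Sum>i=1..N. \<Sum>j=1..N. g i j * (\<sigma> i \<bullet> \<sigma> j))"

text \<open>The \<open>p\<close>-th power of the \<open>(p,2)\<close>-norm.\<close>

definition norm_p2_powr :: "real \<Rightarrow> nat \<Rightarrow> (nat \<Rightarrow> real ^ 'k) \<Rightarrow> real" where
  "norm_p2_powr p N \<sigma> = (\<Sum>i=1..N. norm (\<sigma> i) powr p)"

definition pen_hamiltonian ::
  "(nat \<Rightarrow> nat \<Rightarrow> real) \<Rightarrow> real \<Rightarrow> real \<Rightarrow> nat \<Rightarrow> (nat \<Rightarrow> real ^ 'k) \<Rightarrow> real" where
  "pen_hamiltonian g p t N \<sigma> = hamiltonian g N \<sigma> - t * norm_p2_powr p N \<sigma>"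

definition psd_matrices :: "(real ^ 'k ^ 'k) set" where
  "psd_matrices = {D. transpose D = D \<and> (\<forall>x. 0 \<le> x \<bullet> (D *v x))}"

definition pd_matrices :: "(real ^ 'k ^ 'k) set" where
  "pd_matrices = {D. transpose D = D \<and> (\<forall>x. x \<noteq> 0 \<longrightarrow> 0 < x \<bullet> (D *v x))}"

text \<open>The \<open>(a,b)\<close> entry of \<open>\<sigma>\<^sub>i \<sigma>\<^sub>i\<^sup>T\<close> is \<open>\<sigma> i $ a * \<sigma> i $ b\<close>.\<close>

definition self_overlap :: "nat \<Rightarrow> (nat \<Rightarrow> real ^ 'k) \<Rightarrow> real ^ 'k ^ 'k" where
  "self_overlap N \<sigma> = (1 / real N) *\<^sub>R (\<Sum>i=1..N. \<chi> a b. \<sigma> i $ a * \<sigma> i $ b)"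

definition overlap_configs :: "nat \<Rightarrow> real ^ 'k ^ 'k \<Rightarrow> (nat \<Rightarrow> real ^ 'k) set" where
  "overlap_configs N D = {\<sigma> \<in> configs N. self_overlap N \<sigma> = D}"

text \<open>
  The maxima below are over infinite sets, hence written as suprema. They are attained for \<open>N \<ge> 1\<close>,
  \<open>p > 2\<close> and \<open>t > 0\<close>, the constrained one whenever the constraint set is non-empty (for smaller
  \<open>N\<close> its value is the unspecified \<open>Sup {}\<close>, which has no influence on limits); see
  \<open>lagrangian_attained\<close> and \<open>lagrangian_overlap_attained\<close>.

  The type argument records the dimension \<open>\<kappa>\<close>, which the type of the value
  does not determine for the unconstrained Lagrangian.
\<close>

definition lagrangian ::
  "'k::finite itself \<Rightarrow> (nat \<Rightarrow> nat \<Rightarrow> real) \<Rightarrow> real \<Rightarrow> nat \<Rightarrow> real \<Rightarrow> real" where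
  "lagrangian (_ :: 'k itself) g p N t =
     1 / real N * (\<Squnion>\<sigma>\<in>(configs N :: (nat \<Rightarrow> real ^ 'k) set). pen_hamiltonian g p t N \<sigma>)"

definition lagrangian_overlap ::
  "(nat \<Rightarrow> nat \<Rightarrow> real) \<Rightarrow> real \<Rightarrow> real ^ 'k ^ 'k \<Rightarrow> nat \<Rightarrow> real \<Rightarrow> real" where
  "lagrangian_overlap g p D N t =
     1 / real N * (\<Squnion>\<sigma>\<in>overlap_configs N D. pen_hamiltonian g p t N \<sigma>)"

text \<open>From here on \<open>g i j\<close> are random variables on the probability space \<open>M\<close>.\<close>

definition lim_lagrangian ::
  "'k::finite itself \<Rightarrow> (nat \<Rightarrow> nat \<Rightarrow> 'a \<Rightarrow> real) \<Rightarrow> real \<Rightarrow> real \<Rightarrow> 'a \<Rightarrow> real" where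
  "lim_lagrangian k g p t \<omega> = lim (\<lambda>N. lagrangian k (\<lambda>i j. g i j \<omega>) p N t)"

definition lim_lagrangian_overlap ::
  "'a measure \<Rightarrow> (nat \<Rightarrow> nat \<Rightarrow> 'a \<Rightarrow> real) \<Rightarrow> real \<Rightarrow> real ^ 'k ^ 'k \<Rightarrow> real \<Rightarrow> real" where
  "lim_lagrangian_overlap M g p D t =
     lim (\<lambda>N. LINT \<omega>|M. lagrangian_overlap (\<lambda>i j. g i j \<omega>) p D N t)"


lemma pen_hamiltonian_continuous:
  assumes "p > 0"
  shows "continuous_on A (pen_hamiltonian g p t N :: (nat \<Rightarrow> real ^ 'k) \<Rightarrow> real)"
proof -
  have c: "continuous_on A (\<lambda>\<sigma>::nat \<Rightarrow> real ^ 'k. \<sigma> i)" for i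
    by (rule continuous_on_subset [OF continuous_on_product_coordinates]) simp
  show ?thesis
    unfolding pen_hamiltonian_def [abs_def] hamiltonian_def norm_p2_powr_def
    by (intro continuous_intros c continuous_on_powr') (use assms in auto)
qed

lemma compact_configs_cball:
  "compact {\<sigma> \<in> configs N. \<forall>i\<in>{1..N}. norm (\<sigma> i :: real ^ 'k) \<le> r}" (is "compact ?S")
proof -
  have eq: "?S = Pi\<^sub>E UNIV (\<lambda>i. if i \<in> {1..N} then cball 0 r else {undefined})"
    by (fastforce simp: configs_def PiE_def extensional_def Pi_def split: if_splits)
  show ?thesis
    unfolding eq compactin_euclidean_iff [symmetric] euclidean_product_topology [symmetric]
    by (subst compactin_PiE) (auto simp: compactin_euclidean_iff)
qed

lemma pen_hamiltonian_coercive: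
  assumes "p > 2" "t > 0"
  shows "\<exists>r\<ge>0. \<forall>\<sigma>::nat \<Rightarrow> real ^ 'k. (\<exists>k\<in>{1..N}. r < norm (\<sigma> k)) \<longrightarrow> pen_hamiltonian g p t N \<sigma> \<le> 0"
proof -
  define C where "C = 1 / sqrt (real N) * (\<Sum>i=1..N. \<Sum>j=1..N. \<bar>g i j\<bar>) + 1"
  have C: "C > 0" unfolding C_def
    by (intro add_nonneg_pos mult_nonneg_nonneg sum_nonneg) auto
  define f where "f = (\<lambda>r::real. C * r\<^sup>2 - t * r powr p)"
  have bound: "pen_hamiltonian g p t N \<sigma> \<le> (\<Sum>i=1..N. f (norm (\<sigma> i)))" for \<sigma> :: "nat \<Rightarrow> real ^ 'k"
  proof -
    define S where "S = (\<Sum>i=1..N. (norm (\<sigma> i))\<^sup>2)"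
    have S0: "S \<ge> 0" unfolding S_def by (simp add: sum_nonneg)
    have le: "(norm (\<sigma> i))\<^sup>2 \<le> S" if "i \<in> {1..N}" for i
      unfolding S_def using that by (intro member_le_sum) auto
    have inn: "g i j * (\<sigma> i \<bullet> \<sigma> j) \<le> \<bar>g i j\<bar> * S" if "i \<in> {1..N}" "j \<in> {1..N}" for i j
    proof -
      have "\<bar>\<sigma> i \<bullet> \<sigma> j\<bar> \<le> norm (\<sigma> i) * norm (\<sigma> j)" by (rule Cauchy_Schwarz_ineq2)
      also have "\<dots> \<le> ((norm (\<sigma> i))\<^sup>2 + (norm (\<sigma> j))\<^sup>2) / 2"
        using sum_squares_bound [of "norm (\<sigma> i)" "norm (\<sigma> j)"] by simp
      also have "\<dots> \<le> S" using le [OF that(1)] le [OF that(2)] by simp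
      finally have "\<bar>\<sigma> i \<bullet> \<sigma> j\<bar> \<le> S" .
      then have "\<bar>g i j * (\<sigma> i \<bullet> \<sigma> j)\<bar> \<le> \<bar>g i j\<bar> * S"
        unfolding abs_mult by (rule mult_left_mono) simp
      then show ?thesis by simp
    qed
    have "(\<Sum>i=1..N. \<Sum>j=1..N. g i j * (\<sigma> i \<bullet> \<sigma> j)) \<le> (\<Sum>i=1..N. \<Sum>j=1..N. \<bar>g i j\<bar> * S)"
      by (intro sum_mono inn)
    then have "hamiltonian g N \<sigma> \<le> 1 / sqrt (real N) * (\<Sum>i=1..N. \<Sum>j=1..N. \<bar>g i j\<bar> * S)"
      unfolding hamiltonian_def by (rule mult_left_mono) simp
    also have "\<dots> = (C - 1) * S" by (simp add: C_def sum_distrib_right)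
    also have "\<dots> \<le> C * S" using S0 by (simp add: algebra_simps)
    finally show ?thesis
      by (simp add: pen_hamiltonian_def norm_p2_powr_def f_def S_def sum_subtractf sum_distrib_left)
  qed
  have "filterlim f at_bot at_top"
    unfolding f_def using assms C by real_asymp
  then have ev: "\<forall>K. eventually (\<lambda>r. f r \<le> K) at_top" by (simp add: filterlim_at_bot)
  then obtain r0 where r0: "\<And>r. r \<ge> r0 \<Longrightarrow> f r \<le> 0" by (auto simp: eventually_at_top_linorder)
  define B where "B = C * r0\<^sup>2"
  have B0: "B \<ge> 0" using C by (simp add: B_def)
  have fB: "f r \<le> B" if "r \<ge> 0" for r
  proof (cases "r \<ge> r0")
    case True then show ?thesis using r0 [of r] B0 by simp
  next
    case False
    then have "r\<^sup>2 \<le> r0\<^sup>2" using that by (intro power_mono) auto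
    then have "C * r\<^sup>2 \<le> B" unfolding B_def using C by simp
    moreover have "0 \<le> t * r powr p" using assms by simp
    ultimately show ?thesis by (simp add: f_def)
  qed
  from ev obtain r1 where r1: "\<And>r. r \<ge> r1 \<Longrightarrow> f r \<le> - (real N * B)"
    by (meson eventually_at_top_linorder)
  have "pen_hamiltonian g p t N \<sigma> \<le> 0" if k: "k \<in> {1..N}" "max 0 r1 < norm (\<sigma> k)"
    for \<sigma> :: "nat \<Rightarrow> real ^ 'k" and k
  proof -
    have "(\<Sum>i=1..N. f (norm (\<sigma> i))) = f (norm (\<sigma> k)) + (\<Sum>i\<in>{1..N} - {k}. f (norm (\<sigma> i)))"
      using k by (intro sum.remove) auto
    also have "\<dots> \<le> - (real N * B) + (\<Sum>i\<in>{1..N} - {k}. B)"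
      using k by (intro add_mono r1 sum_mono fB) auto
    also have "\<dots> = - B" using k by (simp add: of_nat_diff algebra_simps)
    finally show ?thesis using bound [of \<sigma>] B0 by linarith
  qed
  then show ?thesis by (intro exI [of _ "max 0 r1"]) auto
qed

lemma lagrangian_attained:
  assumes "p > 2" "t > 0" "N \<ge> 1"
  shows "\<exists>\<sigma>\<in>(configs N :: (nat \<Rightarrow> real ^ 'k) set).
           (\<forall>\<tau>\<in>(configs N :: (nat \<Rightarrow> real ^ 'k) set).
              pen_hamiltonian g p t N \<tau> \<le> pen_hamiltonian g p t N \<sigma>)
           \<and> lagrangian TYPE('k::finite) g p N t = pen_hamiltonian g p t N \<sigma> / real N"
proof -
  let ?h = "pen_hamiltonian g p t N :: (nat \<Rightarrow> real ^ 'k) \<Rightarrow> real"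
  obtain r where r: "r \<ge> 0" and co: "\<And>\<sigma>::nat \<Rightarrow> real ^ 'k. \<exists>k\<in>{1..N}. r < norm (\<sigma> k) \<Longrightarrow> ?h \<sigma> \<le> 0"
    using pen_hamiltonian_coercive [OF assms(1,2), where g = g and N = N and 'k = 'k] by auto
  let ?S = "{\<sigma> \<in> configs N. \<forall>i\<in>{1..N}. norm (\<sigma> i :: real ^ 'k) \<le> r}"
  define z :: "nat \<Rightarrow> real ^ 'k" where "z = restrict (\<lambda>_. 0) {1..N}"
  have z: "z \<in> ?S" using r by (auto simp: z_def configs_def)
  have hz: "?h z = 0" by (simp add: z_def pen_hamiltonian_def hamiltonian_def norm_p2_powr_def)
  have "continuous_on ?S ?h" by (rule pen_hamiltonian_continuous) (use assms in simp)
  with z obtain \<sigma> where \<sigma>: "\<sigma> \<in> ?S" and max: "\<And>\<tau>. \<tau> \<in> ?S \<Longrightarrow> ?h \<tau> \<le> ?h \<sigma>"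
    using continuous_attains_sup [OF compact_configs_cball, of N r ?h] by blast
  have max': "?h \<tau> \<le> ?h \<sigma>" if "\<tau> \<in> configs N" for \<tau>
    using that max [of \<tau>] max [OF z] hz co [of \<tau>] by (cases "\<tau> \<in> ?S") force+
  have "(\<Squnion>\<tau>\<in>configs N. ?h \<tau>) = ?h \<sigma>"
    by (rule cSup_eq_maximum) (use \<sigma> max' in auto)
  with \<sigma> max' show ?thesis by (intro bexI [of _ \<sigma>]) (auto simp: lagrangian_def)
qed

lemma lagrangian_overlap_attained:
  fixes D :: "real ^ 'k ^ 'k"
  assumes "p > 0" "N \<ge> 1" "overlap_configs N D \<noteq> {}"
  shows "\<exists>\<sigma>\<in>overlap_configs N D.
           (\<forall>\<tau>\<in>overlap_configs N D. pen_hamiltonian g p t N \<tau> \<le> pen_hamiltonian g p t N \<sigma>)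
           \<and> lagrangian_overlap g p D N t = pen_hamiltonian g p t N \<sigma> / real N"
proof -
  let ?h = "pen_hamiltonian g p t N :: (nat \<Rightarrow> real ^ 'k) \<Rightarrow> real"
  let ?r = "sqrt (real N * (\<Sum>a\<in>UNIV. D $ a $ a))"
  have sub: "norm (\<sigma> i) \<le> ?r" if s: "\<sigma> \<in> overlap_configs N D" and i: "i \<in> {1..N}" for \<sigma> i
  proof -
    have D: "D = self_overlap N \<sigma>" using s by (simp add: overlap_configs_def)
    have "real N * (\<Sum>a\<in>UNIV. D $ a $ a) = (\<Sum>a\<in>UNIV. \<Sum>i=1..N. (\<sigma> i $ a)\<^sup>2)"
      using assms unfolding D by (simp add: self_overlap_def sum_distrib_left power2_eq_square)
    also have "\<dots> = (\<Sum>i=1..N. (norm (\<sigma> i))\<^sup>2)"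
      by (subst sum.swap) (simp only: power2_norm_eq_inner inner_vec_def inner_real_def flip: power2_eq_square)
    also have "\<dots> \<ge> (norm (\<sigma> i))\<^sup>2" using i by (intro member_le_sum) auto
    finally show ?thesis by (rule real_le_rsqrt)
  qed
  let ?S = "{\<sigma> \<in> configs N. \<forall>i\<in>{1..N}. norm (\<sigma> i :: real ^ 'k) \<le> ?r}"
  have eq: "overlap_configs N D = ?S \<inter> (self_overlap N -` {D})"
    using sub by (fastforce simp: overlap_configs_def)
  have c: "continuous_on UNIV (\<lambda>\<sigma>::nat \<Rightarrow> real ^ 'k. \<sigma> i)" for i
    by (rule continuous_on_product_coordinates)
  have "continuous_on UNIV (self_overlap N :: (nat \<Rightarrow> real ^ 'k) \<Rightarrow> _)"
    unfolding self_overlap_def [abs_def] by (intro continuous_intros c)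
  then have "closed (self_overlap N -` {D} :: (nat \<Rightarrow> real ^ 'k) set)"
    by (intro closed_vimage) auto
  then have "compact (overlap_configs N D)"
    unfolding eq by (intro compact_Int_closed compact_configs_cball)
  moreover have "continuous_on (overlap_configs N D) ?h"
    by (rule pen_hamiltonian_continuous) (use assms in simp)
  ultimately obtain \<sigma> where \<sigma>: "\<sigma> \<in> overlap_configs N D"
      and max: "\<And>\<tau>. \<tau> \<in> overlap_configs N D \<Longrightarrow> ?h \<tau> \<le> ?h \<sigma>"
    using continuous_attains_sup assms(3) by metis
  have "(\<Squnion>\<tau>\<in>overlap_configs N D. ?h \<tau>) = ?h \<sigma>"
    by (rule cSup_eq_maximum) (use \<sigma> max in auto)
  with \<sigma> max show ?thesis by (intro bexI [of _ \<sigma>]) (auto simp: lagrangian_overlap_def)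
qed

end

theory Submission
  imports Defs
begin

text \<open>
  The maximum over configurations with self-overlap \<open>D\<close> is superadditive in \<open>N\<close> in expectation:
  by Slepian's inequality, since the covariance \<open>N \<parallel>R(\<sigma>,\<tau>)\<parallel>\<^sup>2\<close> is convex in the overlap and its
  diagonal is fixed. Fekete's lemma then yields \<open>L\<^bsub>p,D\<^esub>\<close>. Slepian's inequality itself is obtained
  without differentiating under the integral, by comparing the two Gaussian semigroups on
      log-sum-exp
  over a short time and iterating.

  For the upper bound on the unconstrained maximum, a configuration with self-overlap \<open>D\<close> in a
  compact set is extended by \<open>\<epsilon> N\<close> spins to one whose self-overlap is a slightly larger positive
  definite matrix from a finite net. The signs of the new spins are chosen so that the cross terms
  help. Thus no continuity of \<open>L\<^bsub>p,D\<^esub>\<close> in \<open>D\<close> is needed, and positive definite matrices suffice.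

  The Efron-Stein inequality makes the variances summable along \<open>N = k\<^sup>4\<close>, and a monotonicity in \<open>N\<close>
  of the rescaled maximum fills the gaps. Scaling the spins reduces every \<open>t > 0\<close> to \<open>t = 1\<close>.
\<close>

section \<open>Standard Gaussian measure on the line\<close>

text \<open>All the random maxima that are compared or averaged below (constrained, truncated,
  spherical) are suprema of affine forms in finitely many Gaussians, so Slepian's inequality,
  measurability and the variance bound are proved once, for \<open>affine_sup\<close>. The
  unconstrained maximum has unbounded coefficients. It enters only after a truncation: along large
  fourth powers the quadratic form on the unit sphere is almost surely at most
  \<open>3 * sqrt N\<close>, and since p > 2 the penalty then wins once it exceeds a fixed multiple
  of N. Fekete's lemma yields more than a limit: at every size N \<ge> kappa the mean is at most N
  times the limit. This non-asymptotic bound is what lets the finite net in the upper bound consist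
  of arbitrary positive definite matrices. The power 4 comes from the fluctuations: the Efron-Stein
  sum contains the largest of N^2 squared Gaussian differences, controlled by eighth moments at the
  price of a factor \<open>sqrt N\<close>. The maximum divided by N thus has variance of order
  N^(-1/2), which is k^(-2) at N = k^4.\<close>

definition std_gauss :: "real measure" where
  "std_gauss = density lborel (\<lambda>x. ennreal (std_normal_density x))"

lemma prob_space_std_gauss: "prob_space std_gauss"
  unfolding std_gauss_def by (rule prob_space_normal_density) simp

interpretation std_gauss: prob_space std_gauss
  by (rule prob_space_std_gauss)

lemma sets_std_gauss [simp, measurable_cong]: "sets std_gauss = sets borel"
  and space_std_gauss [simp]: "space std_gauss = UNIV"
  by (simp_all add: std_gauss_def)

lemma measurable_std_gauss:
  "measurable std_gauss N = measurable borel N" "measurable N std_gauss = measurable N borel"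
  by (rule measurable_cong_sets; simp)+

lemma integral_std_gauss:
  fixes f :: "real \<Rightarrow> real"
  assumes "f \<in> borel_measurable borel"
  shows "integral\<^sup>L std_gauss f = (LINT x|lborel. std_normal_density x * f x)"
  unfolding std_gauss_def using assms by (subst integral_real_density)
      (auto cong: measurable_cong_sets)

lemma integrable_std_gauss:
  fixes f :: "real \<Rightarrow> real"
  assumes "f \<in> borel_measurable borel"
  shows "integrable std_gauss f \<longleftrightarrow> integrable lborel (\<lambda>x. std_normal_density x * f x)"
  unfolding std_gauss_def using assms by (subst integrable_real_density)
      (auto cong: measurable_cong_sets)

lemma std_gauss_moment [simp, intro]:
  "integrable std_gauss (\<lambda>z. \<bar>z\<bar> ^ k)" "integrable std_gauss (\<lambda>z. z ^ k)"
  by (simp_all add: integrable_std_gauss integrable_std_normal_moment_abs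
      integrable_std_normal_moment)

lemma integrable_std_gauss_id [simp, intro]:
  "integrable std_gauss (\<lambda>z. z)" "integrable std_gauss (\<lambda>z. \<bar>z\<bar>)"
  using std_gauss_moment(2) [of 1] std_gauss_moment(1) [of 1] by simp_all

lemma std_gauss_mean: "(LINT z|std_gauss. z) = 0"
  using integral_std_normal_moment_odd [of 0] by (simp add: integral_std_gauss)

lemma std_gauss_second_moment: "(LINT z|std_gauss. z\<^sup>2) = 1"
  using integral_std_normal_moment_even [of 1] by (simp add: integral_std_gauss)

lemma distr_std_gauss_fst: "distr (std_gauss \<Otimes>\<^sub>M std_gauss) std_gauss fst = std_gauss"
  by (simp add: std_gauss.distr_pair_fst std_gauss.emeasure_space_1)

lemma distr_std_gauss_snd: "distr (std_gauss \<Otimes>\<^sub>M std_gauss) std_gauss snd = std_gauss"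
proof -
  interpret P: pair_prob_space std_gauss std_gauss ..
  have "distr (std_gauss \<Otimes>\<^sub>M std_gauss) std_gauss snd
      = distr (distr (std_gauss \<Otimes>\<^sub>M std_gauss) (std_gauss \<Otimes>\<^sub>M std_gauss) (\<lambda>(x, y). (y, x)))
          std_gauss snd"
    using P.distr_pair_swap by simp
  also have "\<dots> = distr (std_gauss \<Otimes>\<^sub>M std_gauss) std_gauss fst"
    by (subst distr_distr) (auto simp: o_def case_prod_unfold)
  finally show ?thesis using distr_std_gauss_fst by simp
qed

text \<open>Stability of the normal law: independent Gaussians of standard deviations a and b add up
  to one of standard deviation \<open>sqrt (a\<^sup>2 + b\<^sup>2)\<close>. This becomes the
  semigroup law of \<open>gauss_shift\<close>.\<close>

lemma std_gauss_add:
  fixes f :: "real \<Rightarrow> real"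
  assumes f: "f \<in> borel_measurable borel" and ab: "a \<ge> 0" "b \<ge> 0"
  shows "(LINT u|(std_gauss \<Otimes>\<^sub>M std_gauss). f (a * fst u + b * snd u))
       = (LINT z|std_gauss. f (sqrt (a\<^sup>2 + b\<^sup>2) * z))"
proof -
  interpret P: pair_prob_space std_gauss std_gauss ..
  note fst = distr_std_gauss_fst and snd = distr_std_gauss_snd
  have dist: "distributed (std_gauss \<Otimes>\<^sub>M std_gauss) lborel X std_normal_density"
    if "distr (std_gauss \<Otimes>\<^sub>M std_gauss) std_gauss X = std_gauss"
        "X \<in> borel_measurable (std_gauss \<Otimes>\<^sub>M std_gauss)" for X
    using that unfolding distributed_def
    by (simp add: std_gauss_def [symmetric] cong: distr_cong) 
  have F: "distributed (std_gauss \<Otimes>\<^sub>M std_gauss) lborel fst std_normal_density"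
    and S: "distributed (std_gauss \<Otimes>\<^sub>M std_gauss) lborel snd std_normal_density"
    using fst snd by (auto intro!: dist)
  have ind: "P.indep_var borel fst borel snd"
    unfolding P.indep_var_distribution_eq
  proof (intro conjI)
    have "distr (std_gauss \<Otimes>\<^sub>M std_gauss) borel fst = std_gauss"
        "distr (std_gauss \<Otimes>\<^sub>M std_gauss) borel snd = std_gauss"
      using fst snd by (simp_all cong: distr_cong)
    moreover have "distr (std_gauss \<Otimes>\<^sub>M std_gauss) (borel \<Otimes>\<^sub>M borel) (\<lambda>x. (fst x, snd x))
        = std_gauss \<Otimes>\<^sub>M std_gauss"
      unfolding prod.collapse by (rule distr_id2) (rule sets_pair_measure_cong; simp)
    ultimately show "distr (std_gauss \<Otimes>\<^sub>M std_gauss) borel fst \<Otimes>\<^sub>M distr (std_gauss \<Otimes>\<^sub>M std_gauss)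
        borel snd =
      distr (std_gauss \<Otimes>\<^sub>M std_gauss) (borel \<Otimes>\<^sub>M borel) (\<lambda>x. (fst x, snd x))" by simp
  qed auto
  have scale: "distributed N lborel (\<lambda>x. c * X x) (normal_density 0 c)" 
    if "prob_space N" "distributed N lborel X std_normal_density" "c > 0" for c N and X ::
        "_ \<Rightarrow> real"
    using prob_space.normal_density_affine [of N X 0 1 c 0] that by simp
  have via: "(LINT u|N. f (Y u)) = (LINT z|std_gauss. f (c * z))"
    if N: "prob_space N" "distributed N lborel Y (normal_density 0 c)" "c > 0" for c N and Y ::
        "_ \<Rightarrow> real"
  proof -
    have id: "distributed std_gauss lborel (\<lambda>z. z) std_normal_density"
      unfolding distributed_def std_gauss_def [symmetric]
      using distr_id2 [of lborel std_gauss] by (auto cong: measurable_cong_sets)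
    have 2: "distributed std_gauss lborel (\<lambda>z. c * z) (normal_density 0 c)"
      by (rule scale [OF prob_space_std_gauss id \<open>c > 0\<close>])
    have "(LINT u|N. f (Y u)) = (LINT x|lborel. normal_density 0 c x * f x)"
      using distributed_integral [OF N(2), of f] f by simp
    also have "\<dots> = (LINT z|std_gauss. f (c * z))"
      using distributed_integral [OF 2, of f] f by simp
    finally show ?thesis .
  qed
  show ?thesis
  \<comment> \<open>A normal density needs a positive standard deviation, so a vanishing coefficient
    is treated through the marginals.\<close>
  proof (cases "a = 0 \<or> b = 0")
    case True
    have "(LINT u|(std_gauss \<Otimes>\<^sub>M std_gauss). f (c * X u)) = (LINT z|std_gauss. f (c * z))"
      if "distr (std_gauss \<Otimes>\<^sub>M std_gauss) std_gauss X = std_gauss"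
          "X \<in> borel_measurable (std_gauss \<Otimes>\<^sub>M std_gauss)" for X c
    proof -
      have "(LINT z|std_gauss. f (c * z)) = (LINT z|distr (std_gauss \<Otimes>\<^sub>M std_gauss) std_gauss X. f
          (c * z))"
        using that by simp
      also have "\<dots> = (LINT u|(std_gauss \<Otimes>\<^sub>M std_gauss). f (c * X u))"
        using f that(2) by (intro integral_distr) (auto cong: measurable_cong_sets)
      finally show ?thesis by simp
    qed
    from this [OF fst] this [OF snd] True show ?thesis using ab by auto
  next
    case False
    then have ab: "a > 0" "b > 0" using ab by auto
    have "P.indep_var borel ((\<lambda>x. a * x) \<circ> fst) borel ((\<lambda>x. b * x) \<circ> snd)"
      by (rule P.indep_var_compose [OF ind]) auto
    then have "distributed (std_gauss \<Otimes>\<^sub>M std_gauss) lborel (\<lambda>x. a * fst x + b * snd x)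
        (normal_density (0 + 0) (sqrt (a\<^sup>2 + b\<^sup>2)))"
      by (intro P.add_indep_normal scale P.prob_space_axioms F S ab) (auto simp: o_def)
    from via [OF P.prob_space_axioms this [simplified]] show ?thesis using ab by
        (simp add: sum_power2_gt_zero_iff)
  qed
qed

section \<open>Gaussian averaging operators\<close>

text \<open>An l1-Lipschitz condition that also forces F to depend only on the coordinates in S. It
  gives continuity along lines, hence measurability, and linear growth, hence Gaussian
  integrability, and Gaussian averaging preserves it with the same constant.\<close>

definition coord_lipschitz :: "'s set \<Rightarrow> real \<Rightarrow> (('s \<Rightarrow> real) \<Rightarrow> real) \<Rightarrow> bool" where
  "coord_lipschitz S C F \<longleftrightarrow> (\<forall>x y. \<bar>F x - F y\<bar> \<le> C * (\<Sum>s\<in>S. \<bar>x s - y s\<bar>))"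

text \<open>The heat semigroup in the single direction v, at time h^2.\<close>

definition gauss_shift :: "real \<Rightarrow> ('s \<Rightarrow> real) \<Rightarrow> (('s \<Rightarrow> real) \<Rightarrow> real) \<Rightarrow> ('s \<Rightarrow> real) \<Rightarrow> real" where
  "gauss_shift h v F x = (LINT z|std_gauss. F (\<lambda>s. x s + h * z * v s))"

text \<open>Averaging over a Gaussian vector whose covariance is h^2 times the sum of the rank-one
  matrices of the listed directions. Taking one direction at a time keeps all integrals
  one-dimensional.\<close>

definition gauss_shifts ::
  "real \<Rightarrow> ('s \<Rightarrow> real) list \<Rightarrow> (('s \<Rightarrow> real) \<Rightarrow> real) \<Rightarrow> ('s \<Rightarrow> real) \<Rightarrow> real" where
  "gauss_shifts h vs F = foldr (gauss_shift h) vs F"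

lemma gauss_shifts_simps [simp]:
  "gauss_shifts h [] F = F"
  "gauss_shifts h (v # vs) F = gauss_shift h v (gauss_shifts h vs F)"
  by (simp_all add: gauss_shifts_def)

lemma coord_lipschitz_line:
  assumes "coord_lipschitz S C F"
  shows "\<bar>F (\<lambda>s. x s + a * v s) - F (\<lambda>s. x s + b * v s)\<bar> \<le> C * (\<Sum>s\<in>S. \<bar>v s\<bar>) * \<bar>a - b\<bar>"
proof -
  have "\<bar>F (\<lambda>s. x s + a * v s) - F (\<lambda>s. x s + b * v s)\<bar>
      \<le> C * (\<Sum>s\<in>S. \<bar>(x s + a * v s) - (x s + b * v s)\<bar>)"
    using assms unfolding coord_lipschitz_def by blast
  also have "(\<Sum>s\<in>S. \<bar>(x s + a * v s) - (x s + b * v s)\<bar>) = (\<Sum>s\<in>S. \<bar>v s\<bar>) * \<bar>a - b\<bar>"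
    by (simp add: sum_distrib_right flip: abs_mult) (simp add: algebra_simps)
  finally show ?thesis by simp
qed

lemma coord_lipschitz_continuous:
  assumes F: "coord_lipschitz S C F" and xy: "\<And>s. s \<in> S \<Longrightarrow> continuous_on A (\<lambda>u. X u s)" and
      "finite S"
  shows "continuous_on A (\<lambda>u::'b::topological_space. F (X u))"
  unfolding continuous_on_def
proof
  fix u assume "u \<in> A"
  have "((\<lambda>w. C * (\<Sum>s\<in>S. \<bar>X w s - X u s\<bar>)) \<longlongrightarrow> C * (\<Sum>s\<in>S. \<bar>X u s - X u s\<bar>)) (at u within A)"
    using xy \<open>u \<in> A\<close> unfolding continuous_on_def by (intro tendsto_intros) auto
  then have 0: "((\<lambda>w. C * (\<Sum>s\<in>S. \<bar>X w s - X u s\<bar>)) \<longlongrightarrow> 0) (at u within A)" by simp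
  show "((\<lambda>w. F (X w)) \<longlongrightarrow> F (X u)) (at u within A)"
    by (rule LIM_zero_cancel, rule Lim_null_comparison [OF _ 0])
       (use F in \<open>auto simp: coord_lipschitz_def\<close>)
qed

lemma gauss_shift_integrable:
  assumes "coord_lipschitz S C F" "finite S"
  shows "integrable std_gauss (\<lambda>z. F (\<lambda>s. x s + h * z * v s))"
proof (rule Bochner_Integration.integrable_bound)
  show "integrable std_gauss (\<lambda>z. \<bar>F x\<bar> + C * (\<Sum>s\<in>S. \<bar>v s\<bar>) * \<bar>h\<bar> * \<bar>z\<bar>)"
    by (intro Bochner_Integration.integrable_add integrable_mult_right) auto
  have "continuous_on UNIV (\<lambda>z. F (\<lambda>s. x s + h * z * v s))"
    by (rule coord_lipschitz_continuous [OF assms(1) _ assms(2)]) (intro continuous_intros)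
  then show "(\<lambda>z. F (\<lambda>s. x s + h * z * v s)) \<in> borel_measurable std_gauss"
    by (simp add: borel_measurable_continuous_onI cong: measurable_cong_sets)
  have "\<bar>F (\<lambda>s. x s + h * z * v s)\<bar> \<le> \<bar>F x\<bar> + C * (\<Sum>s\<in>S. \<bar>v s\<bar>) * \<bar>h\<bar> * \<bar>z\<bar>" for z
    using coord_lipschitz_line [OF assms(1), of x "h * z" v 0] by (simp add: abs_mult)
  then show "AE z in std_gauss. norm (F (\<lambda>s. x s + h * z * v s)) \<le> norm (\<bar>F x\<bar>
      + C * (\<Sum>s\<in>S. \<bar>v s\<bar>) * \<bar>h\<bar> * \<bar>z\<bar>)"
    by (intro AE_I2) (metis abs_ge_self order_trans real_norm_def)
qed

lemma coord_lipschitz_gauss_shift: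
  assumes F: "coord_lipschitz S C F" "finite S"
  shows "coord_lipschitz S C (gauss_shift h v F)"
  unfolding coord_lipschitz_def
proof (intro allI)
  fix x y
  have "\<bar>gauss_shift h v F x - gauss_shift h v F y\<bar>
      = \<bar>LINT z|std_gauss. F (\<lambda>s. x s + h * z * v s) - F (\<lambda>s. y s + h * z * v s)\<bar>"
    unfolding gauss_shift_def
    by (subst Bochner_Integration.integral_diff) (auto intro: gauss_shift_integrable F)
  also have "\<dots> \<le> (LINT z|std_gauss. \<bar>F (\<lambda>s. x s + h * z * v s) - F (\<lambda>s. y s + h * z * v s)\<bar>)"
    by (rule integral_abs_bound)
  also have "\<dots> \<le> (LINT z|std_gauss. C * (\<Sum>s\<in>S. \<bar>x s - y s\<bar>))"
  proof (rule integral_mono)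
    fix z
    have "\<bar>F (\<lambda>s. x s + h * z * v s) - F (\<lambda>s. y s + h * z * v s)\<bar>
      \<le> C * (\<Sum>s\<in>S. \<bar>(x s + h * z * v s) - (y s + h * z * v s)\<bar>)"
      using F unfolding coord_lipschitz_def by blast
    then show "\<bar>F (\<lambda>s. x s + h * z * v s) - F (\<lambda>s. y s + h * z * v s)\<bar> \<le> C * (\<Sum>s\<in>S. \<bar>x s - y s\<bar>)"
      by simp
  qed (auto intro!: integrable_abs Bochner_Integration.integrable_diff gauss_shift_integrable F)
  also have "\<dots> = C * (\<Sum>s\<in>S. \<bar>x s - y s\<bar>)" using std_gauss.prob_space by simp
  finally show "\<bar>gauss_shift h v F x - gauss_shift h v F y\<bar> \<le> C * (\<Sum>s\<in>S. \<bar>x s - y s\<bar>)" .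
qed

lemma coord_lipschitz_gauss_shifts:
  assumes F: "coord_lipschitz S C F" "finite S"
  shows "coord_lipschitz S C (gauss_shifts h vs F)"
  by (induction vs) (use assms coord_lipschitz_gauss_shift in auto)

lemma sets_pair_std_gauss: "sets (std_gauss \<Otimes>\<^sub>M std_gauss) = sets borel"
  unfolding borel_prod [symmetric] by (rule sets_pair_measure_cong) simp_all

lemma gauss_shift_pair_integrable:
  assumes F: "coord_lipschitz S C F" "finite S" and C: "C \<ge> 0"
  shows "integrable (std_gauss \<Otimes>\<^sub>M std_gauss) (\<lambda>u. F (\<lambda>s. x s + a * fst u * v s + b * snd u * w s))"
proof (rule Bochner_Integration.integrable_bound)
  have 1: "integrable (std_gauss \<Otimes>\<^sub>M std_gauss) (\<lambda>u. \<bar>fst u\<bar>)"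
    by (rule integrable_distr [of fst _ std_gauss]) (simp_all add: distr_std_gauss_fst)
  have 2: "integrable (std_gauss \<Otimes>\<^sub>M std_gauss) (\<lambda>u. \<bar>snd u\<bar>)"
    by (rule integrable_distr [of snd _ std_gauss]) (simp_all add: distr_std_gauss_snd)
  interpret P: pair_prob_space std_gauss std_gauss ..
  let ?B = "\<lambda>u. \<bar>F x\<bar> + C * (\<Sum>s\<in>S. \<bar>a * v s\<bar> * \<bar>fst u\<bar> + \<bar>b * w s\<bar> * \<bar>snd u\<bar>)"
  show "integrable (std_gauss \<Otimes>\<^sub>M std_gauss) ?B"
    by (intro Bochner_Integration.integrable_add integrable_mult_right
        Bochner_Integration.integrable_sum 1 2) auto
  have "continuous_on UNIV (\<lambda>u. F (\<lambda>s. x s + a * fst u * v s + b * snd u * w s))"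
    by (rule coord_lipschitz_continuous [OF F(1) _ F(2)]) (intro continuous_intros)
  then have "(\<lambda>u. F (\<lambda>s. x s + a * fst u * v s + b * snd u * w s)) \<in> borel_measurable borel"
    by (rule borel_measurable_continuous_onI)
  then show "(\<lambda>u. F (\<lambda>s. x s + a * fst u * v s + b * snd u * w s)) \<in> borel_measurable (std_gauss \<Otimes>\<^sub>M
      std_gauss)"
    unfolding measurable_cong_sets [OF sets_pair_std_gauss refl] .
  have "\<bar>F (\<lambda>s. x s + a * fst u * v s + b * snd u * w s)\<bar> \<le> ?B u" for u
  proof -
    have "\<bar>F (\<lambda>s. x s + a * fst u * v s + b * snd u * w s) - F x\<bar>
        \<le> C * (\<Sum>s\<in>S. \<bar>(x s + a * fst u * v s + b * snd u * w s) - x s\<bar>)"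
      using F(1) unfolding coord_lipschitz_def by blast
    also have "\<dots> \<le> C * (\<Sum>s\<in>S. \<bar>a * v s\<bar> * \<bar>fst u\<bar> + \<bar>b * w s\<bar> * \<bar>snd u\<bar>)"
    proof (intro mult_left_mono sum_mono)
      fix s
      have "\<bar>x s + a * fst u * v s + b * snd u * w s - x s\<bar> \<le> \<bar>a * fst u * v s\<bar> + \<bar>b * snd u * w s\<bar>"
          by linarith
      then show "\<bar>x s + a * fst u * v s + b * snd u * w s - x s\<bar> \<le> \<bar>a * v s\<bar> * \<bar>fst u\<bar>
          + \<bar>b * w s\<bar> * \<bar>snd u\<bar>"
        by (simp add: abs_mult mult_ac)
    qed (fact C)
    finally show ?thesis by linarith
  qed
  then show "AE u in std_gauss \<Otimes>\<^sub>M std_gauss. norm (F (\<lambda>s. x s + a * fst u * v s + b * snd u * w s))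
      \<le> norm (?B u)"
    by (intro AE_I2) (simp only: real_norm_def, rule order_trans [OF _ abs_ge_self])
qed

text \<open>As an integral over the product measure, commutation of two averages is Fubini's theorem
  and their composition in one direction is \<open>std_gauss_add\<close>.\<close>

lemma gauss_shift_pair:
  assumes F: "coord_lipschitz S C F" "finite S" "C \<ge> 0"
  shows "gauss_shift a v (gauss_shift b w F) x
       = (LINT u|(std_gauss \<Otimes>\<^sub>M std_gauss). F (\<lambda>s. x s + a * fst u * v s + b * snd u * w s))"
proof -
  interpret P: pair_prob_space std_gauss std_gauss ..
  show ?thesis
    unfolding gauss_shift_def
    using P.integral_fst' [OF gauss_shift_pair_integrable [OF F, of x a v b w]] by simp
qed

lemma gauss_shift_commute:
  assumes F: "coord_lipschitz S C F" "finite S" "C \<ge> 0"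
  shows "gauss_shift a v (gauss_shift b w F) = gauss_shift b w (gauss_shift a v F)"
proof
  fix x
  interpret P: pair_prob_space std_gauss std_gauss ..
  show "gauss_shift a v (gauss_shift b w F) x = gauss_shift b w (gauss_shift a v F) x"
    unfolding gauss_shift_pair [OF F]
    using P.integral_product_swap [OF borel_measurable_integrable [OF gauss_shift_pair_integrable
        [OF F, of x a v b w]]]
    by (simp add: case_prod_unfold add.assoc add.commute [of "b * _ * _"])
qed

lemma gauss_shift_add:
  assumes F: "coord_lipschitz S C F" "finite S" "C \<ge> 0" and ab: "a \<ge> 0" "b \<ge> 0"
  shows "gauss_shift a v (gauss_shift b v F) = gauss_shift (sqrt (a\<^sup>2 + b\<^sup>2)) v F"
proof
  fix x
  have m: "(\<lambda>r. F (\<lambda>s. x s + r * v s)) \<in> borel_measurable borel"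
    by (intro borel_measurable_continuous_onI coord_lipschitz_continuous [OF F(1) _ F(2)]
        continuous_intros)
  show "gauss_shift a v (gauss_shift b v F) x = gauss_shift (sqrt (a\<^sup>2 + b\<^sup>2)) v F x"
    unfolding gauss_shift_pair [OF F] using std_gauss_add [OF m ab]
    by (simp add: gauss_shift_def distrib_right add.assoc)
qed

lemma gauss_shift_mono:
  assumes F: "coord_lipschitz S C F" "coord_lipschitz S D G" "finite S" and le: "\<And>x. F x \<le> G x + c"
  shows "gauss_shift h v F x \<le> gauss_shift h v G x + c"
proof -
  have "gauss_shift h v F x \<le> (LINT z|std_gauss. G (\<lambda>s. x s + h * z * v s) + c)"
    unfolding gauss_shift_def
    by (intro integral_mono le Bochner_Integration.integrable_add gauss_shift_integrable [OF F(1,3)]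
        gauss_shift_integrable [OF F(2,3)]) auto
  also have "\<dots> = gauss_shift h v G x + c"
    unfolding gauss_shift_def
    by (subst Bochner_Integration.integral_add) (use std_gauss.prob_space gauss_shift_integrable [OF
        F(2,3)] in auto)
  finally show ?thesis .
qed

lemma gauss_shifts_mono:
  assumes F: "coord_lipschitz S C F" "coord_lipschitz S D G" "finite S" and le: "\<And>x. F x \<le> G x + c"
  shows "gauss_shifts h vs F x \<le> gauss_shifts h vs G x + c"
proof (induction vs arbitrary: x)
  case (Cons v vs)
  show ?case
    using gauss_shift_mono [OF coord_lipschitz_gauss_shifts coord_lipschitz_gauss_shifts, OF F(1,3)
        F(2,3) F(3) Cons.IH]
    by simp
qed (use le in simp)

lemma gauss_shift_gauss_shifts_commute:
  assumes F: "coord_lipschitz S C F" "finite S" "C \<ge> 0"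
  shows "gauss_shift a v (gauss_shifts b ws F) = gauss_shifts b ws (gauss_shift a v F)"
proof (induction ws)
  case (Cons w ws)
  show ?case
    using gauss_shift_commute [OF coord_lipschitz_gauss_shifts, OF F(1,2) F(2,3), of a v b w]
        Cons.IH by simp
qed simp

lemma gauss_shifts_commute:
  assumes F: "coord_lipschitz S C F" "finite S" "C \<ge> 0"
  shows "gauss_shifts a vs (gauss_shifts b ws F) = gauss_shifts b ws (gauss_shifts a vs F)"
proof (induction vs)
  case (Cons v vs)
  show ?case
    using gauss_shift_gauss_shifts_commute [OF coord_lipschitz_gauss_shifts, OF F(1,2) F(2,3), of a
        v b ws] Cons.IH by simp
qed simp

lemma gauss_shifts_add:
  assumes F: "coord_lipschitz S C F" "finite S" "C \<ge> 0" and ab: "a \<ge> 0" "b \<ge> 0"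
  shows "gauss_shifts a vs (gauss_shifts b vs F) = gauss_shifts (sqrt (a\<^sup>2 + b\<^sup>2)) vs F"
proof (induction vs)
  case (Cons v vs)
  have "gauss_shifts a (v # vs) (gauss_shifts b (v # vs) F)
      = gauss_shift a v (gauss_shift b v (gauss_shifts a vs (gauss_shifts b vs F)))"
    using gauss_shift_gauss_shifts_commute [OF coord_lipschitz_gauss_shifts, OF F(1,2) F(2,3), of b
        v a vs] by simp
  also have "\<dots> = gauss_shift (sqrt (a\<^sup>2 + b\<^sup>2)) v (gauss_shifts a vs (gauss_shifts b vs F))"
    by (rule gauss_shift_add [OF coord_lipschitz_gauss_shifts [OF coord_lipschitz_gauss_shifts], OF
        F(1,2,2,2,3) ab])
  finally show ?case using Cons.IH by simp
qed simp

lemma gauss_shifts_0: "gauss_shifts 0 vs F = F"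
proof (induction vs)
  case (Cons v vs)
  then show ?case using std_gauss.prob_space by (simp add: gauss_shift_def [abs_def])
qed simp

text \<open>The semigroup property turns a comparison over a short time into one over a long time.\<close>

lemma gauss_shifts_compare_iterate:
  assumes F: "coord_lipschitz S C F" "finite S" "C \<ge> 0" and h: "h \<ge> 0"
    and le: "\<And>x. gauss_shifts h bs F x \<le> gauss_shifts h as F x + e"
  shows "gauss_shifts (sqrt n * h) bs F x \<le> gauss_shifts (sqrt n * h) as F x + real n * e"
proof (induction n arbitrary: x)
  case 0
  show ?case by (simp add: gauss_shifts_0)
next
  case (Suc n)
  have sq: "sqrt (Suc n) * h = sqrt (h\<^sup>2 + (sqrt n * h)\<^sup>2)"
  proof -
    have "h\<^sup>2 + (sqrt n * h)\<^sup>2 = real (Suc n) * h\<^sup>2"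
      by (simp add: power_mult_distrib distrib_right)
    then show ?thesis using h by (metis real_sqrt_mult real_sqrt_abs abs_of_nonneg)
  qed
  have L: "coord_lipschitz S C (gauss_shifts t vs F)" for t vs
    by (intro coord_lipschitz_gauss_shifts F)
  have st: "gauss_shifts (sqrt (Suc n) * h) vs F = gauss_shifts h vs (gauss_shifts (sqrt n * h) vs
      F)" for vs
    unfolding sq by (rule gauss_shifts_add [OF F h, symmetric]) (simp add: h)
  have 1: "gauss_shifts (sqrt (Suc n) * h) bs F x \<le> gauss_shifts h bs (gauss_shifts (sqrt n * h) as
      F) x + real n * e"
    unfolding st by (rule gauss_shifts_mono [OF L L F(2) Suc.IH])
  \<comment> \<open>The short step along \<open>bs\<close> is moved inside the long average along
    \<open>as\<close>, where it acts on F itself and the hypothesis applies. Monotonicity then adds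
    just one more e.\<close>
  have 2: "gauss_shifts h bs (gauss_shifts (sqrt n * h) as F) x
      = gauss_shifts (sqrt n * h) as (gauss_shifts h bs F) x"
    by (rule fun_cong [OF gauss_shifts_commute [OF F]])
  have 3: "gauss_shifts (sqrt n * h) as (gauss_shifts h bs F) x
      \<le> gauss_shifts (sqrt n * h) as (gauss_shifts h as F) x + e"
    by (rule gauss_shifts_mono [OF L L F(2) le])
  have 4: "gauss_shifts (sqrt n * h) as (gauss_shifts h as F) x
      = gauss_shifts (sqrt (Suc n) * h) as F x"
    unfolding st by (rule fun_cong [OF gauss_shifts_commute [OF F]])
  have 5: "real (Suc n) * e = real n * e + e" by (simp add: distrib_right)
  show ?case using 1 2 3 4 unfolding 5 by linarith
qed

section \<open>The log-sum-exp function\<close>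

definition log_sum_exp :: "'s set \<Rightarrow> ('s \<Rightarrow> real) \<Rightarrow> real" where
  "log_sum_exp S x = ln (\<Sum>s\<in>S. exp (x s))"

text \<open>The Gibbs average of f, which is the derivative of \<open>log_sum_exp\<close> at x in
  direction f; \<open>gibbs_var\<close> is the second derivative in that direction.\<close>

definition gibbs :: "'s set \<Rightarrow> ('s \<Rightarrow> real) \<Rightarrow> ('s \<Rightarrow> real) \<Rightarrow> real" where
  "gibbs S x f = (\<Sum>s\<in>S. exp (x s) * f s) / (\<Sum>s\<in>S. exp (x s))"

definition gibbs_var :: "'s set \<Rightarrow> ('s \<Rightarrow> real) \<Rightarrow> ('s \<Rightarrow> real) \<Rightarrow> real" where
  "gibbs_var S x f = gibbs S x (\<lambda>s. (f s)\<^sup>2) - (gibbs S x f)\<^sup>2"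

context
  fixes S :: "'s set"
  assumes S: "finite S" "S \<noteq> {}"
begin

lemma partition_pos: "(\<Sum>s\<in>S. exp (x s :: real)) > 0"
  using S by (intro sum_pos) auto

lemma gibbs_bound:
  assumes "\<And>s. s \<in> S \<Longrightarrow> \<bar>f s\<bar> \<le> c"
  shows "\<bar>gibbs S x f\<bar> \<le> c"
proof -
  have "\<bar>\<Sum>s\<in>S. exp (x s) * f s\<bar> \<le> (\<Sum>s\<in>S. exp (x s) * c)"
    by (rule order_trans [OF sum_abs]) (intro sum_mono, simp add: abs_mult assms)
  then show ?thesis
    unfolding gibbs_def abs_divide abs_of_pos [OF partition_pos] using partition_pos [of x]
    by (simp add: pos_divide_le_eq sum_distrib_left mult.commute)
qed

lemma DERIV_log_sum_exp_line:
  "((\<lambda>r. log_sum_exp S (\<lambda>s. x s + r * v s)) has_real_derivative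
     gibbs S (\<lambda>s. x s + r * v s) v) (at r)"
  unfolding log_sum_exp_def gibbs_def
  by (rule derivative_eq_intros partition_pos | simp add: partition_pos)+

lemma DERIV_gibbs_line:
  "((\<lambda>r. gibbs S (\<lambda>s. x s + r * v s) f) has_real_derivative
     gibbs S (\<lambda>s. x s + r * v s) (\<lambda>s. f s * v s)
     - gibbs S (\<lambda>s. x s + r * v s) f * gibbs S (\<lambda>s. x s + r * v s) v) (at r)"
proof -
  let ?e = "\<lambda>r s. exp (x s + r * v s)"
  have Z: "(\<Sum>s\<in>S. ?e r s) \<noteq> 0" using partition_pos by (metis less_irrefl)
  have 1: "((\<lambda>r. \<Sum>s\<in>S. ?e r s * f s) has_real_derivative (\<Sum>s\<in>S. ?e r s * (f s * v s))) (at r)"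
    by (auto intro!: derivative_eq_intros sum.cong simp: mult_ac)
  have 2: "((\<lambda>r. \<Sum>s\<in>S. ?e r s) has_real_derivative (\<Sum>s\<in>S. ?e r s * v s)) (at r)"
    by (auto intro!: derivative_eq_intros sum.cong simp: mult_ac)
  show ?thesis
    unfolding gibbs_def
    by (rule DERIV_cong [OF DERIV_divide [OF 1 2 Z]]) (use Z in \<open>simp add: field_simps
        power2_eq_square\<close>)
qed

lemma DERIV_gibbs_var_line:
  fixes x v w r
  defines "E \<equiv> gibbs S (\<lambda>s. x s + r * v s)"
  shows "((\<lambda>r. gibbs_var S (\<lambda>s. x s + r * v s) w) has_real_derivative
     E (\<lambda>s. (w s)\<^sup>2 * v s) - E (\<lambda>s. (w s)\<^sup>2) * E v - 2 * E w * (E (\<lambda>s. w s * v s)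
         - E w * E v)) (at r)"
  unfolding gibbs_var_def E_def
  by (rule derivative_eq_intros DERIV_gibbs_line refl | simp)+

text \<open>The terms contribute 1 + 1 + 4 multiples of W^2 V. For w = v this is the third
  derivative of \<open>log_sum_exp\<close>; its bound does not depend on the base point, which the
  iteration of short steps requires.\<close>

lemma gibbs_var_deriv_bound:
  fixes x v w r
  defines "E \<equiv> gibbs S (\<lambda>s. x s + r * v s)"
  assumes w: "\<And>s. s \<in> S \<Longrightarrow> \<bar>w s\<bar> \<le> W" and v: "\<And>s. s \<in> S \<Longrightarrow> \<bar>v s\<bar> \<le> V"
  shows "\<bar>E (\<lambda>s. (w s)\<^sup>2 * v s) - E (\<lambda>s. (w s)\<^sup>2) * E v - 2 * E w * (E (\<lambda>s. w s * v s) - E w * E v)\<bar>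
      \<le> 6 * W\<^sup>2 * V"
proof -
  obtain s0 where "s0 \<in> S" using S by auto
  have W0: "W \<ge> 0" using w [OF \<open>s0 \<in> S\<close>] by linarith
  have w2: "\<bar>(w s)\<^sup>2\<bar> \<le> W\<^sup>2" if "s \<in> S" for s
    using w [OF that] W0 by (simp add: abs_le_square_iff [symmetric])
  have a: "\<bar>E (\<lambda>s. (w s)\<^sup>2 * v s)\<bar> \<le> W\<^sup>2 * V"
    unfolding E_def by (rule gibbs_bound) (metis abs_mult mult_mono' w2 v abs_ge_zero)
  have b: "\<bar>E (\<lambda>s. (w s)\<^sup>2) * E v\<bar> \<le> W\<^sup>2 * V"
    unfolding E_def abs_mult by (intro mult_mono gibbs_bound w2 v) auto
  have wv: "\<bar>E (\<lambda>s. w s * v s)\<bar> \<le> W * V"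
    unfolding E_def by (rule gibbs_bound) (metis abs_mult mult_mono' w v abs_ge_zero)
  have ev: "\<bar>E w * E v\<bar> \<le> W * V"
    unfolding E_def abs_mult by (intro mult_mono gibbs_bound w v) (use W0 in auto)
  have "\<bar>E w * (E (\<lambda>s. w s * v s) - E w * E v)\<bar> \<le> W * (2 * (W * V))"
    unfolding abs_mult
    by (intro mult_mono) (use wv ev W0 in \<open>auto simp: E_def intro: gibbs_bound w\<close>)
  then have c: "\<bar>2 * E w * (E (\<lambda>s. w s * v s) - E w * E v)\<bar> \<le> 4 * (W\<^sup>2 * V)"
    unfolding mult.assoc [of 2] abs_mult [of 2] by (simp add: power2_eq_square mult_ac)
  show ?thesis using a b c by linarith
qed

lemma gibbs_var_lipschitz:
  assumes w: "\<And>s. s \<in> S \<Longrightarrow> \<bar>w s\<bar> \<le> W"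
  shows "\<bar>gibbs_var S y w - gibbs_var S x w\<bar> \<le> 6 * W\<^sup>2 * (\<Sum>s\<in>S. \<bar>y s - x s\<bar>)"
proof -
  define v where "v s = y s - x s" for s
  let ?f = "\<lambda>r. gibbs_var S (\<lambda>s. x s + r * v s) w"
  have v: "\<bar>v s\<bar> \<le> (\<Sum>s\<in>S. \<bar>y s - x s\<bar>)" if "s \<in> S" for s
    unfolding v_def using that S by (intro member_le_sum) auto
  have "\<exists>z. 0 < z \<and> z < 1 \<and> ?f 1 - ?f 0 = (1 - 0) *
     (let E = gibbs S (\<lambda>s. x s + z * v s) in
       E (\<lambda>s. (w s)\<^sup>2 * v s) - E (\<lambda>s. (w s)\<^sup>2) * E v - 2 * E w * (E (\<lambda>s. w s * v s) - E w * E v))"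
    unfolding Let_def by (rule MVT2) (auto intro: DERIV_gibbs_var_line)
  then have "\<bar>?f 1 - ?f 0\<bar> \<le> 6 * W\<^sup>2 * (\<Sum>s\<in>S. \<bar>y s - x s\<bar>)"
    using gibbs_var_deriv_bound [OF w v] by (auto simp: Let_def)
  then show ?thesis by (simp add: v_def)
qed

lemma coord_lipschitz_log_sum_exp: "coord_lipschitz S 1 (log_sum_exp S)"
  unfolding coord_lipschitz_def
proof (intro allI)
  fix y x :: "'s \<Rightarrow> real"
  define v where "v s = y s - x s" for s
  let ?f = "\<lambda>r. log_sum_exp S (\<lambda>s. x s + r * v s)"
  have v: "\<bar>v s\<bar> \<le> (\<Sum>s\<in>S. \<bar>y s - x s\<bar>)" if "s \<in> S" for s
    unfolding v_def using that S by (intro member_le_sum) auto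
  have "\<exists>z. 0 < z \<and> z < 1 \<and> ?f 1 - ?f 0 = (1 - 0) * gibbs S (\<lambda>s. x s + z * v s) v"
    by (rule MVT2) (auto intro: DERIV_log_sum_exp_line)
  then have "\<bar>?f 1 - ?f 0\<bar> \<le> (\<Sum>s\<in>S. \<bar>y s - x s\<bar>)"
    using gibbs_bound [OF v] by auto
  then show "\<bar>log_sum_exp S y - log_sum_exp S x\<bar> \<le> 1 * (\<Sum>s\<in>S. \<bar>y s - x s\<bar>)" by (simp add: v_def)
qed

lemma log_sum_exp_taylor:
  assumes v: "\<And>s. s \<in> S \<Longrightarrow> \<bar>v s\<bar> \<le> V"
  shows "\<bar>log_sum_exp S (\<lambda>s. x s + r * v s)
           - (log_sum_exp S x + r * gibbs S x v + r\<^sup>2 / 2 * gibbs_var S x v)\<bar> \<le> V ^ 3 * \<bar>r\<bar> ^ 3"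
proof -
  let ?E = "\<lambda>r. gibbs S (\<lambda>s. x s + r * v s)"
  define diff where "diff m = (if m = 0 then (\<lambda>r. log_sum_exp S (\<lambda>s. x s + r * v s))
     else if m = 1 then (\<lambda>r. ?E r v) else if m = 2 then (\<lambda>r. gibbs_var S (\<lambda>s. x s + r * v s) v)
     else (\<lambda>r. ?E r (\<lambda>s. (v s)\<^sup>2 * v s) - ?E r (\<lambda>s. (v s)\<^sup>2) * ?E r v
         - 2 * ?E r v * (?E r (\<lambda>s. v s * v s) - ?E r v * ?E r v)))" for m :: nat
  have D: "DERIV (diff m) t :> diff (Suc m) t" if "m < 3" for m t
  proof -
    from that consider "m = 0" | "m = 1" | "m = 2" by linarith
    then show ?thesis
    proof cases
      case 2 then show ?thesis
        using DERIV_gibbs_line [of x v v t] by (simp add: diff_def gibbs_var_def power2_eq_square)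
    qed (auto simp: diff_def intro: DERIV_log_sum_exp_line DERIV_gibbs_var_line)
  qed
  obtain t where t: "diff 0 r = (\<Sum>m<3. diff m 0 / fact m * r ^ m) + diff 3 t / fact 3 * r ^ 3"
    using Maclaurin_bi_le [of diff "diff 0" 3 r] D by auto
  \<comment> \<open>The factor 6 cancels the 3! of the Taylor remainder, which leaves V^3.\<close>
  have "\<bar>diff 3 t\<bar> \<le> 6 * V\<^sup>2 * V"
    unfolding diff_def using gibbs_var_deriv_bound [OF v v, where x = x and r = t] by simp
  then have "\<bar>diff 3 t / fact 3\<bar> \<le> V ^ 3" by (simp add: fact_numeral power3_eq_cube
      power2_eq_square)
  then have "\<bar>diff 3 t / fact 3 * r ^ 3\<bar> \<le> V ^ 3 * \<bar>r\<bar> ^ 3"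
    unfolding abs_mult power_abs by (rule mult_right_mono) simp
  moreover have "(\<Sum>m<3. diff m 0 / fact m * r ^ m) = log_sum_exp S x + r * gibbs S x v
      + r\<^sup>2 / 2 * gibbs_var S x v"
    by (simp add: diff_def numeral_3_eq_3 power2_eq_square)
  ultimately show ?thesis using t by (simp add: diff_def)
qed

lemma sum_gibbs_var_lipschitz:
  "\<exists>K\<ge>0. \<forall>x y. \<bar>(\<Sum>w\<leftarrow>ws. gibbs_var S y w) - (\<Sum>w\<leftarrow>ws. gibbs_var S x w)\<bar> \<le> K * (\<Sum>s\<in>S. \<bar>y s - x s\<bar>)"
proof (induction ws)
  case Nil
  then show ?case by (intro exI [of _ 0]) auto
next
  case (Cons w ws)
  then obtain K where K: "K \<ge> 0"
    "\<And>x y. \<bar>(\<Sum>w\<leftarrow>ws. gibbs_var S y w) - (\<Sum>w\<leftarrow>ws. gibbs_var S x w)\<bar> \<le> K * (\<Sum>s\<in>S. \<bar>y s - x s\<bar>)" by auto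
  let ?W = "\<Sum>s\<in>S. \<bar>w s\<bar>"
  have W: "\<bar>w s\<bar> \<le> ?W" if "s \<in> S" for s using that S by (intro member_le_sum) auto
  have "\<bar>(\<Sum>w\<leftarrow>w # ws. gibbs_var S y w) - (\<Sum>w\<leftarrow>w # ws. gibbs_var S x w)\<bar>
     \<le> (6 * ?W\<^sup>2 + K) * (\<Sum>s\<in>S. \<bar>y s - x s\<bar>)" for x y
    using K(2) [of y x] gibbs_var_lipschitz [where w = w and x = x and y = y, OF W] by
        (simp add: distrib_right)
  then show ?case using K by (intro exI [of _ "6 * ?W\<^sup>2 + K"]) auto
qed

text \<open>The vanishing first moment removes the gradient term and the unit second moment keeps
  half of the Gibbs variance. The error is of order h^3 uniformly in x, and therefore stays small
  when about h^(-2) short steps are iterated.\<close>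

lemma gauss_shifts_log_sum_exp_expansion:
  "\<exists>C\<ge>0. \<forall>x h. 0 \<le> h \<longrightarrow> \<bar>gauss_shifts h vs (log_sum_exp S) x
      - (log_sum_exp S x + h\<^sup>2 / 2 * (\<Sum>v\<leftarrow>vs. gibbs_var S x v))\<bar> \<le> C * h ^ 3"
proof (induction vs)
  case Nil
  then show ?case by (intro exI [of _ 0]) auto
next
  case (Cons v vs)
  then obtain C where C: "C \<ge> 0"
    "\<And>x h. 0 \<le> h \<Longrightarrow> \<bar>gauss_shifts h vs (log_sum_exp S) x
      - (log_sum_exp S x + h\<^sup>2 / 2 * (\<Sum>v\<leftarrow>vs. gibbs_var S x v))\<bar> \<le> C * h ^ 3" by auto
  obtain K where K: "K \<ge> 0"
    "\<And>x y. \<bar>(\<Sum>w\<leftarrow>vs. gibbs_var S y w) - (\<Sum>w\<leftarrow>vs. gibbs_var S x w)\<bar> \<le> K * (\<Sum>s\<in>S. \<bar>y s - x s\<bar>)"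
    using sum_gibbs_var_lipschitz by blast
  let ?V = "\<Sum>s\<in>S. \<bar>v s\<bar>"
  have V: "\<bar>v s\<bar> \<le> ?V" if "s \<in> S" for s using that S by (intro member_le_sum) auto
  define m1 m3 where "m1 = (LINT z|std_gauss. \<bar>z\<bar>)" and "m3 = (LINT z|std_gauss. \<bar>z\<bar> ^ 3)"
  have m: "m1 \<ge> 0" "m3 \<ge> 0" unfolding m1_def m3_def by (intro integral_nonneg_AE; simp)+
  \<comment> \<open>Three sources of error: the remaining directions by induction, the Taylor
    remainder in direction v, and the change of the other Gibbs variances when the base point moves
    by h z v.\<close>
  let ?C = "C + ?V ^ 3 * m3 + K * ?V / 2 * m1"
  have "\<bar>gauss_shifts h (v # vs) (log_sum_exp S) x
      - (log_sum_exp S x + h\<^sup>2 / 2 * (\<Sum>v\<leftarrow>v # vs. gibbs_var S x v))\<bar> \<le> ?C * h ^ 3"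
    if h: "h \<ge> 0" for x h
  proof -
    let ?G = "gauss_shifts h vs (log_sum_exp S)"
    let ?q = "\<Sum>v\<leftarrow>vs. gibbs_var S x v"
    let ?p = "\<lambda>z. log_sum_exp S x + h\<^sup>2 / 2 * ?q + h * gibbs S x v * z
        + h\<^sup>2 / 2 * gibbs_var S x v * z\<^sup>2"
    let ?y = "\<lambda>z s. x s + h * z * v s"
    have Gi: "integrable std_gauss (\<lambda>z. ?G (?y z))"
      by (rule gauss_shift_integrable [OF coord_lipschitz_gauss_shifts [OF
          coord_lipschitz_log_sum_exp]]) (use S in auto)
    have pi: "integrable std_gauss ?p"
      by (intro Bochner_Integration.integrable_add integrable_mult_right) auto
    have ip: "(LINT z|std_gauss. ?p z) = log_sum_exp S x + h\<^sup>2 / 2 * ?q + h\<^sup>2 / 2 * gibbs_var S x v"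
      using std_gauss_mean std_gauss_second_moment std_gauss.prob_space by simp
    have bi: "integrable std_gauss (\<lambda>z. C * h ^ 3 + ?V ^ 3 * h ^ 3 * \<bar>z\<bar> ^ 3
        + K * ?V / 2 * h ^ 3 * \<bar>z\<bar>)"
      by (intro Bochner_Integration.integrable_add integrable_mult_right) auto
    have pt: "\<bar>?G (?y z) - ?p z\<bar> \<le> C * h ^ 3 + ?V ^ 3 * h ^ 3 * \<bar>z\<bar> ^ 3 + K * ?V / 2 * h ^ 3 * \<bar>z\<bar>"
        for z
    proof -
      let ?qz = "\<Sum>v\<leftarrow>vs. gibbs_var S (?y z) v"
      have 1: "\<bar>?G (?y z) - (log_sum_exp S (?y z) + h\<^sup>2 / 2 * ?qz)\<bar> \<le> C * h ^ 3"
          by (rule C(2) [OF h])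
      have "\<bar>h * z\<bar> ^ 3 = h ^ 3 * \<bar>z\<bar> ^ 3" using h by (simp add: abs_mult power_mult_distrib)
      then have 2: "\<bar>log_sum_exp S (?y z) - (log_sum_exp S x + (h * z) * gibbs S x v
          + (h * z)\<^sup>2 / 2 * gibbs_var S x v)\<bar>
          \<le> ?V ^ 3 * h ^ 3 * \<bar>z\<bar> ^ 3"
        using log_sum_exp_taylor [OF V, where x = x and r = "h * z"] by (simp add: mult.assoc)
      have "(\<Sum>s\<in>S. \<bar>?y z s - x s\<bar>) = ?V * (h * \<bar>z\<bar>)" using h by
          (simp add: abs_mult sum_distrib_left mult_ac)
      then have "\<bar>?qz - ?q\<bar> \<le> K * (?V * (h * \<bar>z\<bar>))" using K(2) [of "?y z" x] by simp
      then have "\<bar>h\<^sup>2 / 2 * (?qz - ?q)\<bar> \<le> h\<^sup>2 / 2 * (K * (?V * (h * \<bar>z\<bar>)))"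
        unfolding abs_mult by (intro mult_mono) auto
      then have 3: "\<bar>h\<^sup>2 / 2 * ?qz - h\<^sup>2 / 2 * ?q\<bar> \<le> K * ?V / 2 * h ^ 3 * \<bar>z\<bar>"
        by (simp add: algebra_simps power2_eq_square power3_eq_cube)
      have 4: "(h * z)\<^sup>2 / 2 * gibbs_var S x v = h\<^sup>2 / 2 * gibbs_var S x v * z\<^sup>2"
         "(h * z) * gibbs S x v = h * gibbs S x v * z"
        by (simp_all add: power_mult_distrib)
      show ?thesis using 1 2 3 unfolding 4 by linarith
    qed
    have "\<bar>(LINT z|std_gauss. ?G (?y z)) - (LINT z|std_gauss. ?p z)\<bar> \<le> (LINT z|std_gauss. \<bar>?G (?y z)
        - ?p z\<bar>)"
      unfolding Bochner_Integration.integral_diff [OF Gi pi, symmetric] by (rule integral_abs_bound)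
    also have "\<dots> \<le> (LINT z|std_gauss. C * h ^ 3 + ?V ^ 3 * h ^ 3 * \<bar>z\<bar> ^ 3
        + K * ?V / 2 * h ^ 3 * \<bar>z\<bar>)"
      by (intro integral_mono integrable_abs Bochner_Integration.integrable_diff Gi pi bi pt)
    also have "\<dots> = ?C * h ^ 3"
      using std_gauss.prob_space by (simp add: m1_def m3_def distrib_right)
    finally show ?thesis unfolding ip by (simp add: gauss_shift_def algebra_simps)
  qed
  moreover have "?C \<ge> 0" using C(1) K(1) m by (simp add: sum_nonneg)
  ultimately show ?case by blast
qed

end

section \<open>Slepian's inequality for finite families\<close>

text \<open>In terms of the covariance, the variances enter with a plus sign and the covariances of
  all pairs with a minus sign. With equal variances, larger covariances thus mean a smaller total
  Gibbs variance.\<close>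

lemma sum_list_gibbs_var:
  assumes S: "finite S" "S \<noteq> {}"
  shows "(\<Sum>v\<leftarrow>vs. gibbs_var S x v) =
    (\<Sum>s\<in>S. exp (x s) * (\<Sum>v\<leftarrow>vs. v s * v s)) / (\<Sum>s\<in>S. exp (x s))
    - (\<Sum>s\<in>S. \<Sum>t\<in>S. exp (x s) * exp (x t) * (\<Sum>v\<leftarrow>vs. v s * v t)) / (\<Sum>s\<in>S. exp (x s))\<^sup>2"
proof (induction vs)
  case (Cons v vs)
  have "gibbs_var S x v = (\<Sum>s\<in>S. exp (x s) * (v s * v s)) / (\<Sum>s\<in>S. exp (x s))
      - (\<Sum>s\<in>S. \<Sum>t\<in>S. exp (x s) * exp (x t) * (v s * v t)) / (\<Sum>s\<in>S. exp (x s))\<^sup>2"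
    unfolding gibbs_var_def gibbs_def power_divide
    by (simp add: power2_eq_square sum_product mult_ac)
  then show ?case
    using Cons.IH by (simp add: distrib_left sum.distrib add_divide_distrib)
qed simp

text \<open>The ordering of the total Gibbs variances gives the claim over time h^2 up to an error
  of order h^3. With \<open>h = 1 / sqrt (n + 1)\<close>, n + 1 steps reach time 1 with a total
  error of order \<open>1 / sqrt (n + 1)\<close>.\<close>

lemma slepian_log_sum_exp:
  fixes x :: "'s \<Rightarrow> real"
  assumes S: "finite S" "S \<noteq> {}"
    and off: "\<And>s t. s \<in> S \<Longrightarrow> t \<in> S \<Longrightarrow> (\<Sum>v\<leftarrow>as. v s * v t) \<le> (\<Sum>v\<leftarrow>bs. v s * v t)"
    and diag: "\<And>s. s \<in> S \<Longrightarrow> (\<Sum>v\<leftarrow>as. v s * v s) = (\<Sum>v\<leftarrow>bs. v s * v s)"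
  shows "gauss_shifts 1 bs (log_sum_exp S) x \<le> gauss_shifts 1 as (log_sum_exp S) x"
proof -
  have le: "(\<Sum>v\<leftarrow>bs. gibbs_var S y v) \<le> (\<Sum>v\<leftarrow>as. gibbs_var S y v)" for y
    unfolding sum_list_gibbs_var [OF S]
    by (intro diff_mono divide_right_mono sum_mono mult_left_mono off)
        (simp_all add: diag sum_nonneg)
  obtain A where A: "A \<ge> 0" "\<And>x h. 0 \<le> h \<Longrightarrow> \<bar>gauss_shifts h as (log_sum_exp S) x
      - (log_sum_exp S x + h\<^sup>2 / 2 * (\<Sum>v\<leftarrow>as. gibbs_var S x v))\<bar> \<le> A * h ^ 3"
    using gauss_shifts_log_sum_exp_expansion [OF S] by blast
  obtain B where B: "B \<ge> 0" "\<And>x h. 0 \<le> h \<Longrightarrow> \<bar>gauss_shifts h bs (log_sum_exp S) x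
      - (log_sum_exp S x + h\<^sup>2 / 2 * (\<Sum>v\<leftarrow>bs. gibbs_var S x v))\<bar> \<le> B * h ^ 3"
    using gauss_shifts_log_sum_exp_expansion [OF S] by blast
  have short: "gauss_shifts h bs (log_sum_exp S) y \<le> gauss_shifts h as (log_sum_exp S) y + (A
      + B) * h ^ 3"
    if h: "h \<ge> 0" for h y
  proof -
    have "h\<^sup>2 / 2 * (\<Sum>v\<leftarrow>bs. gibbs_var S y v) \<le> h\<^sup>2 / 2 * (\<Sum>v\<leftarrow>as. gibbs_var S y v)"
      by (intro mult_left_mono le) auto
    then show ?thesis using A(2) [OF h, of y] B(2) [OF h, of y] unfolding distrib_right by linarith
  qed
  have long: "gauss_shifts 1 bs (log_sum_exp S) x \<le> gauss_shifts 1 as (log_sum_exp S) x + (A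
      + B) / sqrt (Suc n)" for n
  proof -
    let ?h = "1 / sqrt (Suc n)"
    have "gauss_shifts (sqrt (Suc n) * ?h) bs (log_sum_exp S) x
        \<le> gauss_shifts (sqrt (Suc n) * ?h) as (log_sum_exp S) x + real (Suc n) * ((A + B) * ?h ^ 3)"
      by (rule gauss_shifts_compare_iterate [OF coord_lipschitz_log_sum_exp [OF S] S(1)])
          (auto intro: short)
    moreover have "sqrt (Suc n) * ?h = 1" by simp
    moreover have "real (Suc n) * ((A + B) * ?h ^ 3) = (A + B) / sqrt (Suc n)"
    proof -
      have "real (Suc n) = sqrt (Suc n) * sqrt (Suc n)" by simp
      then show ?thesis by (simp only: power3_eq_cube) (simp add: field_simps del: of_nat_Suc)
    qed
    ultimately show ?thesis by metis
  qed
  have "(\<lambda>n. gauss_shifts 1 as (log_sum_exp S) x + (A + B) / sqrt (Suc n))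
      \<longlonglongrightarrow> gauss_shifts 1 as (log_sum_exp S) x + 0"
    by (intro tendsto_add tendsto_const) real_asymp
  then show ?thesis using long by (intro LIMSEQ_le_const [of _
      "gauss_shifts 1 as (log_sum_exp S) x"]) auto
qed

section \<open>Gaussian product measures and suprema over finite families\<close>

definition gauss_prod :: "'i set \<Rightarrow> ('i \<Rightarrow> real) measure" where
  "gauss_prod K = PiM K (\<lambda>_. std_gauss)"

lemma prob_space_gauss_prod: "prob_space (gauss_prod K)"
  unfolding gauss_prod_def by (intro prob_space_PiM prob_space_std_gauss)

lemma measurable_gauss_prod_component [measurable]:
  "k \<in> K \<Longrightarrow> (\<lambda>g. g k) \<in> borel_measurable (gauss_prod K)"
  unfolding gauss_prod_def using measurable_component_singleton [of k K "\<lambda>_. std_gauss"]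
  by (simp add: measurable_std_gauss)

lemma distr_gauss_prod_component:
  "k \<in> K \<Longrightarrow> distr (gauss_prod K) std_gauss (\<lambda>g. g k) = std_gauss"
  unfolding gauss_prod_def using distr_PiM_component [of K "\<lambda>_. std_gauss" k] prob_space_std_gauss
      by simp

lemma measurable_gauss_prod_component': "k \<in> K \<Longrightarrow> (\<lambda>g. g k) \<in> measurable (gauss_prod K) std_gauss"
  unfolding measurable_std_gauss by (rule measurable_gauss_prod_component)

lemma gauss_prod_component:
  fixes f :: "real \<Rightarrow> real"
  assumes k: "k \<in> K" and f: "f \<in> borel_measurable borel"
  shows "(LINT g|gauss_prod K. f (g k)) = (LINT z|std_gauss. f z)"
    and "integrable (gauss_prod K) (\<lambda>g. f (g k)) \<longleftrightarrow> integrable std_gauss f"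
proof -
  have f': "f \<in> borel_measurable std_gauss" using f unfolding measurable_std_gauss .
  show "(LINT g|gauss_prod K. f (g k)) = (LINT z|std_gauss. f z)"
    using integral_distr [OF measurable_gauss_prod_component' [OF k] f']
    unfolding distr_gauss_prod_component [OF k] by (rule sym)
  show "integrable (gauss_prod K) (\<lambda>g. f (g k)) \<longleftrightarrow> integrable std_gauss f"
    using integrable_distr_eq [OF measurable_gauss_prod_component' [OF k] f']
    unfolding distr_gauss_prod_component [OF k] by (rule sym)
qed

lemma gauss_prod_integrable_component:
  assumes k: "k \<in> K"
  shows "integrable (gauss_prod K) (\<lambda>g. g k)" "integrable (gauss_prod K) (\<lambda>g. \<bar>g k\<bar>)"
    "integrable (gauss_prod K) (\<lambda>g. (g k) ^ n)"
  by (subst gauss_prod_component(2) [OF k, of "\<lambda>z. z"] gauss_prod_component(2) [OF k, of "\<lambda>z. \<bar>z\<bar>"]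
    gauss_prod_component(2) [OF k, of "\<lambda>z. z ^ n"]; simp)+

lemma gauss_prod_integrable_linear:
  fixes f :: "('i \<Rightarrow> real) \<Rightarrow> real"
  assumes "finite K" "f \<in> borel_measurable (gauss_prod K)" "\<And>g. \<bar>f g\<bar> \<le> A + B * (\<Sum>k\<in>K. \<bar>g k\<bar>)"
  shows "integrable (gauss_prod K) f"
proof (rule Bochner_Integration.integrable_bound)
  interpret prob_space "gauss_prod K" by (rule prob_space_gauss_prod)
  show "integrable (gauss_prod K) (\<lambda>g. A + B * (\<Sum>k\<in>K. \<bar>g k\<bar>))"
    by (intro Bochner_Integration.integrable_add integrable_mult_right
        Bochner_Integration.integrable_sum
        gauss_prod_integrable_component) auto
  show "AE g in gauss_prod K. norm (f g) \<le> norm (A + B * (\<Sum>k\<in>K. \<bar>g k\<bar>))"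
    by (intro AE_I2) (simp only: real_norm_def, rule order_trans [OF assms(3) abs_ge_self])
qed (fact assms(2))

text \<open>Fubini's theorem peels off one coordinate of the product measure for each
  direction.\<close>

lemma gauss_prod_eq_gauss_shifts:
  fixes x :: "'s \<Rightarrow> real" and a :: "'i \<Rightarrow> 's \<Rightarrow> real"
  assumes S: "finite S" "S \<noteq> {}" and "distinct ks"
  shows "(LINT g|gauss_prod (set ks). log_sum_exp S (\<lambda>s. x s + (\<Sum>k\<in>set ks. g k * a k s)))
       = gauss_shifts 1 (map a ks) (log_sum_exp S) x"
  using \<open>distinct ks\<close>
proof (induction ks arbitrary: x)
  case Nil
  interpret prob_space "gauss_prod {} :: ('i \<Rightarrow> real) measure" by (rule prob_space_gauss_prod)
  show ?case using prob_space by simp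
next
  case (Cons k ks)
  interpret PS: product_sigma_finite "\<lambda>_::'i. std_gauss" ..
  have [simp]: "k \<notin> set ks" using Cons.prems by simp
  let ?f = "\<lambda>g. log_sum_exp S (\<lambda>s. x s + (\<Sum>k\<in>set (k # ks). g k * a k s))"
  have meas: "?f \<in> borel_measurable (gauss_prod (set (k # ks)))"
    unfolding log_sum_exp_def by measurable
  have int: "integrable (gauss_prod (set (k # ks))) ?f"
  proof (rule gauss_prod_integrable_linear [OF _ meas])
    fix g :: "'i \<Rightarrow> real"
    let ?A = "\<Sum>s\<in>S. \<Sum>k\<in>set (k # ks). \<bar>a k s\<bar>"
    define G where "G = (\<Sum>k\<in>set (k # ks). \<bar>g k\<bar>)"
    have "\<bar>?f g - log_sum_exp S x\<bar> \<le> 1 * (\<Sum>s\<in>S. \<bar>(x s + (\<Sum>k\<in>set (k # ks). g k * a k s)) - x s\<bar>)"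
      using coord_lipschitz_log_sum_exp [OF S] unfolding coord_lipschitz_def by blast
    also have "\<dots> = (\<Sum>s\<in>S. \<bar>\<Sum>k\<in>set (k # ks). g k * a k s\<bar>)"
      by (simp del: set_simps)
    also have "\<dots> \<le> (\<Sum>s\<in>S. \<Sum>k\<in>set (k # ks). \<bar>g k\<bar> * \<bar>a k s\<bar>)"
      by (intro sum_mono order_trans [OF sum_abs]) (simp add: abs_mult)
    also have "\<dots> \<le> (\<Sum>s\<in>S. \<Sum>k\<in>set (k # ks). G * \<bar>a k s\<bar>)"
      unfolding G_def by (intro sum_mono mult_right_mono member_le_sum) auto
    also have "\<dots> = ?A * G"
      unfolding sum_distrib_right by (simp only: mult.commute)
    finally show "\<bar>?f g\<bar> \<le> \<bar>log_sum_exp S x\<bar> + ?A * (\<Sum>k\<in>set (k # ks). \<bar>g k\<bar>)"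
      unfolding G_def by linarith
  qed simp
  have "integral\<^sup>L (gauss_prod (set (k # ks))) ?f = integral\<^sup>L (PiM ({k} \<union> set ks) (\<lambda>_. std_gauss))
      ?f"
    by (simp add: gauss_prod_def)
  also have "\<dots> = (LINT y|PiM {k} (\<lambda>_. std_gauss). LINT g|PiM (set ks) (\<lambda>_. std_gauss). ?f (merge {k}
      (set ks) (y, g)))"
    by (rule PS.product_integral_fold) (use int in \<open>simp_all add: gauss_prod_def\<close>)
  also have "\<dots> = (LINT y|PiM {k} (\<lambda>_. std_gauss). gauss_shifts 1 (map a ks) (log_sum_exp S) (\<lambda>s. x s
      + 1 * y k * a k s))"
  proof (rule Bochner_Integration.integral_cong [OF refl])
    fix y :: "'i \<Rightarrow> real"
    have "?f (merge {k} (set ks) (y, g)) = log_sum_exp S (\<lambda>s. (x s + 1 * y k * a k s)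
        + (\<Sum>k\<in>set ks. g k * a k s))" for g
    proof -
      have "(\<Sum>i\<in>set ks. merge {k} (set ks) (y, g) i * a i s) = (\<Sum>i\<in>set ks. g i * a i s)" for s
        by (rule sum.cong) (auto simp: merge_def)
      then show ?thesis by (simp add: add.assoc)
    qed
    then show "(LINT g|PiM (set ks) (\<lambda>_. std_gauss). ?f (merge {k} (set ks) (y, g)))
        = gauss_shifts 1 (map a ks) (log_sum_exp S) (\<lambda>s. x s + 1 * y k * a k s)"
      using Cons.IH [of "\<lambda>s. x s + 1 * y k * a k s"] Cons.prems by (simp add: gauss_prod_def)
  qed
  also have "\<dots> = (LINT z|std_gauss. gauss_shifts 1 (map a ks) (log_sum_exp S) (\<lambda>s. x s
      + 1 * z * a k s))"
    by (rule PS.product_integral_singleton)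
       (rule borel_measurable_integrable, rule gauss_shift_integrable [OF
           coord_lipschitz_gauss_shifts [OF coord_lipschitz_log_sum_exp]],
         use S in auto)
  finally show ?case by (simp add: gauss_shift_def)
qed

text \<open>The common shape of the maxima: s is a configuration, g the Gaussian array, the
  coefficients come from the Hamiltonian and the constants from the penalty.\<close>

definition affine_sup ::
  "'i set \<Rightarrow> 's set \<Rightarrow> ('s \<Rightarrow> 'i \<Rightarrow> real) \<Rightarrow> ('s \<Rightarrow> real) \<Rightarrow> ('i \<Rightarrow> real) \<Rightarrow> real" where
  "affine_sup K S a c g = (\<Squnion>s\<in>S. (\<Sum>k\<in>K. a s k * g k) + c s)"

lemma log_sum_exp_bounds:
  assumes S: "finite S" "S \<noteq> {}"
  shows "(\<Squnion>s\<in>S. x s) \<le> log_sum_exp S x" "log_sum_exp S x \<le> (\<Squnion>s\<in>S. x s) + ln (card S)"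
proof -
  have c: "card S > 0" using S by (simp add: card_gt_0_iff)
  show "(\<Squnion>s\<in>S. x s) \<le> log_sum_exp S x"
  proof (rule cSUP_least [OF S(2)])
    fix s assume "s \<in> S"
    then have "exp (x s) \<le> (\<Sum>s\<in>S. exp (x s))" using S by (intro member_le_sum) auto
    then have "ln (exp (x s)) \<le> log_sum_exp S x" unfolding log_sum_exp_def
      by (subst ln_le_cancel_iff) (auto intro: partition_pos S)
    then show "x s \<le> log_sum_exp S x" by simp
  qed
  have "(\<Sum>s\<in>S. exp (x s)) \<le> (\<Sum>s\<in>S. exp (\<Squnion>s\<in>S. x s))"
    using S by (intro sum_mono) (auto intro: cSUP_upper)
  also have "\<dots> = exp (\<Squnion>s\<in>S. x s) * card S" by simp
  finally have "log_sum_exp S x \<le> ln (exp (\<Squnion>s\<in>S. x s) * card S)"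
    unfolding log_sum_exp_def using c partition_pos [OF S, of x] by (subst ln_le_cancel_iff) auto
  also have "\<dots> = (\<Squnion>s\<in>S. x s) + ln (card S)" using c by (subst ln_mult) auto
  finally show "log_sum_exp S x \<le> (\<Squnion>s\<in>S. x s) + ln (card S)" .
qed


lemma affine_sup_finite_bound:
  fixes a :: "'s \<Rightarrow> 'i \<Rightarrow> real"
  assumes S: "finite S" "S \<noteq> {}"
  shows "\<exists>A B. \<forall>g. \<bar>affine_sup K S a c g\<bar> \<le> A + B * (\<Sum>k\<in>K. \<bar>g k\<bar>)"
proof (cases "finite K")
  case True
  define A where "A = (\<Sum>s\<in>S. \<bar>c s\<bar>)"
  define B where "B = (\<Sum>s\<in>S. \<Sum>k\<in>K. \<bar>a s k\<bar>)"
  have "\<bar>affine_sup K S a c g\<bar> \<le> A + B * (\<Sum>k\<in>K. \<bar>g k\<bar>)" for g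
  proof -
    define G where "G = (\<Sum>k\<in>K. \<bar>g k\<bar>)"
    have "\<bar>(\<Sum>k\<in>K. a s k * g k) + c s\<bar> \<le> A + B * G" if "s \<in> S" for s
    proof -
      have "\<bar>\<Sum>k\<in>K. a s k * g k\<bar> \<le> (\<Sum>k\<in>K. \<bar>a s k\<bar> * G)"
        unfolding G_def using True
        by (intro order_trans [OF sum_abs] sum_mono) (auto simp: abs_mult intro!: mult_left_mono
            member_le_sum)
      also have "\<dots> = (\<Sum>k\<in>K. \<bar>a s k\<bar>) * G" by (rule sum_distrib_right [symmetric])
      also have "\<dots> \<le> B * G"
      proof (rule mult_right_mono)
        show "(\<Sum>k\<in>K. \<bar>a s k\<bar>) \<le> B" unfolding B_def using S that
          by (intro member_le_sum [of s S "\<lambda>s. \<Sum>k\<in>K. \<bar>a s k\<bar>"]) (simp_all add: sum_nonneg)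
        show "0 \<le> G" unfolding G_def by (simp add: sum_nonneg)
      qed
      finally have 1: "\<bar>\<Sum>k\<in>K. a s k * g k\<bar> \<le> B * G" .
      have "\<bar>c s\<bar> \<le> A" unfolding A_def using S that by (intro member_le_sum) auto
      with 1 show ?thesis by linarith
    qed
    then have "\<bar>affine_sup K S a c g\<bar> \<le> A + B * G"
      unfolding affine_sup_def using S by (intro cSup_abs_le) auto
    then show ?thesis unfolding G_def .
  qed
  then show ?thesis by blast
next
  \<comment> \<open>Sums over an infinite index set are 0 by convention, so the supremum does not
    depend on g.\<close>
  case False
  then show ?thesis by (intro exI [of _ "\<bar>affine_sup K S a c (\<lambda>_. 0)\<bar>"] exI [of _ 0])
      (simp add: affine_sup_def)
qed

lemma affine_sup_finite_measurable:
  assumes "finite S" "S \<noteq> {}"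
  shows "affine_sup K S a c \<in> borel_measurable (gauss_prod K)"
proof -
  have "(\<lambda>g. \<Squnion>s\<in>S. (\<Sum>k\<in>K. a s k * g k) + c s) \<in> borel_measurable (gauss_prod K)"
  proof (rule borel_measurable_cSUP)
    show "countable S" using assms by (simp add: countable_finite)
    show "(\<lambda>g. (\<Sum>k\<in>K. a s k * g k) + c s) \<in> borel_measurable (gauss_prod K)" for s by measurable
    show "bdd_above ((\<lambda>s. (\<Sum>k\<in>K. a s k * g k) + c s) ` S)" for g using assms by simp
  qed
  then show ?thesis unfolding affine_sup_def [abs_def] .
qed

lemma affine_sup_finite_integrable:
  assumes "finite S" "S \<noteq> {}" "finite K"
  shows "integrable (gauss_prod K) (affine_sup K S a c)"
proof -
  obtain A B where "\<And>g. \<bar>affine_sup K S a c g\<bar> \<le> A + B * (\<Sum>k\<in>K. \<bar>g k\<bar>)"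
    using affine_sup_finite_bound [OF assms(1,2)] by blast
  then show ?thesis
    by (rule gauss_prod_integrable_linear [OF assms(3) affine_sup_finite_measurable [OF
        assms(1,2)]])
qed

lemma log_sum_exp_affine_integrable:
  assumes S: "finite S" "S \<noteq> {}" and K: "finite K"
  shows "integrable (gauss_prod K) (\<lambda>g. log_sum_exp S (\<lambda>s. c s + (\<Sum>k\<in>K. g k * a k s)))"
proof -
  let ?f = "\<lambda>g. log_sum_exp S (\<lambda>s. c s + (\<Sum>k\<in>K. g k * a k s))"
  have eq: "(\<Squnion>s\<in>S. c s + (\<Sum>k\<in>K. g k * a k s)) = affine_sup K S (\<lambda>s k. a k s) c g" for g
    by (simp add: affine_sup_def mult.commute add.commute)
  obtain A B where AB: "\<And>g. \<bar>affine_sup K S (\<lambda>s k. a k s) c g\<bar> \<le> A + B * (\<Sum>k\<in>K. \<bar>g k\<bar>)"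
    using affine_sup_finite_bound [OF S] by blast
  have "\<bar>?f g\<bar> \<le> (A + ln (card S)) + B * (\<Sum>k\<in>K. \<bar>g k\<bar>)" for g
  proof -
    have "ln (real (card S)) \<ge> 0" using S by (simp add: ln_ge_zero Suc_leI card_gt_0_iff)
    then show ?thesis
      using AB [of g] log_sum_exp_bounds [OF S, of "\<lambda>s. c s + (\<Sum>k\<in>K. g k * a k s)"]
      unfolding eq by linarith
  qed
  moreover have "?f \<in> borel_measurable (gauss_prod K)" unfolding log_sum_exp_def by measurable
  ultimately show ?thesis by (intro gauss_prod_integrable_linear [OF K])
qed

lemma cSUP_mult_left:
  fixes f :: "'a \<Rightarrow> real"
  assumes X: "X \<noteq> {}" "bdd_above (f ` X)" and c: "c > 0"
  shows "(\<Squnion>x\<in>X. c * f x) = c * (\<Squnion>x\<in>X. f x)"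
proof (rule antisym)
  have b: "bdd_above ((\<lambda>x. c * f x) ` X)"
  proof -
    obtain B where "\<And>x. x \<in> X \<Longrightarrow> f x \<le> B" using X(2) by (auto simp: bdd_above_def)
    then show ?thesis using c by (intro bdd_aboveI2 [of _ _ "c * B"]) auto
  qed
  show "(\<Squnion>x\<in>X. c * f x) \<le> c * (\<Squnion>x\<in>X. f x)"
    using X c by (intro cSUP_least mult_left_mono cSUP_upper) auto
  have "(\<Squnion>x\<in>X. f x) \<le> (\<Squnion>x\<in>X. c * f x) / c"
  proof (rule cSUP_least [OF X(1)])
    fix x assume "x \<in> X"
    then have "c * f x \<le> (\<Squnion>x\<in>X. c * f x)" by (rule cSUP_upper [OF _ b])
    then show "f x \<le> (\<Squnion>x\<in>X. c * f x) / c" using c by (simp add: pos_le_divide_eq mult.commute)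
  qed
  then show "c * (\<Squnion>x\<in>X. f x) \<le> (\<Squnion>x\<in>X. c * f x)"
    using c by (simp add: pos_le_divide_eq mult.commute)
qed

text \<open>At inverse temperature \<open>\<beta>\<close>, \<open>log_sum_exp\<close> divided by
  \<open>\<beta>\<close> exceeds the maximum by at most \<open>ln (card S) / \<beta>\<close>.
  Multiplying all coefficients by \<open>\<beta>\<close> preserves both covariance conditions, and
  \<open>\<beta>\<close> tends to infinity.\<close>

lemma slepian_finite:
  fixes a :: "'s \<Rightarrow> 'i \<Rightarrow> real" and b :: "'s \<Rightarrow> 'j \<Rightarrow> real"
  assumes S: "finite S" "S \<noteq> {}" and K: "finite K" and L: "finite L"
    and off: "\<And>s t. s \<in> S \<Longrightarrow> t \<in> S \<Longrightarrow> (\<Sum>k\<in>K. a s k * a t k) \<le> (\<Sum>l\<in>L. b s l * b t l)"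
    and diag: "\<And>s. s \<in> S \<Longrightarrow> (\<Sum>k\<in>K. a s k * a s k) = (\<Sum>l\<in>L. b s l * b s l)"
  shows "integral\<^sup>L (gauss_prod L) (affine_sup L S b c) \<le> integral\<^sup>L (gauss_prod K) (affine_sup K S
      a c)"
proof -
  obtain ks where ks: "distinct ks" "set ks = K" using finite_distinct_list [OF K] by blast
  obtain ls where ls: "distinct ls" "set ls = L" using finite_distinct_list [OF L] by blast
  interpret PK: prob_space "gauss_prod K" by (rule prob_space_gauss_prod)
  let ?IK = "integral\<^sup>L (gauss_prod K) (affine_sup K S a c)" and ?IL =
      "integral\<^sup>L (gauss_prod L) (affine_sup L S b c)"
  have main: "?IL \<le> ?IK + ln (card S) / \<beta>" if "\<beta> > 0" for \<beta> :: real
  proof -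
    let ?fa = "\<lambda>g. log_sum_exp S (\<lambda>s. \<beta> * c s + (\<Sum>k\<in>K. g k * (\<beta> * a s k)))"
    let ?fb = "\<lambda>g. log_sum_exp S (\<lambda>s. \<beta> * c s + (\<Sum>l\<in>L. g l * (\<beta> * b s l)))"
    have sc: "(\<Squnion>s\<in>S. \<beta> * c s + (\<Sum>k\<in>K. g k * (\<beta> * a s k))) = \<beta> * affine_sup K S a c g"
      for K and a :: "'s \<Rightarrow> _ \<Rightarrow> real" and g
    proof -
      have "(\<Squnion>s\<in>S. \<beta> * ((\<Sum>k\<in>K. a s k * g k) + c s)) = \<beta> * (\<Squnion>s\<in>S. (\<Sum>k\<in>K. a s k * g k) + c s)"
        using S that by (intro cSUP_mult_left) auto
      then show ?thesis by (simp add: affine_sup_def sum_distrib_left distrib_left mult_ac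
          add.commute)
    qed
    have "\<beta> * ?IL = (LINT g|gauss_prod L. \<beta> * affine_sup L S b c g)" by simp
    also have "\<dots> \<le> integral\<^sup>L (gauss_prod L) ?fb"
    proof (rule integral_mono)
      show "\<beta> * affine_sup L S b c g \<le> ?fb g" for g
        using log_sum_exp_bounds(1) [OF S] unfolding sc [symmetric] .
    qed (intro integrable_mult_right affine_sup_finite_integrable S L, rule
        log_sum_exp_affine_integrable [OF S L])
    also have "\<dots> = gauss_shifts 1 (map (\<lambda>l s. \<beta> * b s l) ls) (log_sum_exp S) (\<lambda>s. \<beta> * c s)"
      using gauss_prod_eq_gauss_shifts [OF S ls(1), of "\<lambda>s. \<beta> * c s" "\<lambda>l s. \<beta> * b s l"] ls(2)
          by simp
    also have "\<dots> \<le> gauss_shifts 1 (map (\<lambda>k s. \<beta> * a s k) ks) (log_sum_exp S) (\<lambda>s. \<beta> * c s)"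
    proof (rule slepian_log_sum_exp [OF S])
      have A: "(\<Sum>v\<leftarrow>map (\<lambda>k s. \<beta> * a s k) ks. v s * v t) = \<beta>\<^sup>2 * (\<Sum>k\<in>K. a s k * a t k)" for s t
        using sum_list_distinct_conv_sum_set [OF ks(1), of "\<lambda>k. \<beta> * a s k * (\<beta> * a t k)"] ks(2)
        by (simp add: o_def sum_distrib_left power2_eq_square mult_ac)
      have B: "(\<Sum>v\<leftarrow>map (\<lambda>l s. \<beta> * b s l) ls. v s * v t) = \<beta>\<^sup>2 * (\<Sum>l\<in>L. b s l * b t l)" for s t
        using sum_list_distinct_conv_sum_set [OF ls(1), of "\<lambda>l. \<beta> * b s l * (\<beta> * b t l)"] ls(2)
        by (simp add: o_def sum_distrib_left power2_eq_square mult_ac)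
      show "(\<Sum>v\<leftarrow>map (\<lambda>k s. \<beta> * a s k) ks. v s * v t) \<le> (\<Sum>v\<leftarrow>map (\<lambda>l s. \<beta> * b s l) ls. v s * v t)"
        if "s \<in> S" "t \<in> S" for s t
        unfolding A B by (intro mult_left_mono off that) auto
      show "(\<Sum>v\<leftarrow>map (\<lambda>k s. \<beta> * a s k) ks. v s * v s) = (\<Sum>v\<leftarrow>map (\<lambda>l s. \<beta> * b s l) ls. v s * v s)"
        if "s \<in> S" for s
        unfolding A B by (simp only: diag [OF that])
    qed
    also have "\<dots> = integral\<^sup>L (gauss_prod K) ?fa"
      using gauss_prod_eq_gauss_shifts [OF S ks(1), of "\<lambda>s. \<beta> * c s" "\<lambda>k s. \<beta> * a s k"] ks(2)
          by simp
    also have "\<dots> \<le> (LINT g|gauss_prod K. \<beta> * affine_sup K S a c g + ln (card S))"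
    proof (rule integral_mono)
      show "?fa g \<le> \<beta> * affine_sup K S a c g + ln (card S)" for g
        using log_sum_exp_bounds(2) [OF S] unfolding sc [symmetric] .
    qed (intro Bochner_Integration.integrable_add integrable_mult_right affine_sup_finite_integrable
        S K
        log_sum_exp_affine_integrable [OF S K] PK.integrable_const)+
    also have "\<dots> = \<beta> * ?IK + ln (card S)"
      by (subst Bochner_Integration.integral_add)
         (use affine_sup_finite_integrable [OF S K] PK.prob_space in auto)
    finally show ?thesis using that by (simp add: field_simps)
  qed
  have "(\<lambda>n. ?IK + ln (card S) / real (Suc n)) \<longlonglongrightarrow> ?IK + 0"
    by (intro tendsto_add tendsto_const) real_asymp
  then show ?thesis using main by (intro LIMSEQ_le_const [of _ ?IK]) auto
qed

section \<open>The Efron-Stein inequality\<close>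

lemma measurable_gauss_prod_reindex:
  assumes "t \<in> I \<rightarrow> K"
  shows "(\<lambda>\<omega>. \<lambda>n\<in>I. \<omega> (t n)) \<in> measurable (gauss_prod K) (gauss_prod I)"
  unfolding gauss_prod_def [of I]
  by (rule measurable_restrict, rule measurable_gauss_prod_component') (use assms in auto)

lemma distr_gauss_prod_reindex:
  assumes "inj_on t I" "t \<in> I \<rightarrow> K"
  shows "distr (gauss_prod K) (gauss_prod I) (\<lambda>\<omega>. \<lambda>n\<in>I. \<omega> (t n)) = gauss_prod I"
  unfolding gauss_prod_def by (rule distr_PiM_reindex [OF prob_space_std_gauss assms])

text \<open>Lets sub-arrays, shifted blocks and resampled arrays be integrated as if they were fresh
  arrays.\<close>

lemma gauss_prod_reindex:
  fixes f :: "_ \<Rightarrow> real"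
  assumes t: "inj_on t I" "t \<in> I \<rightarrow> K" and f: "f \<in> borel_measurable (gauss_prod I)"
  shows "(LINT \<omega>|gauss_prod K. f (\<lambda>n\<in>I. \<omega> (t n))) = integral\<^sup>L (gauss_prod I) f"
    and "integrable (gauss_prod K) (\<lambda>\<omega>. f (\<lambda>n\<in>I. \<omega> (t n))) \<longleftrightarrow> integrable (gauss_prod I) f"
    and "(\<lambda>\<omega>. f (\<lambda>n\<in>I. \<omega> (t n))) \<in> borel_measurable (gauss_prod K)"
proof -
  note m = measurable_gauss_prod_reindex [OF t(2)]
  show "(LINT \<omega>|gauss_prod K. f (\<lambda>n\<in>I. \<omega> (t n))) = integral\<^sup>L (gauss_prod I) f"
    using integral_distr [OF m f] unfolding distr_gauss_prod_reindex [OF t] by (rule sym)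
  show "integrable (gauss_prod K) (\<lambda>\<omega>. f (\<lambda>n\<in>I. \<omega> (t n))) \<longleftrightarrow> integrable (gauss_prod I) f"
    using integrable_distr_eq [OF m f] unfolding distr_gauss_prod_reindex [OF t] by (rule sym)
  show "(\<lambda>\<omega>. f (\<lambda>n\<in>I. \<omega> (t n))) \<in> borel_measurable (gauss_prod K)"
    by (rule measurable_compose [OF m f])
qed

lemma integrable_mult_of_squares:
  fixes u v :: "'a \<Rightarrow> real"
  assumes "u \<in> borel_measurable M" "v \<in> borel_measurable M"
    "integrable M (\<lambda>x. (u x)\<^sup>2)" "integrable M (\<lambda>x. (v x)\<^sup>2)"
  shows "integrable M (\<lambda>x. u x * v x)"
proof (rule Bochner_Integration.integrable_bound [where f = "\<lambda>x. (u x)\<^sup>2 + (v x)\<^sup>2"])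
  show "AE x in M. norm (u x * v x) \<le> norm ((u x)\<^sup>2 + (v x)\<^sup>2)"
  proof (intro AE_I2)
    fix x
    have "2 * \<bar>u x\<bar> * \<bar>v x\<bar> \<le> \<bar>u x\<bar>\<^sup>2 + \<bar>v x\<bar>\<^sup>2" by (rule sum_squares_bound)
    moreover have "0 \<le> \<bar>u x\<bar> * \<bar>v x\<bar>" by simp
    ultimately have "\<bar>u x\<bar> * \<bar>v x\<bar> \<le> (u x)\<^sup>2 + (v x)\<^sup>2" unfolding power2_abs by linarith
    then show "norm (u x * v x) \<le> norm ((u x)\<^sup>2 + (v x)\<^sup>2)" by (simp add: abs_mult)
  qed
  show "integrable M (\<lambda>x. (u x)\<^sup>2 + (v x)\<^sup>2)" by (intro Bochner_Integration.integrable_add assms)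
  show "(\<lambda>x. u x * v x) \<in> borel_measurable M" by (intro borel_measurable_times assms)
qed

text \<open>
  Two independent copies of the array are indexed by \<open>K \<times> bool\<close>; \<open>resample K A\<close> takes the
  coordinates in \<open>A\<close> from the second copy and the remaining ones from the first.
\<close>

definition resample :: "'i set \<Rightarrow> 'i set \<Rightarrow> ('i \<times> bool \<Rightarrow> real) \<Rightarrow> 'i \<Rightarrow> real" where
  "resample K A \<omega> = (\<lambda>k\<in>K. \<omega> (k, k \<in> A))"

text \<open>With F A denoting f after resampling A, the variance is the mean of F {} (F {} - F K),
  since the fully resampled copy is independent. This telescopes as the coordinates are resampled
  one by one, and exchanging the two copies in one coordinate turns each increment into half the
  mean of a product of two differences. Only positive parts are kept, because a near-maximiser
  controls the drop of a supremum but not its rise.\<close>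

theorem efron_stein:
  fixes f :: "('i \<Rightarrow> real) \<Rightarrow> real"
  assumes K: "finite K" and f: "f \<in> borel_measurable (gauss_prod K)"
    and f2: "integrable (gauss_prod K) (\<lambda>g. (f g)\<^sup>2)"
  shows "(LINT g|gauss_prod K. (f g - integral\<^sup>L (gauss_prod K) f)\<^sup>2)
    \<le> (\<Sum>k\<in>K. LINT \<omega>|gauss_prod (K \<times> UNIV). (max 0 (f (resample K {} \<omega>) - f (resample K {k} \<omega>)))\<^sup>2)"
proof -
  let ?G = "gauss_prod (K \<times> (UNIV :: bool set))"
  interpret PK: prob_space "gauss_prod K" by (rule prob_space_gauss_prod)
  interpret PG: prob_space ?G by (rule prob_space_gauss_prod)
  define F where "F A \<omega> = f (resample K A \<omega>)" for A \<omega>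
  \<comment> \<open>Exchanges the two copies in the coordinates of B. It preserves the measure, and
    it changes the resampled set by symmetric difference with B (\<open>swF\<close>).\<close>
  define sw where "sw B \<omega> = (\<lambda>n\<in>K \<times> UNIV. \<omega> (fst n, snd n \<noteq> (fst n \<in> B)))" for B and \<omega> ::
      "'i \<times> bool \<Rightarrow> real"
  define \<mu> where "\<mu> = integral\<^sup>L (gauss_prod K) f"
  have f1: "integrable (gauss_prod K) f" by (rule PK.square_integrable_imp_integrable [OF f f2])
  have inj: "inj_on (\<lambda>k. (k, k \<in> A)) K" "(\<lambda>k. (k, k \<in> A)) \<in> K \<rightarrow> K \<times> UNIV" for A
    by (auto simp: inj_on_def)
  have Fm: "F A \<in> borel_measurable ?G" for A
    unfolding F_def [abs_def] resample_def by (rule gauss_prod_reindex(3) [OF inj f])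
  have EF: "(LINT \<omega>|?G. h (F A \<omega>)) = (LINT g|gauss_prod K. h (f g))"
    "integrable ?G (\<lambda>\<omega>. h (F A \<omega>)) \<longleftrightarrow> integrable (gauss_prod K) (\<lambda>g. h (f g))"
    if "h \<in> borel_measurable borel" for h :: "real \<Rightarrow> real" and A
    unfolding F_def resample_def
    using gauss_prod_reindex(1,2) [OF inj measurable_compose [OF f that]] by auto
  have F2: "integrable ?G (\<lambda>\<omega>. (F A \<omega>)\<^sup>2)" for A
    using EF(2) [of "\<lambda>x. x\<^sup>2" A] f2 by simp
  have FF: "integrable ?G (\<lambda>\<omega>. F A \<omega> * F B \<omega>)" for A B
    by (rule integrable_mult_of_squares [OF Fm Fm F2 F2])
  have swF: "F A (sw B \<omega>) = F {k. (k \<in> A) \<noteq> (k \<in> B)} \<omega>" for A B \<omega>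
    unfolding F_def resample_def sw_def by (rule arg_cong [where f = f])
        (auto simp: restrict_def fun_eq_iff)
  have inv: "(LINT \<omega>|?G. h (sw B \<omega>)) = integral\<^sup>L ?G h" if "h \<in> borel_measurable ?G" for h ::
      "_ \<Rightarrow> real" and B
    unfolding sw_def
    by (rule gauss_prod_reindex(1) [OF _ _ that]) (auto simp: inj_on_def)
  have step: "(LINT \<omega>|?G. F {} \<omega> * (F A \<omega> - F (insert k A) \<omega>)) \<le> (LINT \<omega>|?G. (F {} \<omega>
      - F {k} \<omega>)\<^sup>2) / 2"
    if "k \<notin> A" for A k
  proof -
    let ?u = "\<lambda>\<omega>. F {} \<omega> - F {k} \<omega>" and ?v = "\<lambda>\<omega>. F A \<omega> - F (insert k A) \<omega>"
    have int: "integrable ?G (\<lambda>\<omega>. F B \<omega> * ?v \<omega>)" for B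
      unfolding right_diff_distrib by (intro Bochner_Integration.integrable_diff FF)
    have sq: "integrable ?G (\<lambda>\<omega>. (F B \<omega> - F D \<omega>)\<^sup>2)" for B D
      unfolding power2_diff mult.assoc
      by (intro Bochner_Integration.integrable_diff Bochner_Integration.integrable_add
          integrable_mult_right F2 FF)
    have e1: "{i. (i \<in> {}) \<noteq> (i \<in> {k})} = {k}" "{i. (i \<in> A) \<noteq> (i \<in> {k})} = insert k A"
      "{i. (i \<in> insert k A) \<noteq> (i \<in> {k})} = A" "{i. (i \<in> {}) \<noteq> (i \<in> A)} = A"
      "{i. (i \<in> {k}) \<noteq> (i \<in> A)} = insert k A" using that by auto
    \<comment> \<open>Exchanging the copies in coordinate k turns \<open>F {}\<close> into
      \<open>F {k}\<close> and reverses the sign of the increment.\<close>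
    have "(LINT \<omega>|?G. F {} \<omega> * ?v \<omega>) = (LINT \<omega>|?G. F {k} \<omega> * (- ?v \<omega>))"
      using inv [OF borel_measurable_integrable [OF int [of "{}"]], of "{k}"]
      unfolding swF e1 minus_diff_eq by (rule sym)
    also have "\<dots> = - (LINT \<omega>|?G. F {k} \<omega> * ?v \<omega>)" unfolding mult_minus_right
        by (rule Bochner_Integration.integral_minus)
    finally have "2 * (LINT \<omega>|?G. F {} \<omega> * ?v \<omega>) = (LINT \<omega>|?G. F {} \<omega> * ?v \<omega>)
        - (LINT \<omega>|?G. F {k} \<omega> * ?v \<omega>)" by linarith
    also have "\<dots> = (LINT \<omega>|?G. ?u \<omega> * ?v \<omega>)"
      unfolding left_diff_distrib by (rule Bochner_Integration.integral_diff [OF int int,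
          symmetric])
    also have "\<dots> \<le> (LINT \<omega>|?G. (?u \<omega>)\<^sup>2 / 2 + (?v \<omega>)\<^sup>2 / 2)"
    proof (rule integral_mono)
      show "integrable ?G (\<lambda>\<omega>. ?u \<omega> * ?v \<omega>)"
        unfolding left_diff_distrib by (intro Bochner_Integration.integrable_diff int)
      show "integrable ?G (\<lambda>\<omega>. (?u \<omega>)\<^sup>2 / 2 + (?v \<omega>)\<^sup>2 / 2)"
        by (intro Bochner_Integration.integrable_add integrable_divide sq)
      show "?u \<omega> * ?v \<omega> \<le> (?u \<omega>)\<^sup>2 / 2 + (?v \<omega>)\<^sup>2 / 2" for \<omega>
        using sum_squares_bound [of "?u \<omega>" "?v \<omega>"] by linarith
    qed
    also have "\<dots> = (LINT \<omega>|?G. (?u \<omega>)\<^sup>2) / 2 + (LINT \<omega>|?G. (?v \<omega>)\<^sup>2) / 2"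
      by (subst Bochner_Integration.integral_add) (intro integrable_divide sq, intro
          integrable_divide sq, simp)
    also have "(LINT \<omega>|?G. (?v \<omega>)\<^sup>2) = (LINT \<omega>|?G. (?u \<omega>)\<^sup>2)"
      using inv [OF borel_measurable_integrable [OF sq [of "{}" "{k}"]], of A] unfolding swF e1 .
    finally show ?thesis by linarith
  qed
  have tele: "(LINT \<omega>|?G. F {} \<omega> * (F {} \<omega> - F A \<omega>)) \<le> (\<Sum>k\<in>A. (LINT \<omega>|?G. (F {} \<omega>
      - F {k} \<omega>)\<^sup>2) / 2)"
    if "finite A" for A
    using that
  proof induction
    case (insert k A)
    have "(LINT \<omega>|?G. F {} \<omega> * (F {} \<omega> - F (insert k A) \<omega>))
       = (LINT \<omega>|?G. F {} \<omega> * (F {} \<omega> - F A \<omega>) + F {} \<omega> * (F A \<omega> - F (insert k A) \<omega>))"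
      by (simp add: algebra_simps)
    also have "\<dots> = (LINT \<omega>|?G. F {} \<omega> * (F {} \<omega> - F A \<omega>)) + (LINT \<omega>|?G. F {} \<omega> * (F A \<omega>
        - F (insert k A) \<omega>))"
      unfolding right_diff_distrib
      by (rule Bochner_Integration.integral_add) (intro Bochner_Integration.integrable_diff FF)+
    finally show ?case using insert step [of k A] by simp
  qed simp
  \<comment> \<open>The same exchange interchanges the positive and the negative part of the
    difference.\<close>
  have half: "(LINT \<omega>|?G. (F {} \<omega> - F {k} \<omega>)\<^sup>2) = 2 * (LINT \<omega>|?G. (max 0 (F {} \<omega> - F {k} \<omega>))\<^sup>2)"
      for k
  proof -
    let ?p = "\<lambda>\<omega>. (max 0 (F {} \<omega> - F {k} \<omega>))\<^sup>2" and ?q = "\<lambda>\<omega>. (max 0 (F {k} \<omega> - F {} \<omega>))\<^sup>2"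
    have sq: "integrable ?G (\<lambda>\<omega>. (F B \<omega> - F D \<omega>)\<^sup>2)" for B D
      unfolding power2_diff mult.assoc
      by (intro Bochner_Integration.integrable_diff Bochner_Integration.integrable_add
          integrable_mult_right F2 FF)
    have pi: "integrable ?G (\<lambda>\<omega>. (max 0 (F B \<omega> - F D \<omega>))\<^sup>2)" for B D
    proof (rule Bochner_Integration.integrable_bound [OF sq])
      show "(\<lambda>\<omega>. (max 0 (F B \<omega> - F D \<omega>))\<^sup>2) \<in> borel_measurable ?G"
        by (intro borel_measurable_power borel_measurable_max borel_measurable_diff Fm) simp
      show "AE \<omega> in ?G. norm ((max 0 (F B \<omega> - F D \<omega>))\<^sup>2) \<le> norm ((F B \<omega> - F D \<omega>)\<^sup>2)"
        by (intro AE_I2) (auto simp: max_def)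
    qed
    have "(LINT \<omega>|?G. (F {} \<omega> - F {k} \<omega>)\<^sup>2) = (LINT \<omega>|?G. ?p \<omega> + ?q \<omega>)"
      by (rule Bochner_Integration.integral_cong) (auto simp: max_def power2_commute)
    also have "\<dots> = (LINT \<omega>|?G. ?p \<omega>) + (LINT \<omega>|?G. ?q \<omega>)"
      by (rule Bochner_Integration.integral_add [OF pi pi])
    also have "(LINT \<omega>|?G. ?q \<omega>) = (LINT \<omega>|?G. ?p \<omega>)"
    proof -
      have e: "{i. (i \<in> {}) \<noteq> (i \<in> {k})} = {k}" "{i. (i \<in> {k}) \<noteq> (i \<in> {k})} = {}" by auto
      show ?thesis
        using inv [OF borel_measurable_integrable [OF pi [of "{}" "{k}"]], of "{k}"]
            unfolding swF e .
    qed
    finally show ?thesis by simp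
  qed
  \<comment> \<open>\<open>F {}\<close> reads only the first copy and \<open>F K\<close> only the
    second, so the integral factorises.\<close>
  have indep: "(LINT \<omega>|?G. F {} \<omega> * F K \<omega>) = \<mu> * \<mu>"
  proof -
    interpret PS: product_sigma_finite "\<lambda>_::'i \<times> bool. std_gauss" ..
    let ?I = "K \<times> {False}" and ?J = "K \<times> {True}"
    have U: "K \<times> UNIV = ?I \<union> ?J" by auto
    have J0: "inj_on (\<lambda>k. (k, b)) K" "(\<lambda>k. (k, b)) \<in> K \<rightarrow> K \<times> {b}" for b :: bool
      by (auto simp: inj_on_def)
    have "(LINT \<omega>|?G. F {} \<omega> * F K \<omega>) = (LINT \<omega>|PiM (?I \<union> ?J) (\<lambda>_. std_gauss). F {} \<omega> * F K \<omega>)"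
      by (simp add: gauss_prod_def U)
    also have "\<dots> = (LINT x|PiM ?I (\<lambda>_. std_gauss). LINT y|PiM ?J (\<lambda>_. std_gauss).
        F {} (merge ?I ?J (x, y)) * F K (merge ?I ?J (x, y)))"
      by (rule PS.product_integral_fold) (use K FF [of "{}" K] in \<open>auto simp: gauss_prod_def U\<close>)
    also have "\<dots> = (LINT x|gauss_prod ?I. LINT y|gauss_prod ?J. f (\<lambda>k\<in>K. x (k, False)) * f (\<lambda>k\<in>K. y
        (k, True)))"
    proof -
      have "F {} (merge ?I ?J (x, y)) = f (\<lambda>k\<in>K. x (k, False))" "F K (merge ?I ?J (x, y))
          = f (\<lambda>k\<in>K. y (k, True))" for x y
        unfolding F_def resample_def by (auto intro!: arg_cong [where f
            = f] simp: restrict_def merge_def fun_eq_iff)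
      then show ?thesis by (simp only: gauss_prod_def)
    qed
    also have "\<dots> = (LINT x|gauss_prod ?I. f (\<lambda>k\<in>K. x (k, False))) * (LINT y|gauss_prod ?J. f (\<lambda>k\<in>K.
        y (k, True)))"
      by (simp only: integral_mult_right_zero integral_mult_left_zero)
    also have "\<dots> = \<mu> * \<mu>"
      unfolding gauss_prod_reindex(1) [OF J0 f] \<mu>_def ..
    finally show ?thesis .
  qed
  have "(LINT g|gauss_prod K. (f g - \<mu>)\<^sup>2) = (LINT g|gauss_prod K. (f g)\<^sup>2) - \<mu>\<^sup>2"
    using PK.variance_eq [OF f1 f2] unfolding \<mu>_def .
  also have "(LINT g|gauss_prod K. (f g)\<^sup>2) = (LINT \<omega>|?G. F {} \<omega> * F {} \<omega>)"
    using EF(1) [of "\<lambda>x. x * x" "{}"] by (simp add: power2_eq_square)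
  also have "(LINT \<omega>|?G. F {} \<omega> * F {} \<omega>) - \<mu>\<^sup>2 = (LINT \<omega>|?G. F {} \<omega> * (F {} \<omega> - F K \<omega>))"
    unfolding right_diff_distrib Bochner_Integration.integral_diff [OF FF FF] indep by
        (simp add: power2_eq_square)
  also have "\<dots> \<le> (\<Sum>k\<in>K. LINT \<omega>|?G. (max 0 (F {} \<omega> - F {k} \<omega>))\<^sup>2)"
    using tele [OF K] unfolding half by simp
  finally show ?thesis unfolding F_def \<mu>_def .
qed

section \<open>Suprema of bounded families of affine forms\<close>

text \<open>\<open>L\<close> bounds the Euclidean norm of every coefficient vector, which is the
  standard deviation of the form, and governs the variance of the supremum. \<open>C\<close> keeps
  the suprema finite.\<close>

locale affine_family =
  fixes K :: "'i set" and S :: "'s set" and a :: "'s \<Rightarrow> 'i \<Rightarrow> real" and c :: "'s \<Rightarrow> real"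
      and L C :: real
  assumes finite_index: "finite K" and nonempty: "S \<noteq> {}" and L_nonneg: "L \<ge> 0"
    and coeff_bound: "\<And>s. s \<in> S \<Longrightarrow> (\<Sum>k\<in>K. (a s k)\<^sup>2) \<le> L\<^sup>2"
    and const_bound: "\<And>s. s \<in> S \<Longrightarrow> \<bar>c s\<bar> \<le> C"
begin

lemma coeff_le: "s \<in> S \<Longrightarrow> k \<in> K \<Longrightarrow> \<bar>a s k\<bar> \<le> L"
proof -
  assume s: "s \<in> S" "k \<in> K"
  have "(a s k)\<^sup>2 \<le> (\<Sum>k\<in>K. (a s k)\<^sup>2)" using s finite_index by (intro member_le_sum) auto
  also have "\<dots> \<le> L\<^sup>2" by (rule coeff_bound [OF s(1)])
  finally show ?thesis using L_nonneg by (simp add: abs_le_square_iff [symmetric])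
qed

lemma member_bound: "s \<in> S \<Longrightarrow> \<bar>(\<Sum>k\<in>K. a s k * g k) + c s\<bar> \<le> C + L * (\<Sum>k\<in>K. \<bar>g k\<bar>)"
proof -
  assume s: "s \<in> S"
  have "\<bar>\<Sum>k\<in>K. a s k * g k\<bar> \<le> (\<Sum>k\<in>K. L * \<bar>g k\<bar>)"
    by (rule order_trans [OF sum_abs]) (auto simp: abs_mult intro!: sum_mono mult_right_mono
        coeff_le s)
  then show ?thesis using const_bound [OF s] by (simp add: sum_distrib_left)
qed

lemma bdd_above_members: "bdd_above ((\<lambda>s. (\<Sum>k\<in>K. a s k * g k) + c s) ` S)"
  by (rule bdd_aboveI2 [of _ _ "C + L * (\<Sum>k\<in>K. \<bar>g k\<bar>)"])
      (use member_bound [of _ g] in \<open>simp add: abs_le_iff\<close>)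

lemma affine_sup_upper: "s \<in> S \<Longrightarrow> (\<Sum>k\<in>K. a s k * g k) + c s \<le> affine_sup K S a c g"
  unfolding affine_sup_def by (rule cSUP_upper [OF _ bdd_above_members])

lemma affine_sup_least:
  "(\<And>s. s \<in> S \<Longrightarrow> (\<Sum>k\<in>K. a s k * g k) + c s \<le> x) \<Longrightarrow> affine_sup K S a c g \<le> x"
  unfolding affine_sup_def by (rule cSUP_least [OF nonempty])

lemma affine_sup_bound: "\<bar>affine_sup K S a c g\<bar> \<le> C + L * (\<Sum>k\<in>K. \<bar>g k\<bar>)"
  unfolding affine_sup_def by (rule cSup_abs_le) (use nonempty member_bound in auto)

text \<open>Coefficients and constants are rounded down to multiples of \<open>\<epsilon>\<close>.
  Boundedness leaves finitely many cells, and one member of S from each occupied cell is enough.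
  Measurability and Slepian's inequality thereby reduce to finite families.\<close>

lemma finite_approximation:
  assumes "\<epsilon> > 0"
  shows "\<exists>T\<subseteq>S. finite T \<and> T \<noteq> {} \<and>
    (\<forall>g. affine_sup K T a c g \<le> affine_sup K S a c g \<and>
         affine_sup K S a c g \<le> affine_sup K T a c g + \<epsilon> * (1 + (\<Sum>k\<in>K. \<bar>g k\<bar>)))"
proof -
  define \<phi> where "\<phi> s = (restrict (\<lambda>k. \<lfloor>a s k / \<epsilon>\<rfloor>) K, \<lfloor>c s / \<epsilon>\<rfloor>)" for s
  define m where "m = \<lfloor>(L + \<bar>C\<bar>) / \<epsilon>\<rfloor> + 1"
  have fl: "\<lfloor>x / \<epsilon>\<rfloor> \<in> {-m..m}" if "\<bar>x\<bar> \<le> L + \<bar>C\<bar>" for x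
  proof -
    have "x / \<epsilon> \<le> (L + \<bar>C\<bar>) / \<epsilon>" using that assms by (intro divide_right_mono) auto
    then have "\<lfloor>x / \<epsilon>\<rfloor> \<le> \<lfloor>(L + \<bar>C\<bar>) / \<epsilon>\<rfloor>" by (rule floor_mono)
    moreover have "- ((L + \<bar>C\<bar>) / \<epsilon>) \<le> x / \<epsilon>"
      using that assms unfolding minus_divide_left by (intro divide_right_mono) auto
    then have "\<lfloor>- ((L + \<bar>C\<bar>) / \<epsilon>)\<rfloor> \<le> \<lfloor>x / \<epsilon>\<rfloor>" by (rule floor_mono)
    ultimately show ?thesis unfolding m_def atLeastAtMost_iff by linarith
  qed
  have "\<phi> ` S \<subseteq> (K \<rightarrow>\<^sub>E {-m..m}) \<times> {-m..m}"
  proof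
    fix y assume "y \<in> \<phi> ` S"
    then obtain s where s: "s \<in> S" "y = \<phi> s" by auto
    have "\<bar>a s k\<bar> \<le> L + \<bar>C\<bar>" if "k \<in> K" for k using coeff_le [OF s(1) that] by linarith
    moreover have "\<bar>c s\<bar> \<le> L + \<bar>C\<bar>" using const_bound [OF s(1)] L_nonneg by linarith
    ultimately show "y \<in> (K \<rightarrow>\<^sub>E {-m..m}) \<times> {-m..m}" using fl unfolding s(2) \<phi>_def by
        (auto simp del: atLeastAtMost_iff)
  qed
  then have fin: "finite (\<phi> ` S)"
    by (rule finite_subset) (intro finite_cartesian_product finite_PiE finite_index
        finite_atLeastAtMost_int)
  define T where "T = inv_into S \<phi> ` \<phi> ` S"
  have T: "T \<subseteq> S" "finite T" "T \<noteq> {}"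
    using fin nonempty by (auto simp: T_def inv_into_into)
  have close: "\<bar>x - y\<bar> \<le> \<epsilon>" if "\<lfloor>x / \<epsilon>\<rfloor> = \<lfloor>y / \<epsilon>\<rfloor>" for x y
  proof -
    have "\<bar>x / \<epsilon> - y / \<epsilon>\<bar> \<le> 1" using that by linarith
    then have "\<bar>(x - y) / \<epsilon>\<bar> \<le> 1" by (simp add: diff_divide_distrib)
    then show ?thesis using assms by (simp add: abs_divide)
  qed
  interpret T: affine_family K T a c L C
    using T finite_index L_nonneg coeff_bound const_bound by unfold_locales auto
  have "affine_sup K T a c g \<le> affine_sup K S a c g" for g
    using T(1) by (intro T.affine_sup_least affine_sup_upper) auto
  moreover have "affine_sup K S a c g \<le> affine_sup K T a c g + \<epsilon> * (1 + (\<Sum>k\<in>K. \<bar>g k\<bar>))" for g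
  proof (rule affine_sup_least)
    fix s assume s: "s \<in> S"
    define r where "r = inv_into S \<phi> (\<phi> s)"
    have r: "r \<in> T" "\<phi> r = \<phi> s" using s by (auto simp: r_def T_def f_inv_into_f)
    have ca: "\<bar>a s k - a r k\<bar> \<le> \<epsilon>" if "k \<in> K" for k
    proof (rule close)
      have "fst (\<phi> r) k = fst (\<phi> s) k" using r by simp
      then show "\<lfloor>a s k / \<epsilon>\<rfloor> = \<lfloor>a r k / \<epsilon>\<rfloor>" using that by (simp add: \<phi>_def)
    qed
    have cc: "\<bar>c s - c r\<bar> \<le> \<epsilon>" using r by (intro close) (simp add: \<phi>_def)
    have "(\<Sum>k\<in>K. a s k * g k) - (\<Sum>k\<in>K. a r k * g k) \<le> (\<Sum>k\<in>K. \<epsilon> * \<bar>g k\<bar>)"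
      unfolding sum_subtractf [symmetric]
    proof (rule sum_mono)
      fix k assume "k \<in> K"
      have "a s k * g k - a r k * g k \<le> \<bar>a s k - a r k\<bar> * \<bar>g k\<bar>"
        unfolding left_diff_distrib [symmetric] abs_mult [symmetric] by (rule abs_ge_self)
      also have "\<dots> \<le> \<epsilon> * \<bar>g k\<bar>" by (intro mult_right_mono ca \<open>k \<in> K\<close>) simp
      finally show "a s k * g k - a r k * g k \<le> \<epsilon> * \<bar>g k\<bar>" .
    qed
    then have "(\<Sum>k\<in>K. a s k * g k) + c s \<le> ((\<Sum>k\<in>K. a r k * g k) + c r) + \<epsilon> * (1 + (\<Sum>k\<in>K. \<bar>g k\<bar>))"
      using cc by (simp add: distrib_left sum_distrib_left)
    also have "\<dots> \<le> affine_sup K T a c g + \<epsilon> * (1 + (\<Sum>k\<in>K. \<bar>g k\<bar>))"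
      using T.affine_sup_upper [OF r(1)] by simp
    finally show "(\<Sum>k\<in>K. a s k * g k) + c s \<le> affine_sup K T a c g + \<epsilon> * (1 + (\<Sum>k\<in>K. \<bar>g k\<bar>))" .
  qed
  ultimately show ?thesis using T by blast
qed

text \<open>S may be uncountable; the supremum is the pointwise limit of suprema over finite
  subsets.\<close>

lemma affine_sup_measurable: "affine_sup K S a c \<in> borel_measurable (gauss_prod K)"
proof -
  obtain T where T: "\<And>n. T n \<subseteq> S" "\<And>n. finite (T n)" "\<And>n. T n \<noteq> {}"
    "\<And>n g. affine_sup K (T n) a c g \<le> affine_sup K S a c g"
    "\<And>n g. affine_sup K S a c g \<le> affine_sup K (T n) a c g + 1 / real (Suc n) * (1 + (\<Sum>k\<in>K. \<bar>g k\<bar>))"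
  proof -
    have "\<forall>n. \<exists>T\<subseteq>S. finite T \<and> T \<noteq> {} \<and>
      (\<forall>g. affine_sup K T a c g \<le> affine_sup K S a c g \<and>
         affine_sup K S a c g \<le> affine_sup K T a c g + 1 / real (Suc n) * (1 + (\<Sum>k\<in>K. \<bar>g k\<bar>)))"
      by (intro allI finite_approximation) simp
    from choice [OF this] show ?thesis using that by blast
  qed
  show ?thesis
  proof (rule borel_measurable_LIMSEQ_real)
    show "affine_sup K (T n) a c \<in> borel_measurable (gauss_prod K)" for n
      by (rule affine_sup_finite_measurable [OF T(2,3)])
    fix g
    have "(\<lambda>n. affine_sup K S a c g - 1 / real (Suc n) * (1 + (\<Sum>k\<in>K. \<bar>g k\<bar>))) \<longlonglongrightarrow> affine_sup K S a c g
        - 0 * (1 + (\<Sum>k\<in>K. \<bar>g k\<bar>))"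
      by (intro tendsto_diff tendsto_mult tendsto_const) real_asymp
    then have 1: "(\<lambda>n. affine_sup K S a c g - 1 / real (Suc n) * (1 + (\<Sum>k\<in>K. \<bar>g k\<bar>)))
        \<longlonglongrightarrow> affine_sup K S a c g"
      by simp
    show "(\<lambda>n. affine_sup K (T n) a c g) \<longlonglongrightarrow> affine_sup K S a c g"
      by (rule tendsto_sandwich [OF _ _ 1 tendsto_const])
         (use T(4) [where g = g] T(5) [where g = g] in \<open>simp_all only: diff_le_eq eventually_True
             simp_thms\<close>)
  qed
qed

lemma affine_sup_integrable: "integrable (gauss_prod K) (affine_sup K S a c)"
  by (rule gauss_prod_integrable_linear [OF finite_index affine_sup_measurable affine_sup_bound])

lemma affine_sup_square_integrable: "integrable (gauss_prod K) (\<lambda>g. (affine_sup K S a c g)\<^sup>2)"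
proof (rule Bochner_Integration.integrable_bound)
  interpret prob_space "gauss_prod K" by (rule prob_space_gauss_prod)
  let ?n = "real (card K)"
  show "integrable (gauss_prod K) (\<lambda>g. 2 * C\<^sup>2 + 2 * L\<^sup>2 * (?n * (\<Sum>k\<in>K. (g k)\<^sup>2)))"
    by (intro Bochner_Integration.integrable_add integrable_mult_right
        Bochner_Integration.integrable_sum
        gauss_prod_integrable_component) auto
  show "(\<lambda>g. (affine_sup K S a c g)\<^sup>2) \<in> borel_measurable (gauss_prod K)"
    by (intro borel_measurable_power affine_sup_measurable)
  have "(affine_sup K S a c g)\<^sup>2 \<le> 2 * C\<^sup>2 + 2 * L\<^sup>2 * (?n * (\<Sum>k\<in>K. (g k)\<^sup>2))" for g
  proof -
    let ?G = "\<Sum>k\<in>K. \<bar>g k\<bar>"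
    have "(affine_sup K S a c g)\<^sup>2 \<le> (C + L * ?G)\<^sup>2"
      using affine_sup_bound [of g] by (rule abs_le_square_iff [THEN
          iffD1, OF order_trans [OF _ abs_ge_self]])
    also have "\<dots> \<le> 2 * C\<^sup>2 + 2 * (L * ?G)\<^sup>2"
      using sum_squares_bound [of C "L * ?G"] by (simp add: power2_sum)
    also have "?G\<^sup>2 \<le> ?n * (\<Sum>k\<in>K. (g k)\<^sup>2)"
      using sum_squared_le_sum_of_squares [of "\<lambda>k. \<bar>g k\<bar>" K] by (simp add: mult.commute)
    then have "(L * ?G)\<^sup>2 \<le> L\<^sup>2 * (?n * (\<Sum>k\<in>K. (g k)\<^sup>2))"
      unfolding power_mult_distrib by (rule mult_left_mono) simp
    finally show ?thesis by simp
  qed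
  then show "AE g in gauss_prod K. norm ((affine_sup K S a c g)\<^sup>2) \<le> norm (2 * C\<^sup>2
      + 2 * L\<^sup>2 * (?n * (\<Sum>k\<in>K. (g k)\<^sup>2)))"
    by (intro AE_I2) (simp only: real_norm_def, subst abs_of_nonneg, simp, rule order_trans [OF _
        abs_ge_self])
qed

text \<open>One near-maximiser s for the original array serves all coordinates at once: resampling k
  lowers the form at s by at most \<open>\<bar>a s k\<bar>\<close> times the change of that entry,
  and the squares of the \<open>a s k\<close> sum to at most L^2. The slack
  \<open>\<epsilon>\<close>, there because the supremum need not be attained, tends to 0.\<close>

lemma affine_sup_resample:
  assumes M: "\<And>k. k \<in> K \<Longrightarrow> (\<omega> (k, False) - \<omega> (k, True))\<^sup>2 \<le> M" and M0: "0 \<le> M"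
  shows "(\<Sum>k\<in>K. (max 0 (affine_sup K S a c (resample K {} \<omega>)
      - affine_sup K S a c (resample K {k} \<omega>)))\<^sup>2) \<le> 2 * L\<^sup>2 * M"
proof -
  let ?f = "affine_sup K S a c"
  let ?lhs = "\<Sum>k\<in>K. (max 0 (?f (resample K {} \<omega>) - ?f (resample K {k} \<omega>)))\<^sup>2"
  have "?lhs \<le> 2 * L\<^sup>2 * M + 2 * real (card K) * \<epsilon>\<^sup>2" if "\<epsilon> > 0" for \<epsilon>
  proof -
    have "\<exists>s\<in>S. ?f (resample K {} \<omega>) - \<epsilon> < (\<Sum>k\<in>K. a s k * resample K {} \<omega> k) + c s"
      using less_cSUP_iff [OF nonempty bdd_above_members, of "?f (resample K {} \<omega>) - \<epsilon>"
          "resample K {} \<omega>"] that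
      unfolding affine_sup_def by simp
    then obtain s where s: "s \<in> S" "?f (resample K {} \<omega>) - \<epsilon> < (\<Sum>k\<in>K. a s k * resample K {} \<omega> k)
        + c s" by blast
    have "(max 0 (?f (resample K {} \<omega>) - ?f (resample K {k} \<omega>)))\<^sup>2 \<le> 2 * \<epsilon>\<^sup>2 + 2 * (a s k)\<^sup>2 * M"
        if k: "k \<in> K" for k
    proof -
      let ?d = "\<omega> (k, False) - \<omega> (k, True)"
      have "(\<Sum>i\<in>K. a s i * resample K {} \<omega> i) - (\<Sum>i\<in>K. a s i * resample K {k} \<omega> i) = a s k * ?d"
        unfolding sum_subtractf [symmetric] right_diff_distrib [symmetric]
        by (subst sum.remove [OF finite_index k]) (simp add: resample_def k)
      then have "?f (resample K {} \<omega>) - ?f (resample K {k} \<omega>) \<le> \<epsilon> + a s k * ?d"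
        using s(2) affine_sup_upper [OF s(1), of "resample K {k} \<omega>"] by linarith
      then have "max 0 (?f (resample K {} \<omega>) - ?f (resample K {k} \<omega>)) \<le> \<bar>\<epsilon> + a s k * ?d\<bar>"
          by linarith
      then have "(max 0 (?f (resample K {} \<omega>) - ?f (resample K {k} \<omega>)))\<^sup>2 \<le> (\<epsilon> + a s k * ?d)\<^sup>2"
        unfolding power2_abs [of "\<epsilon> + a s k * ?d", symmetric] by (rule power_mono) simp
      also have "\<dots> \<le> 2 * \<epsilon>\<^sup>2 + 2 * (a s k * ?d)\<^sup>2"
        using sum_squares_bound [of \<epsilon> "a s k * ?d"] by (simp add: power2_sum)
      also have "(a s k * ?d)\<^sup>2 \<le> (a s k)\<^sup>2 * M"
        unfolding power_mult_distrib by (intro mult_left_mono M k) simp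
      finally show ?thesis by simp
    qed
    then have "?lhs \<le> (\<Sum>k\<in>K. 2 * \<epsilon>\<^sup>2 + 2 * (a s k)\<^sup>2 * M)" by (rule sum_mono)
    also have "\<dots> = 2 * real (card K) * \<epsilon>\<^sup>2 + 2 * (\<Sum>k\<in>K. (a s k)\<^sup>2) * M"
      by (simp add: sum.distrib sum_distrib_left sum_distrib_right mult.assoc)
    also have "\<dots> \<le> 2 * real (card K) * \<epsilon>\<^sup>2 + 2 * L\<^sup>2 * M"
      using coeff_bound [OF s(1)] M0 by (intro add_left_mono mult_right_mono) auto
    finally show ?thesis by linarith
  qed
  then have "?lhs \<le> 2 * L\<^sup>2 * M + 2 * real (card K) * (1 / real (Suc n))\<^sup>2" for n by simp
  moreover have "(\<lambda>n. 2 * L\<^sup>2 * M + 2 * real (card K) * (1 / real (Suc n))\<^sup>2) \<longlonglongrightarrow> 2 * L\<^sup>2 * M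
      + 2 * real (card K) * 0\<^sup>2"
    by (intro tendsto_intros) real_asymp
  ultimately show ?thesis by (intro LIMSEQ_le_const [of _ "2 * L\<^sup>2 * M"]) auto
qed

end

section \<open>Variance of the supremum of a bounded family\<close>

definition gauss_eighth_moment :: real where
  "gauss_eighth_moment = (LINT z|std_gauss. z ^ 8)"

lemma gauss_eighth_moment_nonneg: "gauss_eighth_moment \<ge> 0"
  unfolding gauss_eighth_moment_def by (intro integral_nonneg_AE AE_I2) simp

text \<open>A squared difference of the two copies is either at most m or at most its fourth power
  divided by m^3. The largest of them is hence at most \<open>m + D / m ^ 3\<close>, with a
  \<open>D\<close> that dominates the sum of the eighth powers. The parameter m is left free for
  balancing.\<close>

lemma (in affine_family) affine_sup_variance:
  assumes m: "m > 0"
  shows "(LINT g|gauss_prod K. (affine_sup K S a c g - integral\<^sup>L (gauss_prod K) (affine_sup K S a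
      c))\<^sup>2)
    \<le> 2 * L\<^sup>2 * (m + real (card K) * (256 * gauss_eighth_moment) / m ^ 3)"
proof -
  let ?f = "affine_sup K S a c"
  let ?G = "gauss_prod (K \<times> (UNIV :: bool set))"
  interpret PG: prob_space ?G by (rule prob_space_gauss_prod)
  define D where "D \<omega> = (\<Sum>k\<in>K. 128 * ((\<omega> (k, False)) ^ 8 + (\<omega> (k, True)) ^ 8))" for \<omega> ::
      "'i \<times> bool \<Rightarrow> real"
  \<comment> \<open>128 = 2^7 is the convexity constant of the eighth power; the two copies make it
    256 in the mean.\<close>
  have p8: "(x - y) ^ 8 \<le> 128 * (x ^ 8 + y ^ 8)" for x y :: real
  proof -
    have s: "(u - v)\<^sup>2 \<le> 2 * (u\<^sup>2 + v\<^sup>2)" "(u + v)\<^sup>2 \<le> 2 * (u\<^sup>2 + v\<^sup>2)" for u v :: real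
      using sum_squares_bound [of u v] sum_squares_bound [of u "- v"] by
          (simp_all add: power2_diff power2_sum)
    have s4: "(2 * (u + v))\<^sup>2 \<le> 8 * (u\<^sup>2 + v\<^sup>2)" "(8 * (u + v))\<^sup>2 \<le> 128 * (u\<^sup>2 + v\<^sup>2)"
        for u v :: real
      using s(2) [of u v] unfolding power_mult_distrib by simp_all
    have "((x - y)\<^sup>2)\<^sup>2 \<le> (2 * (x\<^sup>2 + y\<^sup>2))\<^sup>2" by (intro power_mono s) simp
    also have "\<dots> \<le> 8 * ((x\<^sup>2)\<^sup>2 + (y\<^sup>2)\<^sup>2)" by (rule s4)
    finally have "(((x - y)\<^sup>2)\<^sup>2)\<^sup>2 \<le> (8 * ((x\<^sup>2)\<^sup>2 + (y\<^sup>2)\<^sup>2))\<^sup>2" by (rule power_mono) simp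
    also have "\<dots> \<le> 128 * (((x\<^sup>2)\<^sup>2)\<^sup>2 + ((y\<^sup>2)\<^sup>2)\<^sup>2)" by (rule s4)
    finally show ?thesis by (simp flip: power_mult)
  qed
  have D0: "D \<omega> \<ge> 0" for \<omega> unfolding D_def by (intro sum_nonneg) simp
  have M: "(\<omega> (k, False) - \<omega> (k, True))\<^sup>2 \<le> m + D \<omega> / m ^ 3" if k: "k \<in> K" for \<omega> k
  proof -
    let ?x = "(\<omega> (k, False) - \<omega> (k, True))\<^sup>2"
    have "?x ^ 4 \<le> 128 * ((\<omega> (k, False)) ^ 8 + (\<omega> (k, True)) ^ 8)"
      using p8 [of "\<omega> (k, False)" "\<omega> (k, True)"] by (simp flip: power_mult)
    also have "\<dots> \<le> D \<omega>" unfolding D_def using finite_index k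
      by (intro member_le_sum [of k K "\<lambda>k. 128 * ((\<omega> (k, False)) ^ 8 + (\<omega> (k, True)) ^ 8)"]) auto
    finally have x4: "?x ^ 4 \<le> D \<omega>" .
    show ?thesis
    proof (cases "?x \<le> m")
      case True then show ?thesis using D0 [of \<omega>] m by (simp add: add_increasing2)
    next
      case False
      then have "m ^ 3 \<le> ?x ^ 3" using m by (intro power_mono) auto
      then have "?x * m ^ 3 \<le> ?x * ?x ^ 3" by (rule mult_left_mono) simp
      also have "\<dots> = ?x ^ 4" by (simp add: numeral_eq_Suc)
      finally have "?x * m ^ 3 \<le> D \<omega>" using x4 by linarith
      then have "?x \<le> D \<omega> / m ^ 3" using m by (simp add: pos_le_divide_eq)
      then show ?thesis using m by linarith
    qed
  qed
  have i8: "integrable ?G (\<lambda>\<omega>. (\<omega> (k, b)) ^ 8)" "(LINT \<omega>|?G. (\<omega> (k, b)) ^ 8) = gauss_eighth_moment"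
      if "k \<in> K" for k b
    using gauss_prod_integrable_component(3) [of "(k, b)" "K \<times> UNIV" 8]
      gauss_prod_component(1) [of "(k, b)" "K \<times> UNIV" "\<lambda>z. z ^ 8"] that
    by (auto simp: gauss_eighth_moment_def)
  have Di: "integrable ?G D"
    unfolding D_def [abs_def]
    by (intro Bochner_Integration.integrable_sum integrable_mult_right
        Bochner_Integration.integrable_add i8)
  have ED: "(LINT \<omega>|?G. D \<omega>) = real (card K) * (256 * gauss_eighth_moment)"
  proof -
    have "(LINT \<omega>|?G. D \<omega>) = (\<Sum>k\<in>K. LINT \<omega>|?G. 128 * ((\<omega> (k, False)) ^ 8 + (\<omega> (k, True)) ^ 8))"
      unfolding D_def
      by (intro Bochner_Integration.integral_sum integrable_mult_right
          Bochner_Integration.integrable_add i8)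
    also have "\<dots> = (\<Sum>k\<in>K. 256 * gauss_eighth_moment)"
    proof (rule sum.cong [OF refl])
      fix k assume k: "k \<in> K"
      show "(LINT \<omega>|?G. 128 * ((\<omega> (k, False)) ^ 8 + (\<omega> (k, True)) ^ 8)) = 256 * gauss_eighth_moment"
        unfolding integral_mult_right_zero Bochner_Integration.integral_add [OF i8(1) [OF k] i8(1)
            [OF k]] i8(2) [OF k] by simp
    qed
    finally show ?thesis by simp
  qed
  have inj: "inj_on (\<lambda>k. (k, k \<in> A)) K" "(\<lambda>k. (k, k \<in> A)) \<in> K \<rightarrow> K \<times> UNIV" for A
    by (auto simp: inj_on_def)
  have Fm: "(\<lambda>\<omega>. ?f (resample K A \<omega>)) \<in> borel_measurable ?G" for A
    unfolding resample_def by (rule gauss_prod_reindex(3) [OF inj affine_sup_measurable])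
  let ?p = "\<lambda>k \<omega>. (max 0 (?f (resample K {} \<omega>) - ?f (resample K {k} \<omega>)))\<^sup>2"
  have pm: "?p k \<in> borel_measurable ?G" for k
    by (intro borel_measurable_power borel_measurable_max borel_measurable_diff Fm) simp
  have sum_le: "(\<Sum>k\<in>K. ?p k \<omega>) \<le> 2 * L\<^sup>2 * (m + D \<omega> / m ^ 3)" for \<omega>
    by (rule affine_sup_resample, rule M) (use D0 [of \<omega>] m in simp_all)
  have bi: "integrable ?G (\<lambda>\<omega>. 2 * L\<^sup>2 * (m + D \<omega> / m ^ 3))"
    by (intro integrable_mult_right Bochner_Integration.integrable_add integrable_divide Di) simp
  have pi: "integrable ?G (?p k)" if k: "k \<in> K" for k
  proof (rule Bochner_Integration.integrable_bound [OF bi pm])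
    have "?p k \<omega> \<le> 2 * L\<^sup>2 * (m + D \<omega> / m ^ 3)" for \<omega>
      by (rule order_trans [OF member_le_sum [of k K "\<lambda>k. ?p k \<omega>"] sum_le])
          (use k finite_index in auto)
    then show "AE \<omega> in ?G. norm (?p k \<omega>) \<le> norm (2 * L\<^sup>2 * (m + D \<omega> / m ^ 3))"
      by (intro AE_I2) (simp only: real_norm_def, subst abs_of_nonneg, simp, rule order_trans [OF _
          abs_ge_self])
  qed
  have "(LINT g|gauss_prod K. (?f g - integral\<^sup>L (gauss_prod K) ?f)\<^sup>2) \<le> (\<Sum>k\<in>K. LINT \<omega>|?G. ?p k \<omega>)"
    by (rule efron_stein [OF finite_index affine_sup_measurable affine_sup_square_integrable])
  also have "\<dots> = (LINT \<omega>|?G. (\<Sum>k\<in>K. ?p k \<omega>))"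
    by (rule Bochner_Integration.integral_sum [symmetric, OF pi])
  also have "\<dots> \<le> (LINT \<omega>|?G. 2 * L\<^sup>2 * (m + D \<omega> / m ^ 3))"
    by (rule integral_mono [OF Bochner_Integration.integrable_sum [OF pi] bi sum_le])
  also have "\<dots> = 2 * L\<^sup>2 * (m + (LINT \<omega>|?G. D \<omega>) / m ^ 3)"
    unfolding integral_mult_right_zero Bochner_Integration.integral_add [OF PG.integrable_const
        integrable_divide [OF Di]]
    by (simp add: PG.prob_space)
  finally show ?thesis unfolding ED .
qed

text \<open>The finite approximation is applied to the smaller side. On the larger side, passing
  from S to a subset only decreases the supremum, so no error arises there.\<close>

lemma slepian:
  assumes "affine_family K S a c L C" "affine_family J S b c L' C'"
    and off: "\<And>s t. s \<in> S \<Longrightarrow> t \<in> S \<Longrightarrow> (\<Sum>k\<in>K. a s k * a t k) \<le> (\<Sum>l\<in>J. b s l * b t l)"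
    and diag: "\<And>s. s \<in> S \<Longrightarrow> (\<Sum>k\<in>K. a s k * a s k) = (\<Sum>l\<in>J. b s l * b s l)"
  shows "integral\<^sup>L (gauss_prod J) (affine_sup J S b c) \<le> integral\<^sup>L (gauss_prod K) (affine_sup K S
      a c)"
proof -
  interpret A: affine_family K S a c L C by fact
  interpret B: affine_family J S b c L' C' by fact
  interpret PJ: prob_space "gauss_prod J" by (rule prob_space_gauss_prod)
  let ?W = "LINT g|gauss_prod J. 1 + (\<Sum>k\<in>J. \<bar>g k\<bar>)"
  have wi: "integrable (gauss_prod J) (\<lambda>g. \<epsilon> * (1 + (\<Sum>k\<in>J. \<bar>g k\<bar>)))" for \<epsilon>
    by (intro integrable_mult_right Bochner_Integration.integrable_add
        Bochner_Integration.integrable_sum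
        gauss_prod_integrable_component) auto
  have main: "integral\<^sup>L (gauss_prod J) (affine_sup J S b c)
      \<le> integral\<^sup>L (gauss_prod K) (affine_sup K S a c) + \<epsilon> * ?W"
    if e: "\<epsilon> > 0" for \<epsilon>
  proof -
    obtain T where T: "T \<subseteq> S" "finite T" "T \<noteq> {}"
      "\<And>g. affine_sup J S b c g \<le> affine_sup J T b c g + \<epsilon> * (1 + (\<Sum>k\<in>J. \<bar>g k\<bar>))"
      using B.finite_approximation [OF e] by blast
    have "integral\<^sup>L (gauss_prod J) (affine_sup J S b c)
        \<le> (LINT g|gauss_prod J. affine_sup J T b c g + \<epsilon> * (1 + (\<Sum>k\<in>J. \<bar>g k\<bar>)))"
      by (rule integral_mono [OF B.affine_sup_integrable Bochner_Integration.integrable_add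
            [OF affine_sup_finite_integrable [OF T(2,3) B.finite_index] wi] T(4)])
    also have "\<dots> = integral\<^sup>L (gauss_prod J) (affine_sup J T b c) + \<epsilon> * ?W"
      unfolding Bochner_Integration.integral_add [OF affine_sup_finite_integrable [OF T(2,3)
          B.finite_index] wi]
        integral_mult_right_zero ..
    also have "integral\<^sup>L (gauss_prod J) (affine_sup J T b c)
        \<le> integral\<^sup>L (gauss_prod K) (affine_sup K T a c)"
      using T(1) by (intro slepian_finite T A.finite_index B.finite_index off diag) auto
    also have "\<dots> \<le> integral\<^sup>L (gauss_prod K) (affine_sup K S a c)"
    proof (rule integral_mono [OF affine_sup_finite_integrable [OF T(2,3) A.finite_index]
        A.affine_sup_integrable])
      interpret T: affine_family K T a c L C
        using T A.finite_index A.L_nonneg A.coeff_bound A.const_bound by unfold_locales auto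
      show "affine_sup K T a c g \<le> affine_sup K S a c g" for g
        using T(1) by (intro T.affine_sup_least A.affine_sup_upper) auto
    qed
    finally show ?thesis by simp
  qed
  have "(\<lambda>n. integral\<^sup>L (gauss_prod K) (affine_sup K S a c) + 1 / real (Suc n) * ?W)
      \<longlonglongrightarrow> integral\<^sup>L (gauss_prod K) (affine_sup K S a c) + 0 * ?W"
    by (intro tendsto_add tendsto_mult tendsto_const) real_asymp
  then have "integral\<^sup>L (gauss_prod J) (affine_sup J S b c)
      \<le> integral\<^sup>L (gauss_prod K) (affine_sup K S a c) + 0 * ?W"
    by (rule LIMSEQ_le_const) (intro exI allI impI main, simp)
  then show ?thesis by simp
qed

section \<open>Overlap matrices\<close>

lemma quadratic_form_shift:
  fixes e :: "'k::finite \<Rightarrow> 'k \<Rightarrow> real"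
  assumes sym: "\<And>i j. e i j = e j i"
  shows "(\<Sum>i\<in>UNIV. \<Sum>j\<in>UNIV. (x i + (if i = a then t else 0)) * e i j * (x j + (if j
      = a then t else 0)))
    = (\<Sum>i\<in>UNIV. \<Sum>j\<in>UNIV. x i * e i j * x j) + 2 * t * (\<Sum>i\<in>UNIV. e a i * x i) + t\<^sup>2 * e a a"
proof -
  have d: "(\<Sum>j\<in>UNIV. f j * (if j = a then t else 0)) = f a * t" for f :: "'k \<Rightarrow> real"
    using sum.delta [of UNIV a "\<lambda>j. f j * t"] by (simp add: if_distrib [of "\<lambda>y. _ * y"] cong:
        if_cong)
  let ?d = "\<lambda>i. if i = a then t else 0"
  have "(\<Sum>i\<in>UNIV. \<Sum>j\<in>UNIV. (x i + ?d i) * e i j * (x j + ?d j))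
      = (\<Sum>i\<in>UNIV. \<Sum>j\<in>UNIV. x i * e i j * x j) + (\<Sum>i\<in>UNIV. \<Sum>j\<in>UNIV. (x i * e i j) * ?d j)
        + ((\<Sum>i\<in>UNIV. (\<Sum>j\<in>UNIV. e i j * x j) * ?d i) + (\<Sum>i\<in>UNIV. (\<Sum>j\<in>UNIV. e i j * ?d j) * ?d i))"
    unfolding sum.distrib [symmetric] sum_distrib_right
    by (intro sum.cong refl) (simp add: distrib_left distrib_right mult_ac)
  also have "\<dots> = (\<Sum>i\<in>UNIV. \<Sum>j\<in>UNIV. x i * e i j * x j) + (\<Sum>i\<in>UNIV. x i * e i a * t)
        + ((\<Sum>j\<in>UNIV. e a j * x j) * t + e a a * t * t)"
    unfolding d ..
  also have "(\<Sum>i\<in>UNIV. x i * e i a * t) = (\<Sum>i\<in>UNIV. e a i * x i) * t"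
    unfolding sum_distrib_right by (intro sum.cong refl) (simp add: sym [of _ a])
  finally show ?thesis by (simp add: power2_eq_square)
qed

text \<open>Symmetric Gaussian elimination: A contains the indices of the rows not yet eliminated,
  and each index splits off one square.\<close>

lemma psd_decomposition_on:
  fixes e :: "'k::finite \<Rightarrow> 'k \<Rightarrow> real"
  assumes "finite A"
    and "\<And>i j. e i j = e j i" "\<And>x. 0 \<le> (\<Sum>i\<in>UNIV. \<Sum>j\<in>UNIV. x i * e i j * x j)"
    and "\<And>i j. i \<notin> A \<Longrightarrow> e i j = 0"
  shows "\<exists>b. \<forall>i j. e i j = (\<Sum>a\<in>A. b a i * b a j)"
  using assms
proof (induction A arbitrary: e rule: finite_induct)
  case (insert a A)
  note sym = insert.prems(1) and psd = insert.prems(2) and zero = insert.prems(3)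
  have aa: "0 \<le> e a a"
    using psd [of "\<lambda>i. 0 + (if i = a then 1 else 0)"] unfolding quadratic_form_shift [OF sym]
        by simp
  show ?case
  proof (cases "e a a = 0")
    case True
    \<comment> \<open>A zero on the diagonal of a non-negative form forces its row to vanish;
      otherwise a suitable shift along coordinate a makes the form negative.\<close>
    have "e a j = 0" for j
    proof (rule ccontr)
      assume ne: "e a j \<noteq> 0"
      let ?t = "- (e j j + 1) / (2 * e a j)" and ?u = "\<lambda>i. 0 + (if i = j then 1 else 0) :: real"
      have "(\<Sum>i\<in>UNIV. e a i * ?u i) = (\<Sum>i\<in>UNIV. if i = j then e a i else 0)"
        by (intro sum.cong) auto
      then have "0 \<le> e j j + 2 * ?t * e a j + ?t\<^sup>2 * e a a"
        using psd [of "\<lambda>i. ?u i + (if i = a then ?t else 0)"]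
        unfolding quadratic_form_shift [OF sym] by simp
      moreover have "2 * ?t * e a j = - (e j j + 1)" using ne by simp
      ultimately show False using True by simp
    qed
    then have "e i j = 0" if "i \<notin> A" for i j using zero [of i j] that by (cases "i = a") auto
    with insert.IH [OF sym psd] obtain b where b: "\<And>i j. e i j = (\<Sum>a\<in>A. b a i * b a j)" by blast
    have "e i j = (\<Sum>k\<in>insert a A. (b(a := \<lambda>_. 0)) k i * (b(a := \<lambda>_. 0)) k j)" for i j
      unfolding b using insert.hyps by (auto intro!: sum.cong)
    then show ?thesis by blast
  next
    case False
    with aa have pos: "e a a > 0" by simp
    \<comment> \<open>The Schur complement. Its value at x is the minimum of the form e over the
      coordinate a of x, hence non-negative.\<close>
    define f where "f i j = e i j - e a i * e a j / e a a" for i j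
    have fsym: "f i j = f j i" for i j unfolding f_def using sym [of i j] by
        (simp add: mult.commute)
    have fpsd: "0 \<le> (\<Sum>i\<in>UNIV. \<Sum>j\<in>UNIV. x i * f i j * x j)" for x
    proof -
      let ?l = "\<Sum>i\<in>UNIV. e a i * x i"
      have "(\<Sum>i\<in>UNIV. \<Sum>j\<in>UNIV. x i * f i j * x j)
          = (\<Sum>i\<in>UNIV. \<Sum>j\<in>UNIV. x i * e i j * x j) - ?l\<^sup>2 / e a a"
        unfolding f_def power2_eq_square sum_product sum_divide_distrib sum_subtractf [symmetric]
        by (intro sum.cong refl) (simp add: algebra_simps)
      also have "\<dots> = (\<Sum>i\<in>UNIV. \<Sum>j\<in>UNIV. x i * e i j * x j) + 2 * (- ?l / e a a) * ?l
          + (- ?l / e a a)\<^sup>2 * e a a"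
        using pos by (simp add: field_simps power2_eq_square)
      also have "\<dots> \<ge> 0"
        using psd [of "\<lambda>i. x i + (if i = a then - ?l / e a a else 0)"]
            unfolding quadratic_form_shift [OF sym] .
      finally show ?thesis .
    qed
    have "f i j = 0" if "i \<notin> A" for i j
      using zero [of i j] zero [of i a] sym [of a i] that pos by (cases "i = a") (auto simp: f_def)
    with insert.IH [OF fsym fpsd] obtain b where b: "\<And>i j. f i j = (\<Sum>a\<in>A. b a i * b a j)" by blast
    let ?b = "b(a := \<lambda>i. e a i / sqrt (e a a))"
    have "e i j = (\<Sum>k\<in>insert a A. ?b k i * ?b k j)" for i j
    proof -
      have "(\<Sum>k\<in>insert a A. ?b k i * ?b k j) = e a i * e a j / e a a + (\<Sum>k\<in>A. ?b k i * ?b k j)"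
        using insert.hyps pos by simp
      also have "(\<Sum>k\<in>A. ?b k i * ?b k j) = f i j"
        unfolding b using insert.hyps by (auto intro!: sum.cong)
      finally show ?thesis by (simp add: f_def)
    qed
    then show ?thesis by blast
  qed
qed simp

lemma inner_matrix_vector:
  fixes E :: "real ^ 'k ^ 'k"
  shows "x \<bullet> (E *v y) = (\<Sum>i\<in>UNIV. \<Sum>j\<in>UNIV. x $ i * E $ i $ j * y $ j)"
  by (simp add: inner_vec_def matrix_vector_mult_def sum_distrib_left mult.assoc)

lemma psd_decomposition:
  fixes E :: "real ^ 'k ^ 'k"
  assumes "E \<in> psd_matrices"
  shows "\<exists>b::'k \<Rightarrow> real ^ 'k. \<forall>i j. E $ i $ j = (\<Sum>a\<in>UNIV. b a $ i * b a $ j)"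
proof -
  have sym: "E $ i $ j = E $ j $ i" for i j
    using assms unfolding psd_matrices_def by (auto simp: transpose_def vec_eq_iff)
  have psd: "0 \<le> (\<Sum>i\<in>UNIV. \<Sum>j\<in>UNIV. x i * E $ i $ j * x j)" for x
  proof -
    have "0 \<le> (\<chi> i. x i) \<bullet> (E *v (\<chi> i. x i))" using assms by (auto simp: psd_matrices_def)
    then show ?thesis unfolding inner_matrix_vector by simp
  qed
  have "\<exists>b :: 'k \<Rightarrow> 'k \<Rightarrow> real. \<forall>i j. E $ i $ j = (\<Sum>a\<in>UNIV. b a i * b a j)"
    by (rule psd_decomposition_on [OF finite sym psd]) simp
  then obtain b :: "'k \<Rightarrow> 'k \<Rightarrow> real" where "\<And>i j. E $ i $ j = (\<Sum>a\<in>UNIV. b a i * b a j)" by blast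
  then show ?thesis by (intro exI [of _ "\<lambda>a. \<chi> i. b a i"]) simp
qed

lemma power2_norm_eq_sum_cart:
  "(norm (v :: real ^ 'k))\<^sup>2 = (\<Sum>a\<in>UNIV. v $ a * v $ a)"
  by (simp only: power2_norm_eq_inner inner_vec_def inner_real_def)

text \<open>Each rank-one factor is repeated m times with weight \<open>1 / sqrt m\<close>, so that
  every single vector is short. With m proportional to N this keeps the spins added in
  \<open>extend_config\<close> bounded.\<close>

lemma psd_spread:
  fixes E :: "real ^ 'k ^ 'k"
  assumes E: "E \<in> psd_matrices" and m: "m > 0"
  shows "\<exists>\<tau>::nat \<Rightarrow> real ^ 'k. (\<forall>a b. (\<Sum>j<m * CARD('k). \<tau> j $ a * \<tau> j $ b) = E $ a $ b) \<and>
      (\<forall>j. (norm (\<tau> j))\<^sup>2 \<le> trace E / m)"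
proof -
  obtain b :: "'k \<Rightarrow> real ^ 'k" where b: "\<And>i j. E $ i $ j = (\<Sum>a\<in>UNIV. b a $ i * b a $ j)"
    using psd_decomposition [OF E] by blast
  obtain h :: "nat \<Rightarrow> 'k" where h: "bij_betw h {0..<CARD('k)} UNIV"
    using ex_bij_betw_nat_finite [OF finite [of UNIV]] by blast
  define \<tau> where "\<tau> j = (1 / sqrt m) *\<^sub>R b (h (j mod CARD('k)))" for j
  have tr: "trace E = (\<Sum>a\<in>UNIV. (norm (b a))\<^sup>2)"
    unfolding trace_def b power2_norm_eq_sum_cart by (rule sum.swap)
  have "(\<Sum>j<m * CARD('k). \<tau> j $ a * \<tau> j $ c) = E $ a $ c" for a c
  proof -
    define u where "u i = b (h i) $ a * b (h i) $ c" for i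
    have "(\<Sum>j<m * CARD('k). \<tau> j $ a * \<tau> j $ c) = (\<Sum>j<m * CARD('k). u (j mod CARD('k)) / m)"
      using m by (intro sum.cong) (auto simp: \<tau>_def u_def)
    also have "\<dots> = (\<Sum>l<m. \<Sum>j = l * CARD('k)..<l * CARD('k) + CARD('k). u (j mod CARD('k)) / m)"
      by (rule sum.nat_group [symmetric])
    also have "\<dots> = (\<Sum>l<m. \<Sum>i = 0..<CARD('k). u i / m)"
    proof (rule sum.cong [OF refl])
      fix l
      have "(\<Sum>j = l * CARD('k)..<l * CARD('k) + CARD('k). u (j mod CARD('k)) / m)
          = (\<Sum>i = 0..<CARD('k). u ((i + l * CARD('k)) mod CARD('k)) / m)"
        using sum.shift_bounds_nat_ivl [of "\<lambda>j. u (j mod CARD('k)) / m" 0 "l * CARD('k)" "CARD('k)"]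
            by (simp add: add.commute)
      also have "\<dots> = (\<Sum>i = 0..<CARD('k). u i / m)" by (rule sum.cong) auto
      finally show "(\<Sum>j = l * CARD('k)..<l * CARD('k) + CARD('k). u (j mod CARD('k)) / m) = (\<Sum>i
          = 0..<CARD('k). u i / m)" .
    qed
    also have "\<dots> = (\<Sum>i = 0..<CARD('k). u i)" using m by (simp add: sum_distrib_left)
    also have "\<dots> = E $ a $ c" unfolding u_def b by (rule sum.reindex_bij_betw [OF h])
    finally show ?thesis .
  qed
  moreover have "(norm (\<tau> j))\<^sup>2 \<le> trace E / m" for j
  proof -
    have "(norm (\<tau> j))\<^sup>2 = (norm (b (h (j mod CARD('k)))))\<^sup>2 / m" using m by
        (simp add: \<tau>_def power_divide)
    also have "\<dots> \<le> trace E / m" unfolding tr by (intro divide_right_mono member_le_sum) auto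
    finally show ?thesis .
  qed
  ultimately show ?thesis by blast
qed

lemma psd_trace_nonneg: "(E :: real ^ 'k ^ 'k) \<in> psd_matrices \<Longrightarrow> 0 \<le> trace E"
proof -
  assume "E \<in> psd_matrices"
  from psd_decomposition [OF this] obtain b :: "'k \<Rightarrow> real ^ 'k"
    where b: "\<And>i j. E $ i $ j = (\<Sum>a\<in>UNIV. b a $ i * b a $ j)" by blast
  show ?thesis unfolding trace_def b by (intro sum_nonneg) simp
qed

lemma psd_entry_bound:
  fixes E :: "real ^ 'k ^ 'k"
  assumes "E \<in> psd_matrices" shows "\<bar>E $ i $ j\<bar> \<le> trace E"
proof -
  obtain b :: "'k \<Rightarrow> real ^ 'k" where b: "\<And>i j. E $ i $ j = (\<Sum>a\<in>UNIV. b a $ i * b a $ j)"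
    using psd_decomposition [OF assms] by blast
  have "\<bar>b a $ i * b a $ j\<bar> \<le> (norm (b a))\<^sup>2" for a
    unfolding power2_eq_square abs_mult by (intro mult_mono component_le_norm_cart) auto
  then have "\<bar>E $ i $ j\<bar> \<le> (\<Sum>a\<in>UNIV. (norm (b a))\<^sup>2)"
    unfolding b by (intro order_trans [OF sum_abs] sum_mono)
  also have "\<dots> = trace E" unfolding trace_def b power2_norm_eq_sum_cart by (rule sum.swap)
  finally show ?thesis .
qed

lemma inner_matrix_vector_bound:
  fixes A :: "real ^ 'k ^ 'k"
  shows "\<bar>x \<bullet> (A *v x)\<bar> \<le> real CARD('k) * norm A * (norm x)\<^sup>2"
proof -
  have "\<bar>x \<bullet> (A *v x)\<bar> \<le> (\<Sum>i\<in>UNIV. \<bar>x $ i * (A $ i \<bullet> x)\<bar>)"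
    by (simp add: inner_vec_def matrix_vector_mult_def)
  also have "\<dots> \<le> (\<Sum>i\<in>(UNIV::'k set). norm x * (norm A * norm x))"
  proof (rule sum_mono)
    fix i
    have "\<bar>A $ i \<bullet> x\<bar> \<le> norm (A $ i) * norm x" by (rule Cauchy_Schwarz_ineq2)
    also have "\<dots> \<le> norm A * norm x" by (intro mult_right_mono Finite_Cartesian_Product.norm_nth_le)
        simp
    finally show "\<bar>x $ i * (A $ i \<bullet> x)\<bar> \<le> norm x * (norm A * norm x)"
      unfolding abs_mult by (intro mult_mono component_le_norm_cart) auto
  qed
  finally show ?thesis by (simp add: power2_eq_square mult_ac)
qed

text \<open>Adding spins can only increase the unnormalised self-overlap, so a target matrix has to
  dominate D as a quadratic form; mere closeness would not do. The net consists of nearby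
  representatives raised by a multiple of the identity, which also makes them positive
  definite.\<close>

lemma overlap_net:
  assumes \<epsilon>: "\<epsilon> > 0"
  shows "\<exists>\<D>\<subseteq>(pd_matrices :: (real ^ 'k ^ 'k) set). finite \<D> \<and>
    (\<forall>D\<in>psd_matrices. trace D \<le> r \<longrightarrow>
       (\<exists>D'\<in>\<D>. (\<forall>x. x \<bullet> (D *v x) \<le> x \<bullet> (D' *v x)) \<and> trace D' \<le> trace D + \<epsilon>))"
proof -
  let ?\<kappa> = "real CARD('k)"
  let ?B = "{D :: real ^ 'k ^ 'k. D \<in> psd_matrices \<and> trace D \<le> r}"
  have k: "?\<kappa> > 0" by simp
  \<comment> \<open>As a form, the representative is within \<open>\<delta>\<close> of D and is
    raised by 2 \<open>\<delta>\<close>, so the trace grows by at most 3 \<open>\<delta>\<close>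
    kappa = \<open>\<epsilon>\<close>. Two points of a ball of radius \<open>e\<close> are at
    distance at most 2 \<open>e\<close>, and kappa times that is \<open>\<delta>\<close>.\<close>
  define \<delta> where "\<delta> = \<epsilon> / (3 * ?\<kappa>)"
  define e where "e = \<delta> / (2 * ?\<kappa>)"
  have \<delta>: "\<delta> > 0" "e > 0" using \<epsilon> k by (simp_all add: \<delta>_def e_def)
  have "norm D \<le> ?\<kappa> * (?\<kappa> * r)" if "D \<in> ?B" for D
  proof -
    have "norm D \<le> (\<Sum>i\<in>UNIV. norm (D $ i))" unfolding norm_vec_def by (rule L2_set_le_sum) simp
    also have "\<dots> \<le> (\<Sum>i\<in>UNIV. \<Sum>j\<in>UNIV. \<bar>D $ i $ j\<bar>)" by (intro sum_mono norm_le_l1_cart)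
    also have "\<dots> \<le> (\<Sum>i\<in>(UNIV::'k set). \<Sum>j\<in>(UNIV::'k set). r)"
      using that psd_entry_bound [of D] by (intro sum_mono) (auto intro: order_trans)
    finally show ?thesis by simp
  qed
  then have sub: "?B \<subseteq> cball 0 (?\<kappa> * (?\<kappa> * r))" by auto
  obtain C where C: "finite C" "cball 0 (?\<kappa> * (?\<kappa> * r)) \<subseteq> (\<Union>x\<in>C. ball (x :: real ^ 'k ^ 'k) e)"
    using compact_eq_totally_bounded [THEN iffD1, OF compact_cball] \<delta>(2) by blast
  define rep where "rep x = (SOME y. y \<in> ball x e \<inter> ?B)" for x :: "real ^ 'k ^ 'k"
  define C' where "C' = {x \<in> C. ball x e \<inter> ?B \<noteq> {}}"
  have rep: "rep x \<in> ball x e \<inter> ?B" if "x \<in> C'" for x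
  proof -
    have "\<exists>y. y \<in> ball x e \<inter> ?B" using that unfolding C'_def by blast
    then show ?thesis unfolding rep_def by (rule someI_ex)
  qed
  define up :: "_ \<Rightarrow> real ^ 'k ^ 'k" where "up x = rep x + (2 * \<delta>) *\<^sub>R mat 1" for x
  have qf: "v \<bullet> (up x *v v) = v \<bullet> (rep x *v v) + 2 * \<delta> * (norm v)\<^sup>2" for x v
    unfolding up_def
    by (simp add: matrix_vector_mult_add_rdistrib inner_add_right scaleR_matrix_vector_assoc
        [symmetric] power2_norm_eq_inner)
  have "up x \<in> pd_matrices" if "x \<in> C'" for x
  proof -
    have p: "rep x \<in> psd_matrices" using rep [OF that] by simp
    have "transpose (up x) = up x"
      using p by (simp add: psd_matrices_def up_def transpose_def vec_eq_iff mat_def)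
    moreover have "0 < v \<bullet> (up x *v v)" if "v \<noteq> 0" for v
      unfolding qf using p \<delta> that by (intro add_nonneg_pos) (auto simp: psd_matrices_def)
    ultimately show ?thesis by (simp add: pd_matrices_def)
  qed
  moreover have "\<exists>D'\<in>up ` C'. (\<forall>x. x \<bullet> (D *v x) \<le> x \<bullet> (D' *v x)) \<and> trace D' \<le> trace D + \<epsilon>"
    if D: "D \<in> psd_matrices" "trace D \<le> r" for D
  proof -
    obtain x where x: "x \<in> C" "D \<in> ball x e" using C(2) sub D by blast
    then have x': "x \<in> C'" using D by (auto simp: C'_def)
    have "norm (D - rep x) \<le> 2 * e"
      using rep [OF x'] x(2) dist_triangle2 [of D "rep x" x] by
          (auto simp: dist_norm [symmetric] dist_commute)
    then have "?\<kappa> * norm (D - rep x) \<le> ?\<kappa> * (2 * e)" by (rule mult_left_mono) simp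
    also have "\<dots> = \<delta>" using k by (simp add: e_def)
    finally have small: "?\<kappa> * norm (D - rep x) \<le> \<delta>" .
    have close: "\<bar>v \<bullet> (D *v v) - v \<bullet> (rep x *v v)\<bar> \<le> \<delta> * (norm v)\<^sup>2" for v
    proof -
      have "v \<bullet> (D *v v) - v \<bullet> (rep x *v v) = v \<bullet> ((D - rep x) *v v)"
        by (simp add: matrix_vector_mult_diff_rdistrib inner_diff_right)
      then have "\<bar>v \<bullet> (D *v v) - v \<bullet> (rep x *v v)\<bar> \<le> ?\<kappa> * norm (D - rep x) * (norm v)\<^sup>2"
        using inner_matrix_vector_bound by metis
      also have "\<dots> \<le> \<delta> * (norm v)\<^sup>2" by (rule mult_right_mono [OF small]) simp
      finally show ?thesis .
    qed
    have 1: "v \<bullet> (D *v v) \<le> v \<bullet> (up x *v v)" for v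
      unfolding qf using close [of v] \<delta>(1) mult_nonneg_nonneg [of \<delta> "(norm v)\<^sup>2"] by
          (simp add: abs_le_iff)
    have diag: "A $ i $ i = axis i 1 \<bullet> (A *v axis i 1)" for A :: "real ^ 'k ^ 'k" and i
      by (simp add: inner_matrix_vector axis_def if_distrib [of "\<lambda>x. x * _"] if_distrib [of
          "(*) _"] cong: if_cong)
    have "up x $ i $ i \<le> D $ i $ i + 3 * \<delta>" for i
      unfolding diag qf using close [of "axis i 1"] by (simp add: norm_axis_1 abs_le_iff)
    then have "trace (up x) \<le> (\<Sum>i\<in>(UNIV::'k set). D $ i $ i + 3 * \<delta>)"
      unfolding trace_def by (rule sum_mono)
    also have "\<dots> = trace D + \<epsilon>" using k by (simp add: sum.distrib trace_def \<delta>_def)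
    finally show ?thesis using 1 x' by blast
  qed
  moreover have "finite (up ` C')" using C(1) by (simp add: C'_def)
  ultimately show ?thesis by (intro exI [of _ "up ` C'"]) auto
qed

lemma self_overlap_quadratic:
  "x \<bullet> (self_overlap N \<sigma> *v x) = (\<Sum>i=1..N. (\<sigma> i \<bullet> x)\<^sup>2) / real N"
proof -
  have "x \<bullet> (self_overlap N \<sigma> *v x)
      = (\<Sum>a\<in>UNIV. \<Sum>b\<in>UNIV. \<Sum>i=1..N. (\<sigma> i $ a * x $ a) * (\<sigma> i $ b * x $ b)) / real N"
    unfolding inner_matrix_vector
    by (simp add: self_overlap_def sum_divide_distrib sum_distrib_left sum_distrib_right mult_ac)
  also have "(\<Sum>a\<in>UNIV. \<Sum>b\<in>UNIV. \<Sum>i=1..N. (\<sigma> i $ a * x $ a) * (\<sigma> i $ b * x $ b))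
      = (\<Sum>a\<in>UNIV. \<Sum>i=1..N. \<Sum>b\<in>UNIV. (\<sigma> i $ a * x $ a) * (\<sigma> i $ b * x $ b))"
    by (intro sum.cong refl sum.swap)
  also have "\<dots> = (\<Sum>i=1..N. \<Sum>a\<in>UNIV. \<Sum>b\<in>UNIV. (\<sigma> i $ a * x $ a) * (\<sigma> i $ b * x $ b))"
    by (rule sum.swap)
  also have "\<dots> = (\<Sum>i=1..N. (\<sigma> i \<bullet> x)\<^sup>2)"
    by (simp add: inner_vec_def power2_eq_square sum_product)
  finally show ?thesis .
qed

lemma self_overlap_psd: "self_overlap N \<sigma> \<in> psd_matrices"
  unfolding psd_matrices_def
  by (auto simp: self_overlap_quadratic sum_nonneg) (simp add: self_overlap_def transpose_def
      vec_eq_iff mult.commute)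

lemma trace_self_overlap: "trace (self_overlap N \<sigma>) = (\<Sum>i=1..N. (norm (\<sigma> i))\<^sup>2) / real N"
proof -
  have "trace (self_overlap N \<sigma>) = (\<Sum>a\<in>UNIV. \<Sum>i=1..N. \<sigma> i $ a * \<sigma> i $ a) / real N"
    by (simp add: trace_def self_overlap_def sum_divide_distrib)
  also have "(\<Sum>a\<in>UNIV. \<Sum>i=1..N. \<sigma> i $ a * \<sigma> i $ a) = (\<Sum>i=1..N. (norm (\<sigma> i))\<^sup>2)"
    unfolding power2_norm_eq_sum_cart by (rule sum.swap)
  finally show ?thesis .
qed

section \<open>Superadditivity\<close>

definition site_pairs :: "nat \<Rightarrow> (nat \<times> nat) set" where
  "site_pairs N = {1..N} \<times> {1..N}"

text \<open>The Hamiltonian is linear in the array; pairs serve as the index so that the array is a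
  single function on \<open>site_pairs N\<close>.\<close>

definition ham_coeff :: "nat \<Rightarrow> (nat \<Rightarrow> real ^ 'k) \<Rightarrow> nat \<times> nat \<Rightarrow> real" where
  "ham_coeff N \<sigma> k = (\<sigma> (fst k) \<bullet> \<sigma> (snd k)) / sqrt (real N)"

text \<open>The case t = 1, not divided by N; other t are reached by scaling.\<close>

definition ham_sup :: "real \<Rightarrow> nat \<Rightarrow> (nat \<Rightarrow> real ^ 'k) set \<Rightarrow> (nat \<times> nat \<Rightarrow> real) \<Rightarrow> real" where
  "ham_sup p N X = affine_sup (site_pairs N) X (ham_coeff N) (\<lambda>\<sigma>. - norm_p2_powr p N \<sigma>)"

lemma finite_site_pairs [simp]: "finite (site_pairs N)"
  by (simp add: site_pairs_def)

lemma card_site_pairs: "card (site_pairs N) = N * N"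
  by (simp add: site_pairs_def)

lemma hamiltonian_eq_affine:
  "hamiltonian (\<lambda>i j. g (i, j)) N \<sigma> = (\<Sum>k\<in>site_pairs N. ham_coeff N \<sigma> k * g k)"
  unfolding hamiltonian_def site_pairs_def ham_coeff_def sum.cartesian_product sum_distrib_left
  by (intro sum.cong refl) (auto simp: mult.commute)

lemma ham_sup_eq: "ham_sup p N X g = (\<Squnion>\<sigma>\<in>X. pen_hamiltonian (\<lambda>i j. g (i, j)) p 1 N \<sigma>)"
  unfolding ham_sup_def affine_sup_def pen_hamiltonian_def hamiltonian_eq_affine by simp

text \<open>Expanding both inner products gives N times the squared Hilbert-Schmidt norm of the
  overlap of the two configurations, written with unnormalised sums.\<close>

lemma ham_coeff_covariance:
  "(\<Sum>k\<in>site_pairs N. ham_coeff N \<sigma> k * ham_coeff N \<tau> k)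
    = (\<Sum>a\<in>UNIV. \<Sum>b\<in>UNIV. (\<Sum>i=1..N. \<sigma> i $ a * \<tau> i $ b)\<^sup>2) / real N"
proof -
  have "(\<Sum>a\<in>UNIV. \<Sum>b\<in>UNIV. (\<Sum>i=1..N. \<sigma> i $ a * \<tau> i $ b)\<^sup>2)
      = (\<Sum>a\<in>UNIV. \<Sum>b\<in>UNIV. \<Sum>k\<in>site_pairs N. (\<sigma> (fst k) $ a * \<tau> (fst k) $ b) * (\<sigma> (snd k) $ a * \<tau>
          (snd k) $ b))"
    unfolding power2_eq_square sum_product site_pairs_def sum.cartesian_product by
        (simp add: case_prod_unfold)
  also have "\<dots> = (\<Sum>k\<in>site_pairs N. \<Sum>a\<in>UNIV. \<Sum>b\<in>UNIV. (\<sigma> (fst k) $ a * \<tau> (fst k) $ b) * (\<sigma> (snd k) $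
      a * \<tau> (snd k) $ b))"
    by (subst sum.swap, subst (2) sum.swap) (simp add: sum.swap [of _ UNIV "site_pairs N"])
  also have "\<dots> = (\<Sum>k\<in>site_pairs N. (\<sigma> (fst k) \<bullet> \<sigma> (snd k)) * (\<tau> (fst k) \<bullet> \<tau> (snd k)))"
    by (simp add: inner_vec_def sum_product mult_ac)
  finally show ?thesis
    by (simp add: ham_coeff_def sum_divide_distrib flip: real_sqrt_mult)
qed

lemma ham_coeff_square_bound:
  "(\<Sum>k\<in>site_pairs N. (ham_coeff N \<sigma> k)\<^sup>2) \<le> (\<Sum>i=1..N. (norm (\<sigma> i))\<^sup>2)\<^sup>2 / real N"
proof -
  have "(\<Sum>k\<in>site_pairs N. (ham_coeff N \<sigma> k)\<^sup>2)
      = (\<Sum>k\<in>site_pairs N. (\<sigma> (fst k) \<bullet> \<sigma> (snd k))\<^sup>2) / real N"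
    by (simp add: ham_coeff_def power_divide sum_divide_distrib)
  also have "\<dots> \<le> (\<Sum>k\<in>site_pairs N. (norm (\<sigma> (fst k)))\<^sup>2 * (norm (\<sigma> (snd k)))\<^sup>2) / real N"
  proof (intro divide_right_mono sum_mono)
    fix k :: "nat \<times> nat"
    have "\<bar>\<sigma> (fst k) \<bullet> \<sigma> (snd k)\<bar>\<^sup>2 \<le> (norm (\<sigma> (fst k)) * norm (\<sigma> (snd k)))\<^sup>2"
      by (intro power_mono Cauchy_Schwarz_ineq2) simp
    then show "(\<sigma> (fst k) \<bullet> \<sigma> (snd k))\<^sup>2 \<le> (norm (\<sigma> (fst k)))\<^sup>2 * (norm (\<sigma> (snd k)))\<^sup>2"
      by (simp add: power_mult_distrib)
  qed simp
  also have "(\<Sum>k\<in>site_pairs N. (norm (\<sigma> (fst k)))\<^sup>2 * (norm (\<sigma> (snd k)))\<^sup>2)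
      = (\<Sum>i=1..N. (norm (\<sigma> i))\<^sup>2)\<^sup>2"
    unfolding power2_eq_square [of "sum _ _"] sum_product site_pairs_def sum.cartesian_product by
        (simp add: case_prod_unfold)
  finally show ?thesis .
qed

lemma norm_p2_powr_nonneg: "norm_p2_powr p N \<sigma> \<ge> 0"
  unfolding norm_p2_powr_def by (intro sum_nonneg) simp

lemma affine_family_ham:
  assumes "X \<noteq> {}" "R \<ge> 0" "\<And>\<sigma>. \<sigma> \<in> X \<Longrightarrow> (\<Sum>i=1..N. (norm (\<sigma> i))\<^sup>2) \<le> R * real N"
    "\<And>\<sigma>. \<sigma> \<in> X \<Longrightarrow> norm_p2_powr p N \<sigma> \<le> C"
  shows "affine_family (site_pairs N) X (ham_coeff N) (\<lambda>\<sigma>.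
      - norm_p2_powr p N \<sigma>) (R * sqrt (real N)) C"
proof
  fix \<sigma> assume \<sigma>: "\<sigma> \<in> X"
  have "(\<Sum>i=1..N. (norm (\<sigma> i))\<^sup>2)\<^sup>2 / real N \<le> (R * real N)\<^sup>2 / real N"
    by (intro divide_right_mono power_mono assms(3) \<sigma>) (auto intro: sum_nonneg)
  also have "\<dots> = (R * sqrt (real N))\<^sup>2" by (simp add: power_mult_distrib power2_eq_square)
  finally show "(\<Sum>k\<in>site_pairs N. (ham_coeff N \<sigma> k)\<^sup>2) \<le> (R * sqrt (real N))\<^sup>2"
    using ham_coeff_square_bound [of N \<sigma>] by linarith
  show "\<bar>- norm_p2_powr p N \<sigma>\<bar> \<le> C" using assms(4) [OF \<sigma>] norm_p2_powr_nonneg [of p N \<sigma>] by simp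
qed (use assms in auto)

lemma overlap_configs_norm:
  assumes "\<sigma> \<in> overlap_configs N D"
  shows "(\<Sum>i=1..N. (norm (\<sigma> i))\<^sup>2) = trace D * real N"
  using assms trace_self_overlap [of N \<sigma>] by (cases "N = 0") (auto simp: overlap_configs_def)

lemma overlap_configs_component:
  assumes "\<sigma> \<in> overlap_configs N D" "N > 0"
  shows "(\<Sum>i=1..N. \<sigma> i $ a * \<sigma> i $ b) = real N * D $ a $ b"
proof -
  have "D $ a $ b = self_overlap N \<sigma> $ a $ b" using assms by (simp add: overlap_configs_def)
  then show ?thesis using assms by (simp add: self_overlap_def)
qed

text \<open>A crude bound that grows with N. It serves as the constant \<open>C\<close> of
  \<open>affine_family\<close>, where any finite value will do.\<close>

lemma overlap_configs_norm_p2_bound: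
  assumes p: "p > 0" and s: "\<sigma> \<in> overlap_configs N D"
  shows "norm_p2_powr p N \<sigma> \<le> real N * sqrt (trace D * real N) powr p"
proof -
  have "norm (\<sigma> i) powr p \<le> sqrt (trace D * real N) powr p" if i: "i \<in> {1..N}" for i
  proof (intro powr_mono2 real_le_rsqrt)
    have "(norm (\<sigma> i))\<^sup>2 \<le> (\<Sum>i=1..N. (norm (\<sigma> i))\<^sup>2)" using i by (intro member_le_sum) auto
    then show "(norm (\<sigma> i))\<^sup>2 \<le> trace D * real N" using overlap_configs_norm [OF s] by simp
  qed (use p in auto)
  then have "norm_p2_powr p N \<sigma> \<le> (\<Sum>i=1..N. sqrt (trace D * real N) powr p)"
    unfolding norm_p2_powr_def by (rule sum_mono)
  then show ?thesis by simp
qed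

lemma affine_family_overlap:
  assumes "p > 0" "D \<in> psd_matrices" "overlap_configs N D \<noteq> {}"
  shows "affine_family (site_pairs N) (overlap_configs N D) (ham_coeff N) (\<lambda>\<sigma>. - norm_p2_powr p N \<sigma>)
     (trace D * sqrt (real N)) (real N * sqrt (trace D * real N) powr p)"
  by (rule affine_family_ham [OF assms(3) psd_trace_nonneg [OF assms(2)] _
      overlap_configs_norm_p2_bound [OF assms(1)]])
     (simp_all only: overlap_configs_norm order_refl)

text \<open>The first kappa spins carry the rank-one factors of D, scaled by \<open>sqrt N\<close>;
  the others vanish.\<close>

lemma overlap_configs_nonempty:
  fixes D :: "real ^ 'k ^ 'k"
  assumes D: "D \<in> psd_matrices" and N: "N \<ge> CARD('k)"
  shows "overlap_configs N D \<noteq> {}"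
proof -
  have k: "CARD('k) > 0" by simp
  obtain \<tau> :: "nat \<Rightarrow> real ^ 'k" where \<tau>: "\<And>a b. (\<Sum>j<1 * CARD('k). \<tau> j $ a * \<tau> j $ b) = D $ a $ b"
    using psd_spread [OF D, of 1] by auto
  define \<sigma> where "\<sigma> = (\<lambda>i\<in>{1..N}. if i \<le> CARD('k) then sqrt (real N) *\<^sub>R \<tau> (i - 1) else 0)"
  have "(\<Sum>i=1..N. \<sigma> i $ a * \<sigma> i $ b) = real N * D $ a $ b" for a b
  proof -
    have "(\<Sum>i=1..N. \<sigma> i $ a * \<sigma> i $ b) = (\<Sum>i=1..CARD('k). \<sigma> i $ a * \<sigma> i $ b)"
      by (rule sum.mono_neutral_right) (use N in \<open>auto simp: \<sigma>_def\<close>)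
    also have "\<dots> = (\<Sum>i=1..CARD('k). real N * (\<tau> (i - 1) $ a * \<tau> (i - 1) $ b))"
      using N by (intro sum.cong) (auto simp: \<sigma>_def)
    also have "\<dots> = real N * (\<Sum>j<CARD('k). \<tau> j $ a * \<tau> j $ b)"
      unfolding sum_distrib_left by (rule sum.reindex_bij_witness [of _ Suc "\<lambda>i. i - 1"]) auto
    finally show ?thesis using \<tau> by simp
  qed
  moreover have "N > 0" using N k by linarith
  ultimately have "self_overlap N \<sigma> = D" by (simp add: self_overlap_def vec_eq_iff)
  then have "\<sigma> \<in> overlap_configs N D" by (simp add: overlap_configs_def configs_def \<sigma>_def)
  then show ?thesis by blast
qed

lemma sum_upto_add:
  fixes f :: "nat \<Rightarrow> 'a::comm_monoid_add"
  shows "(\<Sum>i=1..N + M. f i) = (\<Sum>i=1..N. f i) + (\<Sum>j=1..M. f (N + j))"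
proof (induction M)
  case (Suc M)
  then show ?case by (simp add: add.assoc)
qed simp

definition append_config :: "nat \<Rightarrow> nat \<Rightarrow> (nat \<Rightarrow> real ^ 'k) \<Rightarrow> (nat \<Rightarrow> real ^ 'k) \<Rightarrow> nat \<Rightarrow> real ^ 'k"
    where
  "append_config N M \<sigma> \<tau> = (\<lambda>i\<in>{1..N + M}. if i \<le> N then \<sigma> i else \<tau> (i - N))"

lemma append_config_sum:
  "(\<Sum>i=1..N + M. f (append_config N M \<sigma> \<tau> i) (append_config N M \<sigma>' \<tau>' i))
    = (\<Sum>i=1..N. f (\<sigma> i) (\<sigma>' i)) + (\<Sum>i=1..M. f (\<tau> i) (\<tau>' i) :: 'a::comm_monoid_add)"
  unfolding sum_upto_add by (intro arg_cong2 [where f = "(+)"] sum.cong)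
      (auto simp: append_config_def)

lemma append_config_norm_p2:
  "norm_p2_powr p (N + M) (append_config N M \<sigma> \<tau>) = norm_p2_powr p N \<sigma> + norm_p2_powr p M \<tau>"
  unfolding norm_p2_powr_def using append_config_sum [of "\<lambda>x _. norm x powr p" N M \<sigma> \<tau> \<sigma> \<tau>] .

lemma append_config_overlap:
  assumes "\<sigma> \<in> overlap_configs N D" "\<tau> \<in> overlap_configs M D" "N > 0" "M > 0"
  shows "append_config N M \<sigma> \<tau> \<in> overlap_configs (N + M) D"
proof -
  let ?\<rho> = "append_config N M \<sigma> \<tau>"
  have "(\<Sum>i=1..N + M. ?\<rho> i $ a * ?\<rho> i $ b) = real (N + M) * D $ a $ b" for a b
    unfolding append_config_sum [of "\<lambda>x y. x $ a * y $ b"]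
      overlap_configs_component [OF assms(1,3)] overlap_configs_component [OF assms(2,4)]
    by (simp add: distrib_right)
  then have "self_overlap (N + M) ?\<rho> = D" using assms by (simp add: self_overlap_def vec_eq_iff)
  then show ?thesis by (simp add: overlap_configs_def configs_def append_config_def)
qed

text \<open>Convexity of the square with weights n and m; the deficit is a single square.\<close>

lemma square_sum_divide_le:
  fixes u v :: real
  assumes "n > 0" "m > 0"
  shows "(u + v)\<^sup>2 / (n + m) \<le> u\<^sup>2 / n + v\<^sup>2 / m"
proof -
  have "u\<^sup>2 / n + v\<^sup>2 / m - (u + v)\<^sup>2 / (n + m) = (u * m - v * n)\<^sup>2 / (n * m * (n + m))"
    using assms by (simp add: divide_simps) (simp add: algebra_simps power2_eq_square)
  moreover have "\<dots> \<ge> 0" using assms by simp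
  ultimately show ?thesis by linarith
qed


definition mean_ham_sup :: "real \<Rightarrow> nat \<Rightarrow> real ^ 'k ^ 'k \<Rightarrow> real" where
  "mean_ham_sup p N D = integral\<^sup>L (gauss_prod (site_pairs N)) (ham_sup p N (overlap_configs N D))"

text \<open>
  The convexity of \<open>R \<mapsto> \<parallel>R\<parallel>\<^sup>2\<close> makes the covariance of the large system smaller than that of
  two independent small ones, with equality on the diagonal because the self-overlap is fixed.
\<close>

lemma mean_ham_sup_superadditive:
  fixes D :: "real ^ 'k ^ 'k"
  assumes p: "p > 0" and D: "D \<in> psd_matrices" and N: "N \<ge> CARD('k)" and M: "M \<ge> CARD('k)"
  shows "mean_ham_sup p N D + mean_ham_sup p M D \<le> mean_ham_sup p (N + M) D"
proof -
  have "CARD('k) > 0" by simp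
  with N M have pos: "N > 0" "M > 0" by linarith+
  let ?X = "overlap_configs N D" and ?Y = "overlap_configs M D" and ?Z = "overlap_configs (N + M) D"
  define S where "S = ?X \<times> ?Y"
  define A where "A s = ham_coeff (N + M) (append_config N M (fst s) (snd s))" for s ::
      "(nat \<Rightarrow> real ^ 'k) \<times> (nat \<Rightarrow> real ^ 'k)"
  define c where "c s = - norm_p2_powr p (N + M) (append_config N M (fst s) (snd s))" for s ::
      "(nat \<Rightarrow> real ^ 'k) \<times> (nat \<Rightarrow> real ^ 'k)"
  \<comment> \<open>The second subsystem reads the block of the array shifted by N, which is
    disjoint from the first block, so the two are independent. \<open>J\<close> unites both blocks
    and \<open>B\<close> is the coefficient family of the sum of the two Hamiltonians.\<close>
  define sh where "sh k = (fst k + N, snd k + N)" for k :: "nat \<times> nat"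
  define J where "J = site_pairs N \<union> sh ` site_pairs M"
  define B where "B s k = (if k \<in> site_pairs N then ham_coeff N (fst s) k
     else ham_coeff M (snd s) (fst k - N, snd k - N))" for s ::
         "(nat \<Rightarrow> real ^ 'k) \<times> (nat \<Rightarrow> real ^ 'k)" and k
  have inj: "inj_on sh I" for I by (auto simp: inj_on_def sh_def prod_eq_iff)
  have disj: "site_pairs N \<inter> sh ` site_pairs M = {}" by (auto simp: site_pairs_def sh_def)
  have Jsum: "(\<Sum>k\<in>J. f k) = (\<Sum>k\<in>site_pairs N. f k) + (\<Sum>k\<in>site_pairs M. f (sh k))" for f ::
      "_ \<Rightarrow> real"
    unfolding J_def by (subst sum.union_disjoint [OF _ _ disj]) (simp_all add: sum.reindex [OF inj])
  have B1: "B s k = ham_coeff N (fst s) k" if "k \<in> site_pairs N" for s k using that by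
      (simp add: B_def)
  have B2: "B s (sh k) = ham_coeff M (snd s) k" if "k \<in> site_pairs M" for s k
  proof -
    have "sh k \<notin> site_pairs N" using that disj by blast
    then show ?thesis by (simp add: B_def) (simp add: sh_def)
  qed
  interpret X: affine_family "site_pairs N" ?X "ham_coeff N" "\<lambda>\<sigma>. - norm_p2_powr p N \<sigma>"
     "trace D * sqrt (real N)" "real N * sqrt (trace D * real N) powr p"
    by (rule affine_family_overlap [OF p D overlap_configs_nonempty [OF D N]])
  interpret Y: affine_family "site_pairs M" ?Y "ham_coeff M" "\<lambda>\<sigma>. - norm_p2_powr p M \<sigma>"
     "trace D * sqrt (real M)" "real M * sqrt (trace D * real M) powr p"
    by (rule affine_family_overlap [OF p D overlap_configs_nonempty [OF D M]])
  interpret Z: affine_family "site_pairs (N + M)" ?Z "ham_coeff (N + M)" "\<lambda>\<sigma>. - norm_p2_powr p (N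
      + M) \<sigma>"
     "trace D * sqrt (real (N + M))" "real (N + M) * sqrt (trace D * real (N + M)) powr p"
    by (rule affine_family_overlap [OF p D overlap_configs_nonempty [OF D]]) (use N in simp)
  have S: "S \<noteq> {}" using X.nonempty Y.nonempty by (simp add: S_def)
  have SZ: "append_config N M (fst s) (snd s) \<in> ?Z" if "s \<in> S" for s
    using that pos by (intro append_config_overlap) (auto simp: S_def)
  have fA: "affine_family (site_pairs (N + M)) S A c (trace D * sqrt (real (N + M))) (real (N
      + M) * sqrt (trace D * real (N + M)) powr p)"
    by unfold_locales (use S Z.L_nonneg Z.coeff_bound [OF SZ] Z.const_bound [OF SZ] in \<open>simp_all
        add: A_def c_def\<close>)
  interpret A: affine_family "site_pairs (N + M)" S A c "trace D * sqrt (real (N + M))" "real (N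
      + M) * sqrt (trace D * real (N + M)) powr p"
    by (rule fA)
  have covB: "(\<Sum>k\<in>J. B s k * B t k) = (\<Sum>k\<in>site_pairs N. ham_coeff N (fst s) k * ham_coeff N (fst t)
      k)
      + (\<Sum>k\<in>site_pairs M. ham_coeff M (snd s) k * ham_coeff M (snd t) k)" for s t
    unfolding Jsum by (simp add: B1 B2)
  have cov_le: "(\<Sum>k\<in>site_pairs (N + M). A s k * A t k) \<le> (\<Sum>k\<in>J. B s k * B t k)" for s t
  proof -
    let ?u = "\<lambda>a b. \<Sum>i=1..N. fst s i $ a * fst t i $ b" and ?v =
        "\<lambda>a b. \<Sum>i=1..M. snd s i $ a * snd t i $ b"
    have "(\<Sum>k\<in>site_pairs (N + M). A s k * A t k) = (\<Sum>a\<in>UNIV. \<Sum>b\<in>UNIV. (?u a b + ?v a b)\<^sup>2 / (real N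
        + real M))"
      unfolding A_def ham_coeff_covariance append_config_sum [of "\<lambda>x y. x $ _ * y $ _"] by
          (simp add: sum_divide_distrib)
    also have "\<dots> \<le> (\<Sum>a\<in>UNIV. \<Sum>b\<in>UNIV. (?u a b)\<^sup>2 / real N + (?v a b)\<^sup>2 / real M)"
      by (intro sum_mono square_sum_divide_le) (use pos in auto)
    also have "\<dots> = (\<Sum>k\<in>J. B s k * B t k)"
      unfolding covB ham_coeff_covariance by (simp add: sum.distrib sum_divide_distrib)
    finally show ?thesis .
  qed
  have diag: "(\<Sum>k\<in>site_pairs n. ham_coeff n \<sigma> k * ham_coeff n \<sigma> k)
      = real n * (\<Sum>a\<in>UNIV. \<Sum>b\<in>UNIV. (D $ a $ b)\<^sup>2)"
    if "\<sigma> \<in> overlap_configs n D" "n > 0" for \<sigma> n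
    unfolding ham_coeff_covariance overlap_configs_component [OF that] using that(2)
    by (simp add: power2_eq_square sum_distrib_left sum_divide_distrib mult_ac)
  have cov_eq: "(\<Sum>k\<in>site_pairs (N + M). A s k * A s k) = (\<Sum>k\<in>J. B s k * B s k)" if s: "s \<in> S" for s
    unfolding covB A_def diag [OF SZ [OF s], OF add_pos_pos [OF pos]] using s diag [of
        "fst s" N] diag [of "snd s" M] pos
    by (auto simp: S_def distrib_right)
  have fB: "affine_family J S B c (trace D * sqrt (real (N + M))) (real (N
      + M) * sqrt (trace D * real (N + M)) powr p)"
  proof
    fix s assume s: "s \<in> S"
    show "(\<Sum>k\<in>J. (B s k)\<^sup>2) \<le> (trace D * sqrt (real (N + M)))\<^sup>2"
      using A.coeff_bound [OF s] cov_eq [OF s] by (simp add: power2_eq_square)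
  qed (use S A.L_nonneg A.const_bound in \<open>auto simp: J_def\<close>)
  interpret B: affine_family J S B c "trace D * sqrt (real (N + M))" "real (N
      + M) * sqrt (trace D * real (N + M)) powr p"
    by (rule fB)
  let ?f = "\<lambda>g. ham_sup p N ?X (\<lambda>k\<in>site_pairs N. g k)" and ?h =
      "\<lambda>g. ham_sup p M ?Y (\<lambda>k\<in>site_pairs M. g (sh k))"
  have iX: "inj_on (\<lambda>k. k) (site_pairs N)" "(\<lambda>k. k) \<in> site_pairs N \<rightarrow> J" by (auto simp: J_def)
  have iY: "inj_on sh (site_pairs M)" "sh \<in> site_pairs M \<rightarrow> J" using inj by (auto simp: J_def)
  have split_le: "?f g + ?h g \<le> affine_sup J S B c g" for g
  proof -
    have 1: "((\<Sum>k\<in>site_pairs N. ham_coeff N \<sigma> k * g k) + - norm_p2_powr p N \<sigma>)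
      + ((\<Sum>k\<in>site_pairs M. ham_coeff M \<tau> k * g (sh k)) + - norm_p2_powr p M \<tau>)
          \<le> affine_sup J S B c g"
      if "\<sigma> \<in> ?X" "\<tau> \<in> ?Y" for \<sigma> \<tau>
      using B.affine_sup_upper [of "(\<sigma>, \<tau>)" g] that unfolding Jsum
      by (simp add: S_def c_def append_config_norm_p2 B1 B2)
    have "?f g \<le> affine_sup J S B c g - ((\<Sum>k\<in>site_pairs M. ham_coeff M \<tau> k * g (sh k)) +
        - norm_p2_powr p M \<tau>)"
      if t: "\<tau> \<in> ?Y" for \<tau>
      unfolding ham_sup_def
    proof (rule X.affine_sup_least)
      fix \<sigma> assume "\<sigma> \<in> ?X"
      from 1 [OF this t]
      show "(\<Sum>k\<in>site_pairs N. ham_coeff N \<sigma> k * restrict g (site_pairs N) k) + - norm_p2_powr p N \<sigma>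
        \<le> affine_sup J S B c g - ((\<Sum>k\<in>site_pairs M. ham_coeff M \<tau> k * g (sh k)) +
            - norm_p2_powr p M \<tau>)" by simp
    qed
    then have "?h g \<le> affine_sup J S B c g - ?f g"
      unfolding ham_sup_def [of p M] by (intro Y.affine_sup_least) fastforce
    then show ?thesis by simp
  qed
  have fi: "integrable (gauss_prod J) ?f" "(LINT g|gauss_prod J. ?f g) = mean_ham_sup p N D"
    using gauss_prod_reindex(1,2) [OF iX X.affine_sup_measurable] X.affine_sup_integrable
    by (simp_all add: mean_ham_sup_def ham_sup_def)
  have hi: "integrable (gauss_prod J) ?h" "(LINT g|gauss_prod J. ?h g) = mean_ham_sup p M D"
    using gauss_prod_reindex(1,2) [OF iY Y.affine_sup_measurable] Y.affine_sup_integrable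
    by (simp_all add: mean_ham_sup_def ham_sup_def)
  have "mean_ham_sup p N D + mean_ham_sup p M D = (LINT g|gauss_prod J. ?f g + ?h g)"
    unfolding Bochner_Integration.integral_add [OF fi(1) hi(1)] fi(2) hi(2) ..
  also have "\<dots> \<le> integral\<^sup>L (gauss_prod J) (affine_sup J S B c)"
    by (rule integral_mono [OF Bochner_Integration.integrable_add [OF fi(1) hi(1)]
        B.affine_sup_integrable split_le])
  also have "\<dots> \<le> integral\<^sup>L (gauss_prod (site_pairs (N + M))) (affine_sup (site_pairs (N
      + M)) S A c)"
    by (rule slepian [OF fA fB cov_le cov_eq])
  \<comment> \<open>Concatenations are only some of the configurations with self-overlap D.\<close>
  also have "\<dots> \<le> mean_ham_sup p (N + M) D"
    unfolding mean_ham_sup_def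
  proof (rule integral_mono [OF A.affine_sup_integrable])
    show "integrable (gauss_prod (site_pairs (N + M))) (ham_sup p (N + M) ?Z)"
      unfolding ham_sup_def by (rule Z.affine_sup_integrable)
    show "affine_sup (site_pairs (N + M)) S A c g \<le> ham_sup p (N + M) ?Z g" for g
      unfolding ham_sup_def A_def c_def using SZ
      by (intro A.affine_sup_least [unfolded A_def c_def] Z.affine_sup_upper)
  qed
  finally show ?thesis .
qed

text \<open>Superadditivity is available only from size k on, since smaller systems may have no
  configuration with the prescribed self-overlap. The remainder in the division by n0 is therefore
  kept between k and k + n0. The limit is the supremum over n \<ge> k, which gives the second
  conclusion.\<close>

lemma fekete_superadditive:
  fixes u :: "nat \<Rightarrow> real"
  assumes k: "k > 0" and super: "\<And>m n. m \<ge> k \<Longrightarrow> n \<ge> k \<Longrightarrow> u m + u n \<le> u (m + n)"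
    and bound: "\<And>n. n \<ge> k \<Longrightarrow> u n \<le> C * real n"
  shows "convergent (\<lambda>n. u n / real n)" "\<And>n. n \<ge> k \<Longrightarrow> u n / real n \<le> lim (\<lambda>n. u n / real n)"
proof -
  define L where "L = (\<Squnion>n\<in>{k..}. u n / real n)"
  have bdd: "bdd_above ((\<lambda>n. u n / real n) ` {k..})"
    by (rule bdd_aboveI2 [of _ _ C]) (use bound k in \<open>auto simp: divide_le_eq\<close>)
  have iter: "real q * u n + u r \<le> u (q * n + r)" if "n \<ge> k" "r \<ge> k" for q n r
  proof (induction q)
    case (Suc q)
    have "u n + u (q * n + r) \<le> u (n + (q * n + r))" using that by (intro super) auto
    then show ?case using Suc by (simp add: algebra_simps)
  qed simp
  have lim: "(\<lambda>n. u n / real n) \<longlonglongrightarrow> L"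
  proof (rule LIMSEQ_I)
    fix \<epsilon> :: real assume \<epsilon>: "\<epsilon> > 0"
    obtain n0 where n0: "n0 \<ge> k" "L - \<epsilon> / 2 < u n0 / real n0"
      using less_cSUP_iff [OF _ bdd, of "L - \<epsilon> / 2"] \<epsilon> unfolding L_def by auto
    define x where "x = u n0 / real n0"
    have n0p: "n0 > 0" using n0 k by simp
    then have un0: "u n0 = x * real n0" by (simp add: x_def)
    define B where "B = (\<Sum>r=k..k + n0. \<bar>u r\<bar>)"
    define K where "K = real (k + n0) * \<bar>x\<bar> + B"
    have lower: "x - K / real n \<le> u n / real n" if n: "n \<ge> k" for n
    proof -
      define q r where "q = (n - k) div n0" and "r = k + (n - k) mod n0"
      have "q * n0 + (n - k) mod n0 = n - k" unfolding q_def by (rule div_mult_mod_eq)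
      then have nqr: "n = q * n0 + r" using n by (simp add: r_def)
      have r: "k \<le> r" "r \<le> k + n0" using n0p by (auto simp: r_def intro: less_imp_le)
      have "real q * u n0 = x * (real n - real r)" unfolding un0 nqr by (simp add: algebra_simps)
      then have "x * real n - x * real r + u r \<le> u n"
        using iter [OF n0(1) r(1), of q] unfolding nqr [symmetric] by (simp add: right_diff_distrib)
      moreover have "x * real r \<le> real (k + n0) * \<bar>x\<bar>"
      proof -
        have "x * real r \<le> \<bar>x\<bar> * real r" by (intro mult_right_mono) auto
        also have "\<dots> \<le> \<bar>x\<bar> * real (k + n0)" using r by (intro mult_left_mono) auto
        finally show ?thesis by (simp add: mult.commute)
      qed
      moreover have "- u r \<le> B" unfolding B_def
        by (rule order_trans [OF abs_ge_minus_self]) (use r in \<open>intro member_le_sum, auto\<close>)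
      ultimately have "x * real n - K \<le> u n" unfolding K_def by linarith
      then have "(x * real n - K) / real n \<le> u n / real n" by (rule divide_right_mono) simp
      then show ?thesis using n k by (simp add: diff_divide_distrib)
    qed
    have "(\<lambda>n. K / real n) \<longlonglongrightarrow> 0" by real_asymp
    from LIMSEQ_D [OF this, of "\<epsilon> / 2"] \<epsilon> obtain n1 where n1: "\<And>n. n \<ge> n1 \<Longrightarrow> \<bar>K / real n\<bar> < \<epsilon> / 2"
        by auto
    show "\<exists>no. \<forall>n\<ge>no. norm (u n / real n - L) < \<epsilon>"
    proof (intro exI allI impI)
      fix n assume n: "n \<ge> max k n1"
      have "u n / real n \<le> L" unfolding L_def by (rule cSUP_upper [OF _ bdd]) (use n in simp)
      moreover have "x - K / real n \<le> u n / real n" using n by (intro lower) simp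
      moreover have "\<bar>K / real n\<bar> < \<epsilon> / 2" using n by (intro n1) simp
      ultimately show "norm (u n / real n - L) < \<epsilon>" using n0(2) \<epsilon> unfolding x_def real_norm_def
          by linarith
    qed
  qed
  then show "convergent (\<lambda>n. u n / real n)" by (rule convergentI)
  show "u n / real n \<le> lim (\<lambda>n. u n / real n)" if "n \<ge> k" for n
    unfolding limI [OF lim] L_def by (rule cSUP_upper [OF _ bdd]) (use that in simp)
qed

section \<open>The quadratic form on the sphere\<close>

definition unit_vectors :: "nat \<Rightarrow> (nat \<Rightarrow> real) set" where
  "unit_vectors N = {u. (\<Sum>i=1..N. (u i)\<^sup>2) = 1}"

text \<open>For N > 0, the largest eigenvalue of the symmetric part of the array.\<close>

definition quad_sup :: "nat \<Rightarrow> (nat \<times> nat \<Rightarrow> real) \<Rightarrow> real" where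
  "quad_sup N = affine_sup (site_pairs N) (unit_vectors N) (\<lambda>u k. u (fst k) * u (snd k)) (\<lambda>_. 0)"

lemma unit_vectors_nonempty: "N > 0 \<Longrightarrow> unit_vectors N \<noteq> {}"
proof -
  assume "N > 0"
  then have "(\<Sum>i=1..N. (if i = 1 then 1 else 0 :: real)\<^sup>2) = 1"
    by (simp add: if_distrib [of "\<lambda>x. x\<^sup>2"] cong: if_cong)
  then show ?thesis by (auto simp: unit_vectors_def)
qed

lemma quadratic_covariance:
  "(\<Sum>k\<in>site_pairs N. (u (fst k) * u (snd k)) * (v (fst k) * v (snd k)))
      = (\<Sum>i=1..N. u i * v i :: real)\<^sup>2"
  unfolding power2_eq_square sum_product site_pairs_def sum.cartesian_product
  by (simp add: case_prod_unfold mult_ac)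

lemma affine_family_quadratic:
  assumes "N > 0"
  shows "affine_family (site_pairs N) (unit_vectors N) (\<lambda>u k. u (fst k) * u (snd k)) (\<lambda>_. 0) 1 0"
proof
  fix u assume "u \<in> unit_vectors N"
  then show "(\<Sum>k\<in>site_pairs N. (u (fst k) * u (snd k))\<^sup>2) \<le> 1\<^sup>2"
    using quadratic_covariance [of u u N] by (simp add: power2_eq_square unit_vectors_def)
qed (use assms unit_vectors_nonempty in auto)

lemma quadratic_le_quad_sup:
  assumes N: "N > 0"
  shows "(\<Sum>k\<in>site_pairs N. u (fst k) * u (snd k) * g k) \<le> quad_sup N g * (\<Sum>i=1..N. (u i)\<^sup>2)"
proof (cases "(\<Sum>i=1..N. (u i)\<^sup>2) = 0")
  case True
  then have "u i = 0" if "i \<in> {1..N}" for i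
    using that by (subst (asm) sum_nonneg_eq_0_iff) auto
  then have "(\<Sum>k\<in>site_pairs N. u (fst k) * u (snd k) * g k) = 0"
    by (intro sum.neutral) (auto simp: site_pairs_def)
  then show ?thesis unfolding True by simp
next
  case False
  interpret affine_family "site_pairs N" "unit_vectors N" "\<lambda>u k. u (fst k) * u (snd k)" "\<lambda>_. 0" 1 0
    by (rule affine_family_quadratic [OF N])
  define s where "s = (\<Sum>i=1..N. (u i)\<^sup>2)"
  have "s \<ge> 0" unfolding s_def by (intro sum_nonneg) simp
  then have s: "s > 0" using False unfolding s_def by linarith
  define v where "v i = u i / sqrt s" for i
  have "(\<Sum>i=1..N. (v i)\<^sup>2) = s / s"
    unfolding v_def power_divide sum_divide_distrib [symmetric] s_def [symmetric] using s by simp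
  then have "v \<in> unit_vectors N" using s by (simp add: unit_vectors_def)
  from affine_sup_upper [OF this, of g]
  have "(\<Sum>k\<in>site_pairs N. v (fst k) * v (snd k) * g k) \<le> quad_sup N g" by (simp add: quad_sup_def)
  moreover have "v (fst k) * v (snd k) * g k = u (fst k) * u (snd k) * g k / s" for k
    using s by (simp add: v_def)
  ultimately have "(\<Sum>k\<in>site_pairs N. u (fst k) * u (snd k) * g k) / s \<le> quad_sup N g"
    by (simp add: sum_divide_distrib)
  then show ?thesis unfolding s_def [symmetric] using s by (simp add: pos_divide_le_eq)
qed

text \<open>The Hamiltonian is a sum of kappa scalar quadratic forms, one for each coordinate of the
  spins.\<close>

lemma ham_le_quad_sup:
  fixes \<sigma> :: "nat \<Rightarrow> real ^ 'k"
  assumes N: "N > 0"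
  shows "(\<Sum>k\<in>site_pairs N. ham_coeff N \<sigma> k * g k) \<le> quad_sup N g / sqrt (real N) * (\<Sum>i=1..N. (norm
      (\<sigma> i))\<^sup>2)"
proof -
  have "(\<Sum>k\<in>site_pairs N. (\<sigma> (fst k) \<bullet> \<sigma> (snd k)) * g k)
      = (\<Sum>a\<in>UNIV. \<Sum>k\<in>site_pairs N. \<sigma> (fst k) $ a * \<sigma> (snd k) $ a * g k)"
    by (simp add: inner_vec_def sum_distrib_right sum.swap [of _ "UNIV :: 'k set"])
  also have "\<dots> \<le> (\<Sum>a\<in>(UNIV::'k set). quad_sup N g * (\<Sum>i=1..N. (\<sigma> i $ a)\<^sup>2))"
    by (intro sum_mono quadratic_le_quad_sup N)
  also have "\<dots> = quad_sup N g * (\<Sum>i=1..N. (norm (\<sigma> i))\<^sup>2)"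
    unfolding sum_distrib_left [symmetric] power2_norm_eq_sum_cart power2_eq_square [of "_ $ _"]
    by (rule arg_cong [where f = "(*) (quad_sup N g)"], rule sum.swap)
  finally have "(\<Sum>k\<in>site_pairs N. (\<sigma> (fst k) \<bullet> \<sigma> (snd k)) * g k) / sqrt (real N)
      \<le> quad_sup N g * (\<Sum>i=1..N. (norm (\<sigma> i))\<^sup>2) / sqrt (real N)"
    by (rule divide_right_mono) simp
  then show ?thesis by (simp add: ham_coeff_def sum_divide_distrib)
qed

text \<open>
  Comparison of \<open>u\<^sup>T g u + z\<close> with \<open>\<surd>2 h \<bullet> u\<close>: on the unit sphere both have variance 2, and the
  covariances satisfy \<open>(u \<bullet> v)\<^sup>2 + 1 \<ge> 2 (u \<bullet> v)\<close>.
\<close>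

lemma mean_quad_sup:
  assumes N: "N > 0"
  shows "integral\<^sup>L (gauss_prod (site_pairs N)) (quad_sup N) \<le> sqrt 2 * sqrt (real N)"
proof -
  let ?S = "unit_vectors N"
  let ?q = "\<lambda>u k. u (fst k) * u (snd k) :: real"
  \<comment> \<open>Sites are numbered from 1, so \<open>(0, 0)\<close> is a free index; its entry
    is the additional Gaussian z.\<close>
  let ?J = "insert (0, 0) (site_pairs N)"
  have z: "(0, 0) \<notin> site_pairs N" by (simp add: site_pairs_def)
  define b where "b u k = (if k = (0, 0) then 1 else ?q u k)" for u :: "nat \<Rightarrow> real" and k ::
      "nat \<times> nat"
  define a where "a u i = sqrt 2 * u i" for u :: "nat \<Rightarrow> real" and i :: nat
  have bs: "(\<Sum>k\<in>site_pairs N. b u k * f k) = (\<Sum>k\<in>site_pairs N. ?q u k * f k)" for u and f ::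
      "_ \<Rightarrow> real"
    by (rule sum.cong) (use z in \<open>auto simp: b_def\<close>)
  have bs2: "(\<Sum>k\<in>site_pairs N. b u k * b v k) = (\<Sum>k\<in>site_pairs N. ?q u k * ?q v k)" for u v
    by (rule sum.cong) (use z in \<open>auto simp: b_def\<close>)
  have covb: "(\<Sum>k\<in>?J. b u k * b v k) = 1 + (\<Sum>i=1..N. u i * v i)\<^sup>2" for u v
    using z by (simp add: bs2 quadratic_covariance) (simp add: b_def)
  have cova: "(\<Sum>i\<in>{1..N}. a u i * a v i) = 2 * (\<Sum>i=1..N. u i * v i)" for u v
    unfolding a_def sum_distrib_left by (rule sum.cong) (auto simp: algebra_simps)
  interpret Q: affine_family "site_pairs N" ?S ?q "\<lambda>_. 0" 1 0
    by (rule affine_family_quadratic [OF N])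
  have unit: "(\<Sum>i=1..N. u i * u i) = 1" if "u \<in> ?S" for u
    using that by (simp add: unit_vectors_def power2_eq_square)
  have fb: "affine_family ?J ?S b (\<lambda>_. 0) (sqrt 2) 0"
    by unfold_locales (use Q.nonempty covb unit in \<open>auto simp: power2_eq_square\<close>)
  have fa: "affine_family {1..N} ?S a (\<lambda>_. 0) (sqrt 2) 0"
    by unfold_locales (use Q.nonempty cova unit in \<open>auto simp: power2_eq_square\<close>)
  interpret B: affine_family ?J ?S b "\<lambda>_. 0" "sqrt 2" 0 by (rule fb)
  interpret A: affine_family "{1..N}" ?S a "\<lambda>_. 0" "sqrt 2" 0 by (rule fa)
  interpret PA: prob_space "gauss_prod {1..N}" by (rule prob_space_gauss_prod)
  have i: "inj_on (\<lambda>k. k) (site_pairs N)" "(\<lambda>k. k) \<in> site_pairs N \<rightarrow> ?J" by auto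
  let ?f = "\<lambda>g. quad_sup N (\<lambda>k\<in>site_pairs N. g k)"
  have fi: "integrable (gauss_prod ?J) ?f" "(LINT g|gauss_prod ?J. ?f g)
      = integral\<^sup>L (gauss_prod (site_pairs N)) (quad_sup N)"
    using gauss_prod_reindex(1,2) [OF i Q.affine_sup_measurable] Q.affine_sup_integrable
    by (simp_all add: quad_sup_def)
  have z0: "integrable (gauss_prod ?J) (\<lambda>g. g (0, 0))" "(LINT g|gauss_prod ?J. g (0, 0)) = 0"
    using gauss_prod_integrable_component(1) [of "(0, 0)" ?J] gauss_prod_component(1) [of
        "(0, 0)" ?J "\<lambda>z. z"] std_gauss_mean
    by auto
  have le1: "?f g + g (0, 0) \<le> affine_sup ?J ?S b (\<lambda>_. 0) g" for g
  proof -
    have "?f g \<le> affine_sup ?J ?S b (\<lambda>_. 0) g - g (0, 0)"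
      unfolding quad_sup_def
    proof (rule Q.affine_sup_least)
      fix u assume "u \<in> ?S"
      from B.affine_sup_upper [OF this, of g] z
      have "b u (0, 0) * g (0, 0) + (\<Sum>k\<in>site_pairs N. b u k * g k) \<le> affine_sup ?J ?S b (\<lambda>_. 0) g"
          by simp
      then show "(\<Sum>k\<in>site_pairs N. u (fst k) * u (snd k) * restrict g (site_pairs N) k) + 0
          \<le> affine_sup ?J ?S b (\<lambda>_. 0) g - g (0, 0)"
        unfolding bs by (simp add: b_def)
    qed
    then show ?thesis by simp
  qed
  have s2: "integrable (gauss_prod {1..N}) (\<lambda>h. \<Sum>i=1..N. (h i)\<^sup>2)"
    by (intro Bochner_Integration.integrable_sum gauss_prod_integrable_component(3))
  have Es2: "(LINT h|gauss_prod {1..N}. (\<Sum>i=1..N. (h i)\<^sup>2)) = real N"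
  proof -
    have "(LINT h|gauss_prod {1..N}. (\<Sum>i=1..N. (h i)\<^sup>2))
        = (\<Sum>i=1..N. LINT h|gauss_prod {1..N}. (h i)\<^sup>2)"
      by (intro Bochner_Integration.integral_sum gauss_prod_integrable_component(3))
    also have "\<dots> = (\<Sum>i=1..N. 1)"
    proof (rule sum.cong [OF refl])
      fix i assume "i \<in> {1..N}"
      then show "(LINT h|gauss_prod {1..N}. (h i)\<^sup>2) = 1"
        using gauss_prod_component(1) [of i "{1..N}" "\<lambda>z. z\<^sup>2"] std_gauss_second_moment by simp
    qed
    finally show ?thesis by simp
  qed
  let ?n = "sqrt (real N)"
  have n: "?n > 0" "?n * ?n = real N" using N by auto
  \<comment> \<open>The supremum is \<open>sqrt 2\<close> times the norm of h. The inequality 2 u h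
    \<le> h^2 / n + n u^2 with \<open>n = sqrt N\<close> replaces the norm by its square, whose mean
    is N.\<close>
  have le2: "affine_sup {1..N} ?S a (\<lambda>_. 0) h \<le> sqrt 2 * (((\<Sum>i=1..N. (h i)\<^sup>2) / ?n + ?n) / 2)" for h
  proof (rule A.affine_sup_least)
    fix u assume u: "u \<in> ?S"
    let ?s = "\<Sum>i=1..N. (h i)\<^sup>2"
    have t: "u i * h i \<le> ((h i)\<^sup>2 / ?n + ?n * (u i)\<^sup>2) / 2" for i
    proof -
      have "0 \<le> (h i - ?n * u i)\<^sup>2 / ?n" using n by simp
      also have "\<dots> = (h i)\<^sup>2 / ?n + ?n * (u i)\<^sup>2 - 2 * (u i * h i)"
        using n(1) by (simp add: power2_diff power_mult_distrib divide_simps)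
      finally show ?thesis by simp
    qed
    have "(\<Sum>i=1..N. u i * h i) \<le> (\<Sum>i=1..N. ((h i)\<^sup>2 / ?n + ?n * (u i)\<^sup>2) / 2)"
      by (rule sum_mono) (rule t)
    also have "\<dots> = (?s / ?n + ?n * (\<Sum>i=1..N. (u i)\<^sup>2)) / 2"
      by (simp add: sum.distrib sum_distrib_left sum_divide_distrib add_divide_distrib)
    finally have "(\<Sum>i=1..N. u i * h i) \<le> (?s / ?n + ?n) / 2" using u by (simp add: unit_vectors_def)
    then have "sqrt 2 * (\<Sum>i=1..N. u i * h i) \<le> sqrt 2 * ((?s / ?n + ?n) / 2)"
        by (rule mult_left_mono) simp
    then show "(\<Sum>i=1..N. a u i * h i) + 0 \<le> sqrt 2 * ((?s / ?n + ?n) / 2)"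
      by (simp add: a_def sum_distrib_left mult.assoc)
  qed
  have "integral\<^sup>L (gauss_prod (site_pairs N)) (quad_sup N) = (LINT g|gauss_prod ?J. ?f g
      + g (0, 0))"
    unfolding Bochner_Integration.integral_add [OF fi(1) z0(1)] fi(2) z0(2) by simp
  also have "\<dots> \<le> integral\<^sup>L (gauss_prod ?J) (affine_sup ?J ?S b (\<lambda>_. 0))"
    by (rule integral_mono [OF Bochner_Integration.integrable_add [OF fi(1) z0(1)]
        B.affine_sup_integrable le1])
  also have "\<dots> \<le> integral\<^sup>L (gauss_prod {1..N}) (affine_sup {1..N} ?S a (\<lambda>_. 0))"
  proof (rule slepian [OF fa fb])
    fix u v :: "nat \<Rightarrow> real"
    have "0 \<le> (1 - (\<Sum>i=1..N. u i * v i))\<^sup>2" by simp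
    then show "(\<Sum>i\<in>{1..N}. a u i * a v i) \<le> (\<Sum>k\<in>?J. b u k * b v k)"
      unfolding cova covb by (simp add: power2_diff)
  next
    fix u :: "nat \<Rightarrow> real" assume u: "u \<in> ?S"
    show "(\<Sum>i\<in>{1..N}. a u i * a u i) = (\<Sum>k\<in>?J. b u k * b u k)"
      unfolding cova covb unit [OF u] by simp
  qed
  also have "\<dots> \<le> (LINT h|gauss_prod {1..N}. sqrt 2 * (((\<Sum>i=1..N. (h i)\<^sup>2) / ?n + ?n) / 2))"
    by (rule integral_mono [OF A.affine_sup_integrable _ le2])
       (intro integrable_mult_right integrable_divide Bochner_Integration.integrable_add s2
           PA.integrable_const)
  also have "\<dots> = sqrt 2 * ((real N / ?n + ?n) / 2)"
    unfolding integral_mult_right_zero integral_divide_zero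
      Bochner_Integration.integral_add [OF integrable_divide [OF s2] PA.integrable_const] Es2
    using PA.prob_space by simp
  also have "real N / ?n = ?n" using n by (simp add: real_div_sqrt)
  finally show ?thesis by simp
qed

section \<open>The penalty against the squared norm, and the limit at t = 1\<close>

lemma square_le_powr:
  fixes p B :: real
  assumes "p > 2" "B > 0"
  shows "\<exists>C\<ge>0. \<forall>y\<ge>0. B * y\<^sup>2 \<le> y powr p + C"
proof -
  \<comment> \<open>The threshold beyond which \<open>y powr (p - 2)\<close> is at least B; p > 2
    makes it exist.\<close>
  define y0 where "y0 = B powr (1 / (p - 2))"
  have y0: "y0 > 0" "y0 powr (p - 2) = B" using assms by (simp_all add: y0_def powr_powr)
  have "B * y\<^sup>2 \<le> y powr p + B * y0\<^sup>2" if "y \<ge> 0" for y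
  proof (cases "y \<ge> y0")
    case True
    then have yp: "y > 0" using y0 by simp
    have "B \<le> y powr (p - 2)" unfolding y0(2) [symmetric] using True y0 assms by
        (intro powr_mono2) auto
    then have "B * y\<^sup>2 \<le> y powr (p - 2) * y\<^sup>2" by (rule mult_right_mono) simp
    also have "\<dots> = y powr p" using yp by (simp flip: powr_numeral powr_add)
    finally show ?thesis using assms by (simp add: add_increasing2)
  next
    case False
    then have "B * y\<^sup>2 \<le> B * y0\<^sup>2" using that assms by (intro mult_left_mono power_mono) auto
    then show ?thesis by (simp add: add_increasing)
  qed
  then show ?thesis using assms by (intro exI [of _ "B * y0\<^sup>2"]) auto
qed

lemma square_le_norm_p2:
  assumes "p > 2" "B > 0"
  shows "\<exists>C\<ge>0. \<forall>N. \<forall>\<sigma> :: nat \<Rightarrow> real ^ 'k. B * (\<Sum>i=1..N. (norm (\<sigma> i))\<^sup>2) \<le> norm_p2_powr p N \<sigma>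
      + C * real N"
proof -
  obtain C where C: "C \<ge> 0" "\<And>y. y \<ge> 0 \<Longrightarrow> B * y\<^sup>2 \<le> y powr p + C"
    using square_le_powr [OF assms] by blast
  have "B * (\<Sum>i=1..N. (norm (\<sigma> i))\<^sup>2) \<le> norm_p2_powr p N \<sigma> + C * real N" for N and \<sigma> ::
      "nat \<Rightarrow> real ^ 'k"
  proof -
    have "B * (\<Sum>i=1..N. (norm (\<sigma> i))\<^sup>2) \<le> (\<Sum>i=1..N. norm (\<sigma> i) powr p + C)"
      unfolding sum_distrib_left by (intro sum_mono C(2)) simp
    then show ?thesis by (simp add: sum.distrib norm_p2_powr_def mult.commute)
  qed
  then show ?thesis using C(1) by blast
qed

text \<open>The spherical bound limits the mean of the Hamiltonian part to
  \<open>2 * trace D * N\<close>, and \<open>square_le_norm_p2\<close> with constant 2 lets the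
  penalty absorb exactly this. The result is uniform in D, so the supremum of the limits over D is
  finite.\<close>

lemma mean_ham_sup_bound:
  assumes "p > 2"
  shows "\<exists>C\<ge>0. \<forall>N\<ge>CARD('k). \<forall>D\<in>psd_matrices. mean_ham_sup p N (D :: real ^ 'k ^ 'k) \<le> C * real N"
proof -
  obtain C where C: "C \<ge> 0" "\<And>N (\<sigma> :: nat \<Rightarrow> real ^ 'k). 2 * (\<Sum>i=1..N. (norm (\<sigma> i))\<^sup>2)
      \<le> norm_p2_powr p N \<sigma> + C * real N"
    using square_le_norm_p2 [OF assms, of 2] by auto
  have "mean_ham_sup p N D \<le> C * real N" if N: "N \<ge> CARD('k)" and D: "D \<in> psd_matrices" for N
      and D :: "real ^ 'k ^ 'k"
  proof -
    have "CARD('k) > 0" by simp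
    with N have N0: "N > 0" by linarith
    interpret X: affine_family "site_pairs N" "overlap_configs N D" "ham_coeff N" "\<lambda>\<sigma>.
        - norm_p2_powr p N \<sigma>"
       "trace D * sqrt (real N)" "real N * sqrt (trace D * real N) powr p"
      using assms by (intro affine_family_overlap D overlap_configs_nonempty N) simp
    interpret Q: affine_family "site_pairs N" "unit_vectors N" "\<lambda>u k. u (fst k) * u (snd k)"
        "\<lambda>_. 0" 1 0
      by (rule affine_family_quadratic [OF N0])
    interpret P: prob_space "gauss_prod (site_pairs N)" by (rule prob_space_gauss_prod)
    let ?s = "trace D * real N"
    have s: "?s \<ge> 0" using psd_trace_nonneg [OF D] by simp
    have qi: "integrable (gauss_prod (site_pairs N)) (quad_sup N)"
      unfolding quad_sup_def by (rule Q.affine_sup_integrable)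
    have "mean_ham_sup p N D \<le> (LINT g|gauss_prod (site_pairs N). quad_sup N g / sqrt (real N) * ?s
        + (C * real N - 2 * ?s))"
      unfolding mean_ham_sup_def ham_sup_def
    proof (rule integral_mono [OF X.affine_sup_integrable])
      show "integrable (gauss_prod (site_pairs N)) (\<lambda>g. quad_sup N g / sqrt (real N) * ?s
          + (C * real N - 2 * ?s))"
        by (intro Bochner_Integration.integrable_add integrable_mult_left integrable_divide qi
            P.integrable_const)
      fix g
      show "affine_sup (site_pairs N) (overlap_configs N D) (ham_coeff N) (\<lambda>\<sigma>.
          - norm_p2_powr p N \<sigma>) g
          \<le> quad_sup N g / sqrt (real N) * ?s + (C * real N - 2 * ?s)"
      proof (rule X.affine_sup_least)
        fix \<sigma> assume \<sigma>: "\<sigma> \<in> overlap_configs N D"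
        show "(\<Sum>k\<in>site_pairs N. ham_coeff N \<sigma> k * g k) + - norm_p2_powr p N \<sigma>
            \<le> quad_sup N g / sqrt (real N) * ?s + (C * real N - 2 * ?s)"
          using ham_le_quad_sup [OF N0, of \<sigma> g] C(2) [of \<sigma> N] unfolding overlap_configs_norm [OF \<sigma>]
              by linarith
      qed
    qed
    also have "\<dots> = integral\<^sup>L (gauss_prod (site_pairs N)) (quad_sup N) / sqrt (real N) * ?s
        + (C * real N - 2 * ?s)"
      unfolding Bochner_Integration.integral_add [OF integrable_mult_left [OF integrable_divide [OF
          qi]] P.integrable_const]
      by (simp add: P.prob_space)
    also have "\<dots> \<le> 2 * ?s + (C * real N - 2 * ?s)"
    proof (intro add_right_mono mult_right_mono s)
      have "sqrt 2 \<le> (2::real)" by (rule real_le_lsqrt) auto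
      then have "sqrt 2 * sqrt (real N) \<le> 2 * sqrt (real N)" by (rule mult_right_mono) simp
      then have "integral\<^sup>L (gauss_prod (site_pairs N)) (quad_sup N) \<le> 2 * sqrt (real N)"
        using mean_quad_sup [OF N0] by linarith
      then show "integral\<^sup>L (gauss_prod (site_pairs N)) (quad_sup N) / sqrt (real N) \<le> 2"
        using N0 by (simp add: pos_divide_le_eq)
    qed
    finally show ?thesis by simp
  qed
  then show ?thesis using C(1) by blast
qed

text \<open>The value \<open>L_{p,D}(1)\<close>, expressed through the canonical product measure;
  \<open>lim_lagrangian_overlap_scale\<close> connects it with the given probability space.\<close>

definition lim_overlap :: "real \<Rightarrow> real ^ 'k ^ 'k \<Rightarrow> real" where
  "lim_overlap p D = lim (\<lambda>N. mean_ham_sup p N D / real N)"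

lemma mean_ham_sup_limit:
  fixes D :: "real ^ 'k ^ 'k"
  assumes p: "p > 2" and D: "D \<in> psd_matrices"
  shows "(\<lambda>N. mean_ham_sup p N D / real N) \<longlonglongrightarrow> lim_overlap p D"
    and "\<And>N. N \<ge> CARD('k) \<Longrightarrow> mean_ham_sup p N D \<le> lim_overlap p D * real N"
proof -
  obtain C where C: "\<And>N. N \<ge> CARD('k) \<Longrightarrow> mean_ham_sup p N D \<le> C * real N"
    using mean_ham_sup_bound [OF p] D by blast
  have p0: "p > 0" using p by simp
  note f = fekete_superadditive [of "CARD('k)" "\<lambda>N. mean_ham_sup p N D", OF _
      mean_ham_sup_superadditive [OF p0 D] C, simplified]
  show "(\<lambda>N. mean_ham_sup p N D / real N) \<longlonglongrightarrow> lim_overlap p D"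
    using f(1) unfolding lim_overlap_def by (simp add: convergent_LIMSEQ_iff)
  fix N assume N: "N \<ge> CARD('k)"
  have "CARD('k) > 0" by simp
  with N have "N > 0" by linarith
  with f(2) [OF N] show "mean_ham_sup p N D \<le> lim_overlap p D * real N"
    unfolding lim_overlap_def by (simp add: pos_divide_le_eq)
qed

lemma lim_overlap_bounded:
  assumes p: "p > 2"
  shows "bdd_above (lim_overlap p ` (psd_matrices :: (real ^ 'k ^ 'k) set))"
proof -
  obtain C where C: "\<And>N (D :: real ^ 'k ^ 'k). N \<ge> CARD('k) \<Longrightarrow> D \<in> psd_matrices \<Longrightarrow> mean_ham_sup p N D
      \<le> C * real N"
    using mean_ham_sup_bound [OF p] by blast
  have "lim_overlap p D \<le> C" if D: "D \<in> psd_matrices" for D :: "real ^ 'k ^ 'k"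
  proof (rule LIMSEQ_le_const2 [OF mean_ham_sup_limit(1) [OF p D]], intro exI allI impI)
    fix N assume N: "N \<ge> CARD('k)"
    have "CARD('k) > 0" by simp
    with N have "N > 0" by linarith
    with C [OF N D] show "mean_ham_sup p N D / real N \<le> C" by (simp add: pos_divide_le_eq)
  qed
  then show ?thesis by (intro bdd_aboveI2)
qed

definition gauss_var_const :: real where
  "gauss_var_const = 2 * (1 + 256 * gauss_eighth_moment)"

lemma gauss_var_const_nonneg: "gauss_var_const \<ge> 0"
  using gauss_eighth_moment_nonneg by (simp add: gauss_var_const_def)

text \<open>There are N^2 entries, so \<open>m = sqrt N\<close> gives both terms of
  \<open>affine_sup_variance\<close> the order \<open>sqrt N\<close>, because N^2 / N^(3/2) =
  N^(1/2).\<close>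

lemma site_pairs_variance:
  assumes "affine_family (site_pairs N) S a c L C" "N > 0"
  shows "(LINT g|gauss_prod (site_pairs N). (affine_sup (site_pairs N) S a c g
      - integral\<^sup>L (gauss_prod (site_pairs N)) (affine_sup (site_pairs N) S a c))\<^sup>2)
          \<le> gauss_var_const * L\<^sup>2 * sqrt (real N)"
proof -
  interpret affine_family "site_pairs N" S a c L C by fact
  let ?n = "sqrt (real N)"
  have n: "?n > 0" "real N = ?n * ?n" using assms(2) by auto
  have "real (card (site_pairs N)) = ?n ^ 4"
    unfolding card_site_pairs of_nat_mult using n(2) by (simp add: numeral_eq_Suc mult.assoc)
  then have "real (card (site_pairs N)) * (256 * gauss_eighth_moment) / ?n ^ 3
      = ?n * (256 * gauss_eighth_moment)"
    using n(1) by (simp add: numeral_eq_Suc)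
  then show ?thesis
    using affine_sup_variance [OF n(1)] by (simp add: gauss_var_const_def algebra_simps)
qed

section \<open>Extending a configuration to a prescribed overlap\<close>

text \<open>Unnormalised, so that values at the sizes N and N + M can be compared before the factors
  \<open>1 / sqrt N\<close> and \<open>1 / sqrt (N + M)\<close> enter.\<close>

definition quad_form :: "(nat \<times> nat \<Rightarrow> real) \<Rightarrow> nat \<Rightarrow> (nat \<Rightarrow> real ^ 'k) \<Rightarrow> real" where
  "quad_form g N \<sigma> = (\<Sum>i=1..N. \<Sum>j=1..N. g (i, j) * (\<sigma> i \<bullet> \<sigma> j))"

lemma quad_form_eq: "quad_form g N \<sigma> = sqrt (real N) * (\<Sum>k\<in>site_pairs N. ham_coeff N \<sigma> k * g k)"
  unfolding hamiltonian_eq_affine [symmetric] hamiltonian_def quad_form_def by (cases "N = 0") auto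

lemma quad_form_cong:
  assumes "\<And>i. i \<in> {1..N} \<Longrightarrow> \<sigma> i = \<tau> i"
  shows "quad_form g N \<sigma> = quad_form g N \<tau>"
  unfolding quad_form_def by (intro sum.cong refl) (use assms in auto)

text \<open>Choosing the sign of each new spin in turn makes its interaction with the previous spins
    nonnegative.\<close>

lemma greedy_signs:
  fixes \<sigma> \<tau> :: "nat \<Rightarrow> real ^ 'k"
  shows "\<exists>\<rho>. (\<forall>i\<in>{1..N}. \<rho> i = \<sigma> i) \<and> (\<forall>j\<in>{1..M}. \<rho> (N + j) = \<tau> j \<or> \<rho> (N + j) = - \<tau> j) \<and>
    quad_form g N \<sigma> + (\<Sum>j=1..M. g (N + j, N + j) * (norm (\<tau> j))\<^sup>2) \<le> quad_form g (N + M) \<rho>"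
proof (induction M)
  case 0
  show ?case by (intro exI [of _ \<sigma>]) simp
next
  case (Suc M)
  then obtain \<rho> where \<rho>: "\<And>i. i \<in> {1..N} \<Longrightarrow> \<rho> i = \<sigma> i"
    "\<And>j. j \<in> {1..M} \<Longrightarrow> \<rho> (N + j) = \<tau> j \<or> \<rho> (N + j) = - \<tau> j"
    "quad_form g N \<sigma> + (\<Sum>j=1..M. g (N + j, N + j) * (norm (\<tau> j))\<^sup>2) \<le> quad_form g (N + M) \<rho>"
        by blast
  let ?n = "N + M"
  define l where "l = (\<Sum>i=1..?n. (g (i, Suc ?n) + g (Suc ?n, i)) * (\<rho> i \<bullet> \<tau> (Suc M)))"
  define s :: real where "s = (if l \<ge> 0 then 1 else -1)"
  define \<rho>' where "\<rho>' = \<rho>(Suc ?n := s *\<^sub>R \<tau> (Suc M))"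
  have s: "s * s = 1" "s = 1 \<or> s = -1" "s * l \<ge> 0" by (auto simp: s_def mult_nonpos_nonpos)
  have old: "\<rho>' i = \<rho> i" if "i \<in> {1..?n}" for i using that by (simp add: \<rho>'_def)
  have new: "\<rho>' (Suc ?n) = s *\<^sub>R \<tau> (Suc M)" by (simp add: \<rho>'_def)
  have "quad_form g (Suc ?n) \<rho>' = quad_form g ?n \<rho>' + (\<Sum>i=1..?n. g (i, Suc ?n) * (\<rho>' i \<bullet> \<rho>' (Suc
      ?n)))
      + (\<Sum>j=1..?n. g (Suc ?n, j) * (\<rho>' (Suc ?n) \<bullet> \<rho>' j))
          + g (Suc ?n, Suc ?n) * (\<rho>' (Suc ?n) \<bullet> \<rho>' (Suc ?n))"
    by (simp add: quad_form_def sum.distrib)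
  also have "quad_form g ?n \<rho>' = quad_form g ?n \<rho>" by (rule quad_form_cong) (rule old)
  also have "(\<Sum>i=1..?n. g (i, Suc ?n) * (\<rho>' i \<bullet> \<rho>' (Suc ?n)))
      = s * (\<Sum>i=1..?n. g (i, Suc ?n) * (\<rho> i \<bullet> \<tau> (Suc M)))"
    unfolding new sum_distrib_left by (intro sum.cong refl) (simp add: old)
  also have "(\<Sum>j=1..?n. g (Suc ?n, j) * (\<rho>' (Suc ?n) \<bullet> \<rho>' j))
      = s * (\<Sum>j=1..?n. g (Suc ?n, j) * (\<rho> j \<bullet> \<tau> (Suc M)))"
    unfolding new sum_distrib_left by (intro sum.cong refl) (simp add: old inner_commute)
  also have "\<rho>' (Suc ?n) \<bullet> \<rho>' (Suc ?n) = (norm (\<tau> (Suc M)))\<^sup>2"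
    unfolding new using s(1) by (simp add: power2_norm_eq_inner)
  finally have "quad_form g (Suc ?n) \<rho>' = quad_form g ?n \<rho> + s * l
      + g (Suc ?n, Suc ?n) * (norm (\<tau> (Suc M)))\<^sup>2"
    by (simp add: l_def distrib_right sum.distrib distrib_left)
  then have "quad_form g N \<sigma> + (\<Sum>j=1..Suc M. g (N + j, N + j) * (norm (\<tau> j))\<^sup>2) \<le> quad_form g (N
      + Suc M) \<rho>'"
    using \<rho>(3) s(3) by simp
  moreover have "\<rho>' i = \<sigma> i" if "i \<in> {1..N}" for i using old [of i] \<rho>(1) [OF that] that by simp
  moreover have "\<rho>' (N + j) = \<tau> j \<or> \<rho>' (N + j) = - \<tau> j" if "j \<in> {1..Suc M}" for j
  proof (cases "j = Suc M")
    case True then show ?thesis using s(2) new by auto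
  next
    case False
    then show ?thesis using \<rho>(2) [of j] old [of "N + j"] that by simp
  qed
  ultimately show ?case by blast
qed

text \<open>The deficit \<open>E\<close> of the unnormalised self-overlap is non-negative by
  domination, and \<open>psd_spread\<close> distributes it over the new spins. Their signs do not
  affect the self-overlap, so they can be chosen greedily. A loss can come only from the diagonal
  entries of g, whose terms are insensitive to signs.\<close>

lemma extend_config:
  fixes \<sigma> :: "nat \<Rightarrow> real ^ 'k" and D' :: "real ^ 'k ^ 'k"
  assumes p: "p > 0" and N: "N > 0" and m: "m > 0" and M: "M = m * CARD('k)"
    and D': "D' \<in> psd_matrices" and le: "\<And>x. x \<bullet> (self_overlap N \<sigma> *v x) \<le> x \<bullet> (D' *v x)"
    and q: "(real (N + M) * trace D' - real N * trace (self_overlap N \<sigma>)) / real m \<le> q"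
  shows "\<exists>\<rho>\<in>overlap_configs (N + M) D'.
     quad_form g N \<sigma> - q * (\<Sum>j=1..M. \<bar>g (N + j, N + j)\<bar>) \<le> quad_form g (N + M) \<rho> \<and>
     norm_p2_powr p (N + M) \<rho> \<le> norm_p2_powr p N \<sigma> + real M * sqrt q powr p"
proof -
  define E where "E = real (N + M) *\<^sub>R D' - real N *\<^sub>R self_overlap N \<sigma>"
  have E: "E \<in> psd_matrices"
  proof -
    have "transpose E = E"
      using D' self_overlap_psd [of N \<sigma>] unfolding psd_matrices_def
      by (simp add: E_def transpose_def vec_eq_iff)
    moreover have "0 \<le> x \<bullet> (E *v x)" for x
    proof -
      have "x \<bullet> (E *v x) = real (N + M) * (x \<bullet> (D' *v x)) - real N * (x \<bullet> (self_overlap N \<sigma> *v x))"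
        unfolding E_def matrix_vector_mult_diff_rdistrib inner_diff_right
        by (simp add: scaleR_matrix_vector_assoc [symmetric])
      moreover have "real N * (x \<bullet> (self_overlap N \<sigma> *v x)) \<le> real (N + M) * (x \<bullet> (D' *v x))"
        by (rule mult_mono) (use le D' in \<open>auto simp: psd_matrices_def self_overlap_quadratic
            sum_nonneg\<close>)
      ultimately show ?thesis by simp
    qed
    ultimately show ?thesis by (simp add: psd_matrices_def)
  qed
  have trE: "trace E = real (N + M) * trace D' - real N * trace (self_overlap N \<sigma>)"
    by (simp add: E_def trace_def sum_subtractf sum_distrib_left)
  obtain \<tau>0 :: "nat \<Rightarrow> real ^ 'k" where \<tau>0: "\<And>a b. (\<Sum>j<m * CARD('k). \<tau>0 j $ a * \<tau>0 j $ b)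
      = E $ a $ b"
    "\<And>j. (norm (\<tau>0 j))\<^sup>2 \<le> trace E / m"
    using psd_spread [OF E m] by blast
  define \<tau> where "\<tau> j = \<tau>0 (j - 1)" for j
  have \<tau>n: "(norm (\<tau> j))\<^sup>2 \<le> q" for j using \<tau>0(2) [of "j - 1"] q unfolding trE \<tau>_def by linarith
  have \<tau>s: "(\<Sum>j=1..M. \<tau> j $ a * \<tau> j $ b) = E $ a $ b" for a b
    unfolding \<tau>0(1) [symmetric] M [symmetric] \<tau>_def
    by (rule sum.reindex_bij_witness [of _ Suc "\<lambda>i. i - 1"]) auto
  obtain \<rho>0 where \<rho>0: "\<And>i. i \<in> {1..N} \<Longrightarrow> \<rho>0 i = \<sigma> i" "\<And>j. j \<in> {1..M} \<Longrightarrow> \<rho>0 (N + j) = \<tau> j \<or> \<rho>0 (N + j)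
      = - \<tau> j"
    "quad_form g N \<sigma> + (\<Sum>j=1..M. g (N + j, N + j) * (norm (\<tau> j))\<^sup>2) \<le> quad_form g (N + M) \<rho>0"
    using greedy_signs [of N \<sigma> M \<tau> g] by blast
  define \<rho> where "\<rho> = restrict \<rho>0 {1..N + M}"
  have \<rho>1: "\<rho> i = \<sigma> i" if "i \<in> {1..N}" for i using that \<rho>0(1) by (simp add: \<rho>_def)
  have \<rho>2: "\<rho> (N + j) = \<tau> j \<or> \<rho> (N + j) = - \<tau> j" if "j \<in> {1..M}" for j using that \<rho>0(2) by
      (simp add: \<rho>_def)
  have "(\<Sum>i=1..N + M. \<rho> i $ a * \<rho> i $ b) = real (N + M) * D' $ a $ b" for a b
  proof -
    have "(\<Sum>i=1..N + M. \<rho> i $ a * \<rho> i $ b) = (\<Sum>i=1..N. \<sigma> i $ a * \<sigma> i $ b)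
        + (\<Sum>j=1..M. \<tau> j $ a * \<tau> j $ b)"
      unfolding sum_upto_add
    proof (intro arg_cong2 [where f = "(+)"] sum.cong refl)
      show "\<rho> i $ a * \<rho> i $ b = \<sigma> i $ a * \<sigma> i $ b" if "i \<in> {1..N}" for i using \<rho>1 [OF that] by simp
      show "\<rho> (N + j) $ a * \<rho> (N + j) $ b = \<tau> j $ a * \<tau> j $ b" if "j \<in> {1..M}" for j
          using \<rho>2 [OF that] by auto
    qed
    also have "(\<Sum>i=1..N. \<sigma> i $ a * \<sigma> i $ b) = real N * self_overlap N \<sigma> $ a $ b"
      using N by (simp add: self_overlap_def)
    finally show ?thesis unfolding \<tau>s by (simp add: E_def)
  qed
  then have "self_overlap (N + M) \<rho> = D'" using N by (simp add: self_overlap_def vec_eq_iff)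
  then have 1: "\<rho> \<in> overlap_configs (N + M) D'" by (simp add: overlap_configs_def configs_def \<rho>_def)
  have "- (q * (\<Sum>j=1..M. \<bar>g (N + j, N + j)\<bar>)) \<le> (\<Sum>j=1..M. g (N + j, N + j) * (norm (\<tau> j))\<^sup>2)"
    unfolding sum_distrib_left sum_negf [symmetric]
  proof (rule sum_mono)
    fix j
    have "\<bar>g (N + j, N + j) * (norm (\<tau> j))\<^sup>2\<bar> \<le> \<bar>g (N + j, N + j)\<bar> * q"
      unfolding abs_mult using \<tau>n [of j] by (intro mult_left_mono) auto
    then show "- (q * \<bar>g (N + j, N + j)\<bar>) \<le> g (N + j, N + j) * (norm (\<tau> j))\<^sup>2" by
        (simp add: mult.commute abs_le_iff)
  qed
  moreover have "quad_form g (N + M) \<rho> = quad_form g (N + M) \<rho>0" by (rule quad_form_cong)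
      (simp add: \<rho>_def)
  ultimately have 2: "quad_form g N \<sigma> - q * (\<Sum>j=1..M. \<bar>g (N + j, N + j)\<bar>) \<le> quad_form g (N + M) \<rho>"
    using \<rho>0(3) by linarith
  have "norm_p2_powr p (N + M) \<rho> = norm_p2_powr p N \<sigma> + (\<Sum>j=1..M. norm (\<tau> j) powr p)"
    unfolding norm_p2_powr_def sum_upto_add
  proof (intro arg_cong2 [where f = "(+)"] sum.cong refl)
    show "norm (\<rho> i) powr p = norm (\<sigma> i) powr p" if "i \<in> {1..N}" for i using \<rho>1 [OF that] by simp
    show "norm (\<rho> (N + j)) powr p = norm (\<tau> j) powr p" if "j \<in> {1..M}" for j using \<rho>2 [OF that]
        by auto
  qed
  also have "(\<Sum>j=1..M. norm (\<tau> j) powr p) \<le> (\<Sum>j=1..M. sqrt q powr p)"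
    by (intro sum_mono powr_mono2 real_le_rsqrt \<tau>n) (use p in auto)
  finally have 3: "norm_p2_powr p (N + M) \<rho> \<le> norm_p2_powr p N \<sigma> + real M * sqrt q powr p" by simp
  show ?thesis using 1 2 3 by blast
qed

text \<open>Truncation by the penalty itself; as p > 2, this also bounds the mean squared norm of
  the spins.\<close>

definition trunc_configs :: "real \<Rightarrow> real \<Rightarrow> nat \<Rightarrow> (nat \<Rightarrow> real ^ 'k) set" where
  "trunc_configs p r N = {\<sigma> \<in> configs N. norm_p2_powr p N \<sigma> \<le> r * real N}"

lemma zero_config:
  assumes "r \<ge> 0" shows "(\<lambda>i\<in>{1..N}. 0) \<in> trunc_configs p r N"
  using assms by (simp add: trunc_configs_def configs_def norm_p2_powr_def)

lemma trunc_configs_norm: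
  assumes p: "p > 2"
  shows "\<exists>C\<ge>0. \<forall>r N. \<forall>\<sigma>\<in>trunc_configs p r N. (\<Sum>i=1..N. (norm (\<sigma> i :: real ^ 'k))\<^sup>2) \<le> (r
      + C) * real N"
proof -
  obtain C where C: "C \<ge> 0" "\<And>N (\<sigma> :: nat \<Rightarrow> real ^ 'k). 1 * (\<Sum>i=1..N. (norm (\<sigma> i))\<^sup>2)
      \<le> norm_p2_powr p N \<sigma> + C * real N"
    using square_le_norm_p2 [OF p, of 1] by auto
  have "(\<Sum>i=1..N. (norm (\<sigma> i))\<^sup>2) \<le> (r + C) * real N" if "\<sigma> \<in> trunc_configs p r N" for r N and \<sigma> ::
      "nat \<Rightarrow> real ^ 'k"
    using C(2) [of \<sigma> N] that by (simp add: trunc_configs_def distrib_right)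
  then show ?thesis using C(1) by blast
qed

lemma affine_family_trunc:
  assumes "r \<ge> 0" "R \<ge> 0" "\<And>\<sigma> :: nat \<Rightarrow> real ^ 'k. \<sigma> \<in> trunc_configs p r N
      \<Longrightarrow> (\<Sum>i=1..N. (norm (\<sigma> i))\<^sup>2) \<le> R * real N"
  shows "affine_family (site_pairs N) (trunc_configs p r N :: (nat \<Rightarrow> real ^ 'k) set) (ham_coeff N)
    (\<lambda>\<sigma>. - norm_p2_powr p N \<sigma>) (R * sqrt (real N)) (r * real N)"
  by (rule affine_family_ham [OF _ assms(2,3)]) (use zero_config [OF assms(1)] in \<open>auto simp:
      trunc_configs_def\<close>)

text \<open>Integrates the pointwise inequality 2 |X| s \<le> X^2 + s^2.\<close>

lemma (in prob_space) mean_abs_le_of_square: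
  fixes X :: "'a \<Rightarrow> real"
  assumes "X \<in> borel_measurable M" "integrable M (\<lambda>x. (X x)\<^sup>2)" "expectation (\<lambda>x. (X x)\<^sup>2) \<le> s\<^sup>2"
      "s > 0"
  shows "integrable M (\<lambda>x. \<bar>X x\<bar>)" "expectation (\<lambda>x. \<bar>X x\<bar>) \<le> s"
proof -
  show i: "integrable M (\<lambda>x. \<bar>X x\<bar>)"
    using square_integrable_imp_integrable [OF assms(1,2)] by (rule integrable_abs)
  have "expectation (\<lambda>x. \<bar>X x\<bar>) \<le> expectation (\<lambda>x. ((X x)\<^sup>2 / s + s) / 2)"
  proof (rule integral_mono [OF i])
    show "integrable M (\<lambda>x. ((X x)\<^sup>2 / s + s) / 2)"
      by (intro integrable_divide Bochner_Integration.integrable_add assms(2) integrable_const)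
    fix x
    have "2 * \<bar>X x\<bar> * s \<le> \<bar>X x\<bar>\<^sup>2 + s\<^sup>2" by (rule sum_squares_bound)
    then show "\<bar>X x\<bar> \<le> ((X x)\<^sup>2 / s + s) / 2"
      using assms(4) by (simp add: field_simps power2_eq_square)
  qed
  also have "\<dots> = (expectation (\<lambda>x. (X x)\<^sup>2) / s + s) / 2"
    unfolding integral_divide_zero Bochner_Integration.integral_add [OF integrable_divide [OF
        assms(2)] integrable_const]
    using prob_space by simp
  also have "\<dots> \<le> (s\<^sup>2 / s + s) / 2"
    using assms(3,4) by (intro divide_right_mono add_right_mono) auto
  finally show "expectation (\<lambda>x. \<bar>X x\<bar>) \<le> s" using assms(4) by (simp add: power2_eq_square)
qed

lemma std_gauss_abs_mean: "(LINT z|std_gauss. \<bar>z\<bar>) \<le> 1"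
  using std_gauss.mean_abs_le_of_square(2) [of "\<lambda>z. z" 1] std_gauss_second_moment by
      (simp add: measurable_std_gauss)

lemma pd_imp_psd: "D \<in> pd_matrices \<Longrightarrow> D \<in> psd_matrices"
  unfolding pd_matrices_def psd_matrices_def
  by (auto intro: less_imp_le) (metis inner_zero_left less_imp_le order_refl)

section \<open>Upper bound for the mean of the truncated maximum\<close>

definition mean_trunc_sup :: "'k::finite itself \<Rightarrow> real \<Rightarrow> real \<Rightarrow> nat \<Rightarrow> real" where
  "mean_trunc_sup _ p r N = integral\<^sup>L (gauss_prod (site_pairs N)) (ham_sup p N (trunc_configs p r N
      :: (nat \<Rightarrow> real ^ 'k) set))"

text \<open>A truncated configuration is extended to a self-overlap D' from the net. Its value is
  then at most the mean for D', plus the deviation from that mean, plus the cost of the new spins.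
  The factor \<open>c\<close> exchanges the normalisation \<open>1 / sqrt N\<close> for
  \<open>1 / sqrt (N + M)\<close>; it multiplies the penalty too, which produces the last term.
  \<open>q\<close> bounds the squared norms of the new spins and \<open>s\<close> the mean absolute
  deviation for one matrix of the net.\<close>

lemma mean_trunc_sup_step:
  fixes \<D> :: "(real ^ 'k ^ 'k) set"
  assumes p: "p > 2" and r: "r \<ge> 0" and R: "R \<ge> 0" and \<epsilon>: "0 < \<epsilon>" "\<epsilon> \<le> 1"
    and S: "\<And>(D :: real ^ 'k ^ 'k) N. D \<in> pd_matrices \<Longrightarrow> N \<ge> CARD('k) \<Longrightarrow> mean_ham_sup p N D
        \<le> S * real N"
    and trR: "\<And>N (\<sigma> :: nat \<Rightarrow> real ^ 'k). \<sigma> \<in> trunc_configs p r N \<Longrightarrow> (\<Sum>i=1..N. (norm (\<sigma> i))\<^sup>2)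
        \<le> R * real N"
    and net: "\<D> \<subseteq> pd_matrices" "finite \<D>"
      "\<And>D. D \<in> psd_matrices \<Longrightarrow> trace D \<le> R \<Longrightarrow>
         \<exists>D'\<in>\<D>. (\<forall>x. x \<bullet> (D *v x) \<le> x \<bullet> (D' *v x)) \<and> trace D' \<le> trace D + \<epsilon>"
    and N: "N \<ge> CARD('k)" and m: "\<epsilon> * real N \<le> real m" and M: "M = m * CARD('k)"
    and T: "\<And>D. D \<in> \<D> \<Longrightarrow> trace D \<le> T" "T \<ge> 0"
  defines "q \<equiv> real CARD('k) * (R + 1) + 1" and "c \<equiv> sqrt (real (N + M) / real N)"
    and "s \<equiv> sqrt (gauss_var_const + 1) * (T + 1) * sqrt (real (N + M) * sqrt (real (N + M)))"
  shows "mean_trunc_sup TYPE('k) p r N \<le> c * (S * real (N + M) + real (card \<D>) * s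
      + real M * sqrt q powr p
      + q / sqrt (real (N + M)) * real M) + (c - 1) * (r * real N)"
proof -
  have "CARD('k) > 0" by simp
  with N have N0: "N > 0" by linarith
  have m0: "m > 0" using m \<epsilon> N0 by (metis mult_pos_pos not_gr_zero not_le of_nat_0
      of_nat_0_less_iff)
  let ?N = "N + M"
  have N'0: "real ?N > 0" "real N > 0" using N0 by simp_all
  have N'k: "?N \<ge> CARD('k)" using N by simp
  have p0: "p > 0" using p by simp
  have q0: "q \<ge> 0" using R by (simp add: q_def)
  have c1: "c \<ge> 1" using N'0 by (simp add: c_def)
  have cN: "1 / sqrt (real N) = c / sqrt (real ?N)" using N'0 by (simp add: c_def real_sqrt_divide)
  let ?G = "gauss_prod (site_pairs ?N)"
  let ?T = "trunc_configs p r N :: (nat \<Rightarrow> real ^ 'k) set"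
  interpret P: prob_space ?G by (rule prob_space_gauss_prod)
  interpret T: affine_family "site_pairs N" ?T "ham_coeff N" "\<lambda>\<sigma>. - norm_p2_powr p N \<sigma>"
      "R * sqrt (real N)" "r * real N"
    by (rule affine_family_trunc [OF r R trR])
  have psd: "D \<in> psd_matrices" if "D \<in> \<D>" for D using that net(1) pd_imp_psd by auto
  have fam: "affine_family (site_pairs ?N) (overlap_configs ?N D) (ham_coeff ?N) (\<lambda>\<sigma>.
      - norm_p2_powr p ?N \<sigma>)
     (trace D * sqrt (real ?N)) (real ?N * sqrt (trace D * real ?N) powr p)" if "D \<in> \<D>" for D
    by (rule affine_family_overlap [OF p0 psd [OF that] overlap_configs_nonempty [OF psd [OF that]
        N'k]])
  define dev where "dev D g = ham_sup p ?N (overlap_configs ?N D) g - mean_ham_sup p ?N D" for D ::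
      "real ^ 'k ^ 'k" and g
  have s0: "s > 0" unfolding s_def using gauss_var_const_nonneg T(2) N'0 by
      (intro mult_pos_pos) auto
  have dev_mean: "integrable ?G (\<lambda>g. \<bar>dev D g\<bar>)" "(LINT g|?G. \<bar>dev D g\<bar>) \<le> s" if D: "D \<in> \<D>" for D
  proof -
    interpret X: affine_family "site_pairs ?N" "overlap_configs ?N D" "ham_coeff ?N" "\<lambda>\<sigma>.
        - norm_p2_powr p ?N \<sigma>"
      "trace D * sqrt (real ?N)" "real ?N * sqrt (trace D * real ?N) powr p" by (rule fam [OF D])
    have m1: "dev D \<in> borel_measurable ?G"
      unfolding dev_def ham_sup_def by (intro borel_measurable_diff X.affine_sup_measurable
          borel_measurable_const)
    have i2: "integrable ?G (\<lambda>g. (dev D g)\<^sup>2)"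
      unfolding dev_def ham_sup_def power2_diff mult.assoc
      by (intro Bochner_Integration.integrable_diff Bochner_Integration.integrable_add
          integrable_mult_right
          integrable_mult_left X.affine_sup_square_integrable X.affine_sup_integrable
              P.integrable_const)
    have "(LINT g|?G. (dev D g)\<^sup>2) \<le> gauss_var_const * (trace D * sqrt (real ?N))\<^sup>2 * sqrt (real
        ?N)"
      unfolding dev_def ham_sup_def mean_ham_sup_def using N0 by
          (intro site_pairs_variance [OF fam [OF D]]) simp
    also have "\<dots> \<le> (gauss_var_const + 1) * ((T + 1) * sqrt (real ?N))\<^sup>2 * sqrt (real ?N)"
      using T(1) [OF D] T(2) psd_trace_nonneg [OF psd [OF D]] gauss_var_const_nonneg
      by (intro mult_right_mono mult_mono power_mono) auto
    also have "\<dots> = s\<^sup>2"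
      unfolding s_def power_mult_distrib using gauss_var_const_nonneg by simp
    finally have E2: "(LINT g|?G. (dev D g)\<^sup>2) \<le> s\<^sup>2" .
    show "integrable ?G (\<lambda>g. \<bar>dev D g\<bar>)" "(LINT g|?G. \<bar>dev D g\<bar>) \<le> s"
      by (rule P.mean_abs_le_of_square [OF m1 i2 E2 s0])+
  qed
  \<comment> \<open>D' depends on the configuration but the net does not, so the sum over the net
    bounds the deviation for whichever D' is selected.\<close>
  define Y where "Y g = (\<Sum>D\<in>\<D>. \<bar>dev D g\<bar>)" for g
  define V where "V g = (\<Sum>j=1..M. \<bar>g (N + j, N + j)\<bar>)" for g :: "nat \<times> nat \<Rightarrow> real"
  have Yi: "integrable ?G Y" "(LINT g|?G. Y g) \<le> real (card \<D>) * s"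
  proof -
    show "integrable ?G Y" unfolding Y_def by (rule Bochner_Integration.integrable_sum [OF
        dev_mean(1)])
    have "(LINT g|?G. Y g) = (\<Sum>D\<in>\<D>. LINT g|?G. \<bar>dev D g\<bar>)"
      unfolding Y_def by (rule Bochner_Integration.integral_sum [OF dev_mean(1)])
    also have "\<dots> \<le> (\<Sum>D\<in>\<D>. s)" by (rule sum_mono) (rule dev_mean(2))
    finally show "(LINT g|?G. Y g) \<le> real (card \<D>) * s" by simp
  qed
  have Vi: "integrable ?G V" "(LINT g|?G. V g) \<le> real M"
  proof -
    have j: "(N + j, N + j) \<in> site_pairs ?N" if "j \<in> {1..M}" for j using that by
        (simp add: site_pairs_def)
    show "integrable ?G V" unfolding V_def
      by (intro Bochner_Integration.integrable_sum gauss_prod_integrable_component(2) j)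
    have "(LINT g|?G. V g) = (\<Sum>j=1..M. LINT g|?G. \<bar>g (N + j, N + j)\<bar>)"
      unfolding V_def by (intro Bochner_Integration.integral_sum gauss_prod_integrable_component(2)
          j)
    also have "\<dots> \<le> (\<Sum>j=1..M. 1)"
    proof (rule sum_mono)
      fix l assume "l \<in> {1..M}"
      show "(LINT g|?G. \<bar>g (N + l, N + l)\<bar>) \<le> 1"
        using gauss_prod_component(1) [OF j [OF \<open>l \<in> {1..M}\<close>], of "\<lambda>z. \<bar>z\<bar>"] std_gauss_abs_mean
            by simp
    qed
    finally show "(LINT g|?G. V g) \<le> real M" by simp
  qed
  let ?b = "\<lambda>g. c * (S * real ?N + Y g + real M * sqrt q powr p + q / sqrt (real ?N) * V g) + (c
      - 1) * (r * real N)"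
  let ?f = "\<lambda>g. ham_sup p N ?T (\<lambda>k\<in>site_pairs N. g k)"
  have point: "?f g \<le> ?b g" for g
    unfolding ham_sup_def
  proof (rule T.affine_sup_least)
    fix \<sigma> assume \<sigma>: "\<sigma> \<in> ?T"
    let ?D = "self_overlap N \<sigma>"
    have trD: "trace ?D \<le> R" unfolding trace_self_overlap using trR [OF \<sigma>] N0 by
        (simp add: pos_divide_le_eq)
    obtain D' where D': "D' \<in> \<D>" "\<And>x. x \<bullet> (?D *v x) \<le> x \<bullet> (D' *v x)" "trace D' \<le> trace ?D + \<epsilon>"
      using net(3) [OF self_overlap_psd trD] by blast
    \<comment> \<open>The M new sites account for M (R + 1), which is kappa (R + 1) after division
      by m. Raising the trace by \<open>\<epsilon>\<close> on the N old sites costs at most m, which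
      gives the summand 1 of \<open>q\<close>.\<close>
    have "(real ?N * trace D' - real N * trace ?D) / real m \<le> q"
    proof -
      have "real ?N * trace D' - real N * trace ?D = real M * trace D' + real N * (trace D'
          - trace ?D)"
        by (simp add: algebra_simps)
      also have "\<dots> \<le> real M * (R + 1) + real N * \<epsilon>"
        using D'(3) trD \<epsilon> by (intro add_mono mult_left_mono) auto
      also have "\<dots> \<le> real M * (R + 1) + real m" using m by (simp add: mult.commute)
      also have "\<dots> = q * real m" by (simp add: q_def M algebra_simps)
      finally show ?thesis using m0 by (simp add: pos_divide_le_eq)
    qed
    from extend_config [OF p0 N0 m0 M psd [OF D'(1)] D'(2) this, of g]
    obtain \<rho> where \<rho>: "\<rho> \<in> overlap_configs ?N D'" "quad_form g N \<sigma> - q * V g \<le> quad_form g ?N \<rho>"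
      "norm_p2_powr p ?N \<rho> \<le> norm_p2_powr p N \<sigma> + real M * sqrt q powr p" unfolding V_def by blast
    interpret X: affine_family "site_pairs ?N" "overlap_configs ?N D'" "ham_coeff ?N" "\<lambda>\<sigma>.
        - norm_p2_powr p ?N \<sigma>"
      "trace D' * sqrt (real ?N)" "real ?N * sqrt (trace D' * real ?N) powr p"
          by (rule fam [OF D'(1)])
    have "quad_form g ?N \<rho> / sqrt (real ?N) - norm_p2_powr p ?N \<rho>
        \<le> ham_sup p ?N (overlap_configs ?N D') g"
      using X.affine_sup_upper [OF \<rho>(1), of g] N'0 unfolding quad_form_eq ham_sup_def by simp
    also have "\<dots> \<le> mean_ham_sup p ?N D' + \<bar>dev D' g\<bar>" unfolding dev_def by simp
    also have "mean_ham_sup p ?N D' \<le> S * real ?N" using D'(1) net(1) by (intro S N'k) auto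
    also have "\<bar>dev D' g\<bar> \<le> Y g" unfolding Y_def using net(2) D'(1) by (intro member_le_sum) auto
    finally have up: "quad_form g ?N \<rho> / sqrt (real ?N) - norm_p2_powr p ?N \<rho> \<le> S * real ?N + Y g"
        by simp
    have "quad_form g N \<sigma> / sqrt (real ?N) \<le> (quad_form g ?N \<rho> + q * V g) / sqrt (real ?N)"
      using \<rho>(2) by (intro divide_right_mono) auto
    also have "\<dots> = quad_form g ?N \<rho> / sqrt (real ?N) + q / sqrt (real ?N) * V g"
      by (simp add: add_divide_distrib)
    finally have "quad_form g N \<sigma> / sqrt (real ?N)
        \<le> S * real ?N + Y g + (norm_p2_powr p N \<sigma> + real M * sqrt q powr p)
            + q / sqrt (real ?N) * V g"
      using up \<rho>(3) by linarith
    then have "c * (quad_form g N \<sigma> / sqrt (real ?N))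
        \<le> c * (S * real ?N + Y g + (norm_p2_powr p N \<sigma> + real M * sqrt q powr p)
            + q / sqrt (real ?N) * V g)"
      using c1 by (intro mult_left_mono) auto
    moreover have "c * (quad_form g N \<sigma> / sqrt (real ?N))
        = (\<Sum>k\<in>site_pairs N. ham_coeff N \<sigma> k * g k)"
    proof -
      have "c * (quad_form g N \<sigma> / sqrt (real ?N)) = quad_form g N \<sigma> * (c / sqrt (real ?N))" by simp
      also have "\<dots> = (\<Sum>k\<in>site_pairs N. ham_coeff N \<sigma> k * g k)"
        unfolding cN [symmetric] quad_form_eq using N'0 by simp
      finally show ?thesis .
    qed
    moreover have "(c - 1) * norm_p2_powr p N \<sigma> \<le> (c - 1) * (r * real N)"
      using c1 \<sigma> by (intro mult_left_mono) (auto simp: trunc_configs_def)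
    moreover have "c * (S * real ?N + Y g + (norm_p2_powr p N \<sigma> + real M * sqrt q powr p)
        + q / sqrt (real ?N) * V g)
       = c * (S * real ?N + Y g + real M * sqrt q powr p + q / sqrt (real ?N) * V g) + (c
           - 1) * norm_p2_powr p N \<sigma> + norm_p2_powr p N \<sigma>"
      by (simp add: algebra_simps)
    moreover have "(\<Sum>k\<in>site_pairs N. ham_coeff N \<sigma> k * restrict g (site_pairs N) k)
        = (\<Sum>k\<in>site_pairs N. ham_coeff N \<sigma> k * g k)"
      by (rule sum.cong) auto
    ultimately show "(\<Sum>k\<in>site_pairs N. ham_coeff N \<sigma> k * restrict g (site_pairs N) k) +
        - norm_p2_powr p N \<sigma> \<le> ?b g"
      by linarith
  qed
  have i: "inj_on (\<lambda>k. k) (site_pairs N)" "(\<lambda>k. k) \<in> site_pairs N \<rightarrow> site_pairs ?N" by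
      (auto simp: site_pairs_def)
  have fi: "integrable ?G ?f" "(LINT g|?G. ?f g) = mean_trunc_sup TYPE('k) p r N"
    using gauss_prod_reindex(1,2) [OF i T.affine_sup_measurable] T.affine_sup_integrable
    by (simp_all add: mean_trunc_sup_def ham_sup_def)
  have j1: "integrable ?G (\<lambda>g. S * real ?N + Y g)" "integrable ?G (\<lambda>g. S * real ?N + Y g
      + real M * sqrt q powr p)"
    "integrable ?G (\<lambda>g. q / sqrt (real ?N) * V g)"
    by (intro Bochner_Integration.integrable_add integrable_mult_right P.integrable_const Yi Vi)+
  have j2: "integrable ?G (\<lambda>g. c * (S * real ?N + Y g + real M * sqrt q powr p
      + q / sqrt (real ?N) * V g))"
    by (rule integrable_mult_right [OF Bochner_Integration.integrable_add [OF j1(2,3)]])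
  have "mean_trunc_sup TYPE('k) p r N \<le> (LINT g|?G. ?b g)"
    unfolding fi(2) [symmetric]
    by (rule integral_mono [OF fi(1) Bochner_Integration.integrable_add [OF j2 P.integrable_const]
        point])
  also have "\<dots> = c * (S * real ?N + (LINT g|?G. Y g) + real M * sqrt q powr p
      + q / sqrt (real ?N) * (LINT g|?G. V g)) + (c - 1) * (r * real N)"
    unfolding Bochner_Integration.integral_add [OF j2 P.integrable_const] integral_mult_right_zero
      Bochner_Integration.integral_add [OF j1(2,3)] Bochner_Integration.integral_add [OF j1(1)
          P.integrable_const]
      Bochner_Integration.integral_add [OF P.integrable_const Yi(1)]
    using P.prob_space by simp
  also have "\<dots> \<le> c * (S * real ?N + real (card \<D>) * s + real M * sqrt q powr p
      + q / sqrt (real ?N) * real M) + (c - 1) * (r * real N)"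
    using c1 q0 by (intro add_right_mono mult_left_mono add_mono order_refl Yi(2) Vi(2)) auto
  finally show ?thesis .
qed

text \<open>The costs proportional to the number of new spins, at most e N, are held below
  \<open>\<eta>\<close> / 2 per site by a small e. The deviations have order N^(3/4) and the
  diagonal terms order N^(1/2), so both vanish after division by N, the net being fixed.\<close>

lemma mean_trunc_sup_upper:
  assumes p: "p > 2" and r: "r \<ge> 0" and \<eta>: "\<eta> > 0"
    and S: "\<And>(D :: real ^ 'k ^ 'k) N. D \<in> pd_matrices \<Longrightarrow> N \<ge> CARD('k) \<Longrightarrow> mean_ham_sup p N D
        \<le> S * real N"
  shows "eventually (\<lambda>N. mean_trunc_sup TYPE('k) p r N / real N \<le> S + \<eta>) sequentially"
proof -
  obtain C where C: "C \<ge> 0" "\<And>r N (\<sigma> :: nat \<Rightarrow> real ^ 'k). \<sigma> \<in> trunc_configs p r N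
      \<Longrightarrow> (\<Sum>i=1..N. (norm (\<sigma> i))\<^sup>2) \<le> (r + C) * real N"
    using trunc_configs_norm [OF p, where 'k = 'k] by blast
  define R where "R = r + C"
  have R: "R \<ge> 0" using r C by (simp add: R_def)
  have trR: "(\<Sum>i=1..N. (norm (\<sigma> i))\<^sup>2) \<le> R * real N" if "\<sigma> \<in> trunc_configs p r N" for N and \<sigma> ::
      "nat \<Rightarrow> real ^ 'k"
    unfolding R_def by (rule C(2) [OF that])
  have k0: "real CARD('k) > 0" by simp
  define q where "q = real CARD('k) * (R + 1) + 1"
  \<comment> \<open>\<open>W\<close> collects the coefficients of \<open>e\<close> in the final
    estimate, and \<open>e\<close> is chosen with \<open>e * W \<le> \<eta> / 2\<close>. The
    definition of \<open>\<epsilon>\<close> gives M \<le> \<open>e * N\<close>, its factor 2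
    absorbing the rounding up of \<open>\<epsilon> * N\<close>; the cap on \<open>e\<close> by twice
    kappa ensures \<open>\<epsilon> \<le> 1\<close>.\<close>
  define W where "W = 3 * \<bar>S\<bar> + 2 * sqrt q powr p + r"
  have W: "W \<ge> 0" using r by (simp add: W_def)
  define e where "e = min (min 1 (2 * real CARD('k))) (\<eta> / (2 * (W + 1)))"
  define \<epsilon> where "\<epsilon> = e / (2 * real CARD('k))"
  have e: "e > 0" "e \<le> 1" "e * W \<le> \<eta> / 2" "e \<le> 2 * real CARD('k)"
  proof -
    show e0: "e > 0" "e \<le> 1" using \<eta> W k0 by (auto simp: e_def)
    show "e \<le> 2 * real CARD('k)" unfolding e_def by linarith
    have "e \<le> \<eta> / (2 * (W + 1))" by (simp add: e_def)
    then have "e * (W + 1) \<le> \<eta> / (2 * (W + 1)) * (W + 1)" using W by (intro mult_right_mono) auto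
    also have "\<dots> = \<eta> / 2" using W by (simp add: field_simps)
    finally show "e * W \<le> \<eta> / 2" using e0 by (simp add: distrib_left)
  qed
  have \<epsilon>: "\<epsilon> > 0" "\<epsilon> \<le> 1" using e k0 by (auto simp: \<epsilon>_def)
  obtain \<D> :: "(real ^ 'k ^ 'k) set" where net: "\<D> \<subseteq> pd_matrices" "finite \<D>"
      "\<And>D. D \<in> psd_matrices \<Longrightarrow> trace D \<le> R \<Longrightarrow>
         \<exists>D'\<in>\<D>. (\<forall>x. x \<bullet> (D *v x) \<le> x \<bullet> (D' *v x)) \<and> trace D' \<le> trace D + \<epsilon>"
    using overlap_net [OF \<epsilon>(1), of R] by blast
  define T where "T = (\<Sum>D\<in>\<D>. trace D)"
  have tr0: "trace D \<ge> 0" if "D \<in> \<D>" for D using that net(1) by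
      (intro psd_trace_nonneg pd_imp_psd) auto
  have T: "trace D \<le> T" if "D \<in> \<D>" for D
    unfolding T_def using that net(2) tr0 by (intro member_le_sum) auto
  have T0: "T \<ge> 0" unfolding T_def by (rule sum_nonneg) (rule tr0)
  define K0 where "K0 = sqrt (gauss_var_const + 1) * (T + 1)"
  have K0: "K0 \<ge> 0" unfolding K0_def using gauss_var_const_nonneg T0 by simp
  let ?err = "\<lambda>N::nat. 2 * (real (card \<D>) * (K0 * (2 * (sqrt (real N * sqrt (real N)) / real N)))
      + q * (1 / sqrt (real N)))"
  have "?err \<longlonglongrightarrow> 2 * (real (card \<D>) * (K0 * (2 * 0)) + q * 0)"
    by (intro tendsto_mult tendsto_add tendsto_const; real_asymp)
  then have "eventually (\<lambda>N. ?err N < \<eta> / 2) sequentially"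
    using \<eta> by (intro order_tendstoD(2)) auto
  moreover have "eventually (\<lambda>N. N \<ge> CARD('k)) sequentially" by (rule eventually_ge_at_top)
  moreover have "eventually (\<lambda>N. 1 \<le> \<epsilon> * real N) sequentially" using \<epsilon>(1) by real_asymp
  ultimately show ?thesis
  proof eventually_elim
    case (elim N)
    define m where "m = nat \<lceil>\<epsilon> * real N\<rceil>"
    define M where "M = m * CARD('k)"
    have N0: "real N > 0" using elim(3) \<epsilon> by (cases "N = 0") auto
    have m1: "\<epsilon> * real N \<le> real m" unfolding m_def using elim(3) by linarith
    have m2: "real m \<le> 2 * \<epsilon> * real N" unfolding m_def using elim(3) by linarith
    have M2: "real M \<le> e * real N"
    proof -
      have "real M \<le> (2 * \<epsilon> * real N) * real CARD('k)"
        unfolding M_def of_nat_mult by (rule mult_right_mono [OF m2]) simp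
      also have "\<dots> = e * real N" using k0 by (simp add: \<epsilon>_def)
      finally show ?thesis .
    qed
    let ?N = "real (N + M)"
    let ?c = "sqrt (?N / real N)"
    let ?s = "sqrt (gauss_var_const + 1) * (T + 1) * sqrt (?N * sqrt ?N)"
    have N': "?N \<le> (1 + e) * real N" "real N \<le> ?N" "?N > 0" using M2 N0 by
        (simp_all add: distrib_right)
    have ratio: "1 \<le> ?N / real N" "?N / real N \<le> 1 + e" using N' N0 by
        (simp_all add: pos_divide_le_eq pos_le_divide_eq)
    have c: "1 \<le> ?c" "?c \<le> 1 + e"
    proof -
      show "1 \<le> ?c" using ratio(1) by simp
      have "1 + e \<le> (1 + e)\<^sup>2" using e by (simp add: power2_sum)
      then have "?N / real N \<le> (1 + e)\<^sup>2" using ratio(2) by linarith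
      then show "?c \<le> 1 + e" using e by (intro real_le_lsqrt) auto
    qed
    have step: "mean_trunc_sup TYPE('k) p r N \<le> ?c * (S * ?N + real (card \<D>) * ?s
        + real M * sqrt q powr p
      + q / sqrt ?N * real M) + (?c - 1) * (r * real N)"
      unfolding q_def
      by (rule mean_trunc_sup_step [OF p r R \<epsilon> S trR net elim(2) m1 M_def T T0])
    have a: "?c * (S * ?N) / real N \<le> S + \<bar>S\<bar> * (3 * e)"
    proof -
      have x: "1 \<le> ?c * (?N / real N)" "?c * (?N / real N) \<le> 1 + 3 * e"
      proof -
        show "1 \<le> ?c * (?N / real N)" using mult_mono [OF c(1) ratio(1)] by simp
        have "?c * (?N / real N) \<le> (1 + e) * (1 + e)" using c ratio e by (intro mult_mono) auto
        also have "\<dots> \<le> 1 + 3 * e" using e mult_left_mono [of e 1 e] by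
            (simp add: distrib_left distrib_right)
        finally show "?c * (?N / real N) \<le> 1 + 3 * e" .
      qed
      have "S * (?c * (?N / real N) - 1) \<le> \<bar>S\<bar> * (3 * e)" using x by (intro mult_mono) auto
      moreover have "?c * (S * ?N) / real N = S * (?c * (?N / real N) - 1) + S" by
          (simp add: algebra_simps)
      ultimately show ?thesis by linarith
    qed
    have b: "?s \<le> K0 * (2 * sqrt (real N * sqrt (real N)))"
    proof -
      have "(1 + e) * real N \<le> 2 * real N" by (rule mult_right_mono) (use e in auto)
      then have "?N \<le> 2 * real N" using N'(1) by linarith
      then have "?N * sqrt ?N \<le> (2 * real N) * sqrt (4 * real N)"
        using N' N0 by (intro mult_mono) auto
      also have "\<dots> = 2\<^sup>2 * (real N * sqrt (real N))" by (simp add: real_sqrt_mult)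
      finally have "sqrt (?N * sqrt ?N) \<le> sqrt (2\<^sup>2 * (real N * sqrt (real N)))"
          by (rule real_sqrt_le_mono)
      also have "\<dots> = 2 * sqrt (real N * sqrt (real N))" by (simp add: real_sqrt_mult)
      finally show ?thesis unfolding K0_def [symmetric] using K0 by (rule mult_left_mono)
    qed
    have q0: "q \<ge> 0" using R by (simp add: q_def)
    have "?c * (real (card \<D>) * ?s + real M * sqrt q powr p + q / sqrt ?N * real M)
       \<le> 2 * (real (card \<D>) * (K0 * (2 * sqrt (real N * sqrt (real N))))
           + (e * real N) * sqrt q powr p + q / sqrt (real N) * real N)"
    proof (rule mult_mono)
      show "?c \<le> 2" using c e by linarith
      have "real M \<le> real N"
        using M2 mult_right_mono [of e 1 "real N"] e N0 by linarith
      moreover have "q / sqrt ?N \<le> q / sqrt (real N)" using q0 N' N0 by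
          (intro divide_left_mono) auto
      ultimately have "q / sqrt ?N * real M \<le> q / sqrt (real N) * real N"
        using q0 by (intro mult_mono) auto
      moreover have "real (card \<D>) * ?s \<le> real (card \<D>) * (K0 * (2 * sqrt (real N * sqrt (real
          N))))"
        by (rule mult_left_mono [OF b]) simp
      moreover have "real M * sqrt q powr p \<le> (e * real N) * sqrt q powr p"
        by (rule mult_right_mono [OF M2]) simp
      ultimately show "real (card \<D>) * ?s + real M * sqrt q powr p + q / sqrt ?N * real M
        \<le> real (card \<D>) * (K0 * (2 * sqrt (real N * sqrt (real N)))) + (e * real N) * sqrt q powr p
            + q / sqrt (real N) * real N"
        by linarith
      show "0 \<le> real (card \<D>) * ?s + real M * sqrt q powr p + q / sqrt ?N * real M"
        using q0 T0 gauss_var_const_nonneg by (intro add_nonneg_nonneg mult_nonneg_nonneg) auto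
    qed simp
    then have "?c * (real (card \<D>) * ?s + real M * sqrt q powr p + q / sqrt ?N * real M) / real N
       \<le> 2 * (real (card \<D>) * (K0 * (2 * sqrt (real N * sqrt (real N))))
           + (e * real N) * sqrt q powr p + q / sqrt (real N) * real N) / real N"
      using N0 by (intro divide_right_mono) auto
    also have "\<dots> = ?err N + 2 * e * sqrt q powr p"
      using N0 by (simp add: add_divide_distrib distrib_left)
    finally have d: "?c * (real (card \<D>) * ?s + real M * sqrt q powr p
        + q / sqrt ?N * real M) / real N \<le> ?err N + 2 * e * sqrt q powr p" .
    have f: "(?c - 1) * (r * real N) / real N \<le> e * r"
    proof -
      have "(?c - 1) * (r * real N) / real N = (?c - 1) * r" using N0 by simp
      also have "\<dots> \<le> e * r" using c r by (intro mult_right_mono) linarith+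
      finally show ?thesis .
    qed
    have "mean_trunc_sup TYPE('k) p r N / real N \<le> (?c * (S * ?N + real (card \<D>) * ?s
        + real M * sqrt q powr p
      + q / sqrt ?N * real M) + (?c - 1) * (r * real N)) / real N"
      using step N0 by (intro divide_right_mono) auto
    also have "\<dots> = ?c * (S * ?N) / real N + ?c * (real (card \<D>) * ?s + real M * sqrt q powr p
        + q / sqrt ?N * real M) / real N
        + (?c - 1) * (r * real N) / real N"
      by (simp only: add.assoc distrib_left add_divide_distrib)
    also have "\<dots> \<le> S + \<bar>S\<bar> * (3 * e) + (?err N + 2 * e * sqrt q powr p) + e * r"
      by (intro add_mono a d f)
    also have "\<dots> = S + e * W + ?err N" by (simp add: W_def algebra_simps)
    finally show ?case using e(3) elim(1) by linarith
  qed
qed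

section \<open>Scaling and truncation\<close>

definition scale_config :: "nat \<Rightarrow> real \<Rightarrow> (nat \<Rightarrow> real ^ 'k) \<Rightarrow> nat \<Rightarrow> real ^ 'k" where
  "scale_config N l \<sigma> = (\<lambda>i\<in>{1..N}. l *\<^sub>R \<sigma> i)"

lemma scale_config_scale:
  assumes "\<sigma> \<in> configs N" "l \<noteq> 0"
  shows "scale_config N l (scale_config N (1 / l) \<sigma>) = \<sigma>"
  using assms by (auto simp: scale_config_def configs_def PiE_def extensional_def fun_eq_iff)

lemma scale_config_configs: "l \<noteq> 0 \<Longrightarrow> scale_config N l ` configs N
    = (configs N :: (nat \<Rightarrow> real ^ 'k) set)"
proof (intro equalityI subsetI)
  fix \<sigma> :: "nat \<Rightarrow> real ^ 'k" assume l: "l \<noteq> 0" and \<sigma>: "\<sigma> \<in> configs N"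
  have "scale_config N (1 / l) \<sigma> \<in> configs N" by (simp add: configs_def scale_config_def)
  then show "\<sigma> \<in> scale_config N l ` configs N"
    using scale_config_scale [OF \<sigma> l] by (intro image_eqI) auto
qed (auto simp: configs_def scale_config_def)

lemma self_overlap_scale: "self_overlap N (scale_config N l \<sigma>) = l\<^sup>2 *\<^sub>R self_overlap N \<sigma>"
proof -
  have "(\<Sum>i=1..N. scale_config N l \<sigma> i $ a * scale_config N l \<sigma> i $ b)
      = l\<^sup>2 * (\<Sum>i=1..N. \<sigma> i $ a * \<sigma> i $ b)" for a b
    unfolding sum_distrib_left by (rule sum.cong) (auto simp: scale_config_def power2_eq_square
        mult_ac)
  then show ?thesis by (simp add: self_overlap_def vec_eq_iff)
qed

lemma scale_config_overlap:
  assumes l: "l \<noteq> 0"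
  shows "scale_config N l ` overlap_configs N D = overlap_configs N (l\<^sup>2 *\<^sub>R D)"
proof (intro equalityI subsetI)
  fix \<sigma> assume \<sigma>: "\<sigma> \<in> overlap_configs N (l\<^sup>2 *\<^sub>R D)"
  have "scale_config N (1 / l) \<sigma> \<in> overlap_configs N D"
    using \<sigma> l by (auto simp: overlap_configs_def self_overlap_scale power_divide)
        (simp add: configs_def scale_config_def)
  then show "\<sigma> \<in> scale_config N l ` overlap_configs N D"
    using scale_config_scale [of \<sigma> N l] \<sigma> l by (intro image_eqI [of _ _ "scale_config N (1 / l) \<sigma>"])
        (auto simp: overlap_configs_def)
qed (auto simp: overlap_configs_def self_overlap_scale, simp add: configs_def scale_config_def)

text \<open>With \<open>t l\<^sup>p = l\<^sup>2\<close> both terms of the penalised Hamiltonian scale alike, which reduces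
    everything to \<open>t = 1\<close>.\<close>

lemma pen_hamiltonian_scale:
  assumes l: "l > 0" "t * l powr p = l\<^sup>2"
  shows "pen_hamiltonian g p t N (scale_config N l \<sigma>) = l\<^sup>2 * pen_hamiltonian g p 1 N \<sigma>"
proof -
  have "hamiltonian g N (scale_config N l \<sigma>) = l\<^sup>2 * hamiltonian g N \<sigma>"
    unfolding hamiltonian_def sum_distrib_left
    by (intro sum.cong refl) (auto simp: scale_config_def power2_eq_square)
  moreover have "norm_p2_powr p N (scale_config N l \<sigma>) = l powr p * norm_p2_powr p N \<sigma>"
    unfolding norm_p2_powr_def sum_distrib_left
    by (intro sum.cong refl) (use l in \<open>auto simp: scale_config_def powr_mult\<close>)
  ultimately show ?thesis using l(2) by (simp add: pen_hamiltonian_def right_diff_distrib flip: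
      mult.assoc)
qed

lemma lagrangian_scale:
  assumes p: "p > 2" and l: "l > 0" "t * l powr p = l\<^sup>2" and N: "N \<ge> 1"
  shows "lagrangian TYPE('k::finite) g p N t = l\<^sup>2 * lagrangian TYPE('k) g p N 1"
proof -
  let ?C = "configs N :: (nat \<Rightarrow> real ^ 'k) set"
  obtain \<sigma> where \<sigma>: "\<sigma> \<in> ?C" "\<And>\<tau>. \<tau> \<in> ?C \<Longrightarrow> pen_hamiltonian g p 1 N \<tau> \<le> pen_hamiltonian g p 1 N \<sigma>"
    using lagrangian_attained [OF p zero_less_one N, where 'k = 'k and g = g] by blast
  have "(\<Squnion>\<sigma>\<in>?C. pen_hamiltonian g p t N \<sigma>) = (\<Squnion>\<sigma>\<in>scale_config N l ` ?C. pen_hamiltonian g p t N \<sigma>)"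
    using l by (simp add: scale_config_configs)
  also have "\<dots> = (\<Squnion>\<sigma>\<in>?C. l\<^sup>2 * pen_hamiltonian g p 1 N \<sigma>)"
    by (simp add: image_comp o_def pen_hamiltonian_scale [OF l])
  also have "\<dots> = l\<^sup>2 * (\<Squnion>\<sigma>\<in>?C. pen_hamiltonian g p 1 N \<sigma>)"
    using \<sigma> l by (intro cSUP_mult_left bdd_aboveI2) auto
  finally show ?thesis by (simp add: lagrangian_def)
qed

lemma lagrangian_overlap_scale:
  assumes p: "p > 0" and l: "l > 0" "t * l powr p = l\<^sup>2" and N: "N \<ge> 1" and ne:
      "overlap_configs N D \<noteq> {}"
  shows "lagrangian_overlap g p (l\<^sup>2 *\<^sub>R D) N t = l\<^sup>2 * lagrangian_overlap g p D N 1"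
proof -
  obtain \<sigma> where \<sigma>: "\<sigma> \<in> overlap_configs N D"
      "\<And>\<tau>. \<tau> \<in> overlap_configs N D \<Longrightarrow> pen_hamiltonian g p 1 N \<tau> \<le> pen_hamiltonian g p 1 N \<sigma>"
    using lagrangian_overlap_attained [OF p N ne, of g 1] by blast
  have "(\<Squnion>\<sigma>\<in>overlap_configs N (l\<^sup>2 *\<^sub>R D). pen_hamiltonian g p t N \<sigma>)
      = (\<Squnion>\<sigma>\<in>scale_config N l ` overlap_configs N D. pen_hamiltonian g p t N \<sigma>)"
    using l by (simp add: scale_config_overlap)
  also have "\<dots> = (\<Squnion>\<sigma>\<in>overlap_configs N D. l\<^sup>2 * pen_hamiltonian g p 1 N \<sigma>)"
    by (simp add: image_comp o_def pen_hamiltonian_scale [OF l])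
  also have "\<dots> = l\<^sup>2 * (\<Squnion>\<sigma>\<in>overlap_configs N D. pen_hamiltonian g p 1 N \<sigma>)"
    using \<sigma> l by (intro cSUP_mult_left bdd_aboveI2) auto
  finally show ?thesis by (simp add: lagrangian_overlap_def)
qed

lemma lagrangian_upper:
  assumes p: "p > 2" "t > 0" and N: "N \<ge> 1" and \<sigma>: "\<sigma> \<in> (configs N :: (nat \<Rightarrow> real ^ 'k::finite)
      set)"
  shows "pen_hamiltonian g p t N \<sigma> \<le> real N * lagrangian TYPE('k) g p N t"
proof -
  obtain \<tau> :: "nat \<Rightarrow> real ^ 'k" where "\<And>\<rho>. \<rho> \<in> (configs N :: (nat \<Rightarrow> real ^ 'k) set)
      \<Longrightarrow> pen_hamiltonian g p t N \<rho> \<le> pen_hamiltonian g p t N \<tau>"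
      "lagrangian TYPE('k) g p N t = pen_hamiltonian g p t N \<tau> / real N"
    using lagrangian_attained [OF p N, where 'k = 'k and g = g] by blast
  then show ?thesis using \<sigma> N by simp
qed

lemma lagrangian_nonneg:
  assumes p: "p > 2" "t > 0" and N: "N \<ge> 1"
  shows "lagrangian TYPE('k::finite) g p N t \<ge> 0"
proof -
  have "(\<lambda>i\<in>{1..N}. 0) \<in> (configs N :: (nat \<Rightarrow> real ^ 'k) set)" by (simp add: configs_def)
  from lagrangian_upper [OF p N this, of g] have "0 \<le> real N * lagrangian TYPE('k) g p N t"
    by (simp add: pen_hamiltonian_def hamiltonian_def norm_p2_powr_def)
  then show ?thesis using N by (simp add: zero_le_mult_iff)
qed

text \<open>A maximiser on N sites is padded with zeros to N' sites, which multiplies its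
  Hamiltonian by \<open>sqrt x\<close>, where x = N / N'. Rescaling the spins by the l with
  \<open>l\<^sup>2 * sqrt x = l powr p\<close> makes Hamiltonian and penalty shrink by the common
  factor \<open>x powr \<beta>\<close>. The exponent is this \<open>\<beta>\<close> plus 1 for the
  division by N.\<close>

lemma lagrangian_monotone:
  assumes p: "p > 2" and N: "1 \<le> N" "N \<le> N'"
  shows "real N powr (1 + p / (2 * (p - 2))) * lagrangian TYPE('k::finite) g p N 1
    \<le> real N' powr (1 + p / (2 * (p - 2))) * lagrangian TYPE('k) g p N' 1"
proof -
  define x where "x = real N / real N'"
  define l where "l = x powr (1 / (2 * (p - 2)))"
  define \<beta> where "\<beta> = p / (2 * (p - 2))"
  have x: "x > 0" "x \<le> 1" using N by (auto simp: x_def)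
  have l: "l > 0" "l powr p = x powr \<beta>" "l\<^sup>2 = l powr p / sqrt x"
  proof -
    show "l > 0" using x by (simp add: l_def)
    show lp: "l powr p = x powr \<beta>" by (simp add: l_def powr_powr \<beta>_def)
    have "l\<^sup>2 = x powr (1 / (2 * (p - 2)) + 1 / (2 * (p - 2)))"
      unfolding powr_add l_def power2_eq_square ..
    also have "1 / (2 * (p - 2)) + 1 / (2 * (p - 2)) = 1 / (p - 2)" using p by
        (simp add: field_simps)
    finally have "l\<^sup>2 = x powr (1 / (p - 2))" .
    also have "1 / (p - 2) = \<beta> - 1 / 2" using p by (simp add: \<beta>_def field_simps)
    also have "x powr (\<beta> - 1 / 2) = x powr \<beta> / sqrt x" using x by
        (simp add: powr_diff powr_half_sqrt)
    finally show "l\<^sup>2 = l powr p / sqrt x" unfolding lp .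
  qed
  obtain \<sigma> where \<sigma>: "\<sigma> \<in> (configs N :: (nat \<Rightarrow> real ^ 'k) set)"
      "lagrangian TYPE('k) g p N 1 = pen_hamiltonian g p 1 N \<sigma> / real N"
    using lagrangian_attained [OF p _ N(1), of 1, where 'k = 'k and g = g] by auto
  define \<rho> where "\<rho> = (\<lambda>i\<in>{1..N'}. if i \<le> N then l *\<^sub>R \<sigma> i else 0)"
  have in_sub: "{1..N} \<subseteq> {1..N'}" using N by auto
  have H: "(\<Sum>i=1..N'. \<Sum>j=1..N'. g i j * (\<rho> i \<bullet> \<rho> j)) = l\<^sup>2 * (\<Sum>i=1..N. \<Sum>j=1..N. g i j * (\<sigma> i \<bullet> \<sigma>
      j))"
  proof -
    have "(\<Sum>i=1..N'. \<Sum>j=1..N'. g i j * (\<rho> i \<bullet> \<rho> j)) = (\<Sum>i=1..N. \<Sum>j=1..N'. g i j * (\<rho> i \<bullet> \<rho> j))"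
      by (rule sum.mono_neutral_right) (use in_sub in \<open>auto simp: \<rho>_def\<close>)
    also have "\<dots> = (\<Sum>i=1..N. \<Sum>j=1..N. g i j * (\<rho> i \<bullet> \<rho> j))"
      by (rule sum.cong [OF refl], rule sum.mono_neutral_right) (use in_sub in \<open>auto simp: \<rho>_def\<close>)
    also have "\<dots> = (\<Sum>i=1..N. \<Sum>j=1..N. l\<^sup>2 * (g i j * (\<sigma> i \<bullet> \<sigma> j)))"
      by (intro sum.cong refl) (use N in \<open>auto simp: \<rho>_def power2_eq_square\<close>)
    finally show ?thesis by (simp add: sum_distrib_left)
  qed
  have P: "norm_p2_powr p N' \<rho> = l powr p * norm_p2_powr p N \<sigma>"
  proof -
    have "norm_p2_powr p N' \<rho> = (\<Sum>i=1..N. norm (\<rho> i) powr p)" unfolding norm_p2_powr_def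
      by (rule sum.mono_neutral_right) (use in_sub in \<open>auto simp: \<rho>_def\<close>)
    also have "\<dots> = (\<Sum>i=1..N. l powr p * norm (\<sigma> i) powr p)"
      by (intro sum.cong refl) (use N l(1) in \<open>auto simp: \<rho>_def powr_mult\<close>)
    finally show ?thesis by (simp add: norm_p2_powr_def sum_distrib_left)
  qed
  have "hamiltonian g N' \<rho> = l powr p * hamiltonian g N \<sigma>"
  proof -
    have "l\<^sup>2 / sqrt (real N') = l powr p / sqrt (real N)"
      unfolding l(3) x_def using N by (simp add: real_sqrt_divide)
    then have "l\<^sup>2 / sqrt (real N') * (\<Sum>i=1..N. \<Sum>j=1..N. g i j * (\<sigma> i \<bullet> \<sigma> j))
       = l powr p / sqrt (real N) * (\<Sum>i=1..N. \<Sum>j=1..N. g i j * (\<sigma> i \<bullet> \<sigma> j))" by simp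
    then show ?thesis unfolding hamiltonian_def H by simp
  qed
  then have "pen_hamiltonian g p 1 N' \<rho> = x powr \<beta> * pen_hamiltonian g p 1 N \<sigma>"
    unfolding pen_hamiltonian_def P l(2) by (simp add: right_diff_distrib)
  moreover have "\<rho> \<in> configs N'" by (simp add: \<rho>_def configs_def)
  ultimately have "x powr \<beta> * (real N * lagrangian TYPE('k) g p N 1)
      \<le> real N' * lagrangian TYPE('k) g p N' 1"
    using lagrangian_upper [OF p _ _ \<open>\<rho> \<in> configs N'\<close>, of 1 g] \<sigma>(2) N by simp
  then have "real N' powr \<beta> * (x powr \<beta> * (real N * lagrangian TYPE('k) g p N 1))
      \<le> real N' powr \<beta> * (real N' * lagrangian TYPE('k) g p N' 1)"
    by (rule mult_left_mono) simp
  moreover have "real N' powr \<beta> * x powr \<beta> = real N powr \<beta>"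
    using N by (simp add: x_def powr_divide)
  moreover have "real N powr (1 + \<beta>) = real N powr \<beta> * real N" "real N' powr (1 + \<beta>)
      = real N' powr \<beta> * real N'"
    using N by (simp_all add: powr_add)
  ultimately show ?thesis
    unfolding \<beta>_def [symmetric] by (simp only: mult.assoc [symmetric])
qed

text \<open>Monotonicity traps u N between its values at the two neighbouring fourth powers, up to
  powers of the ratio of consecutive fourth powers, which tends to 1.\<close>

lemma convergent_from_fourth_powers:
  fixes u :: "nat \<Rightarrow> real"
  assumes \<alpha>: "\<alpha> \<ge> 0" and nonneg: "\<And>N. N \<ge> 1 \<Longrightarrow> u N \<ge> 0"
    and mono: "\<And>N N'. 1 \<le> N \<Longrightarrow> N \<le> N' \<Longrightarrow> real N powr \<alpha> * u N \<le> real N' powr \<alpha> * u N'"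
    and lim: "(\<lambda>k. u (k ^ 4)) \<longlonglongrightarrow> l"
  shows "u \<longlonglongrightarrow> l"
proof -
  define K where "K N = nat \<lfloor>root 4 (real N)\<rfloor>" for N :: nat
  have K: "K N ^ 4 \<le> N" "N \<le> Suc (K N) ^ 4" for N
  proof -
    have r0: "root 4 (real N) \<ge> 0" by simp
    have rN: "root 4 (real N) ^ 4 = real N" by (rule real_root_pow_pos2) auto
    have "real (K N) \<le> root 4 (real N)" unfolding K_def using r0 by linarith
    then have "real (K N) ^ 4 \<le> root 4 (real N) ^ 4" by (rule power_mono) simp
    then have "real (K N ^ 4) \<le> real N" unfolding rN by simp
    then show "K N ^ 4 \<le> N" unfolding of_nat_le_iff .
    have "root 4 (real N) \<le> real (Suc (K N))" unfolding K_def using r0 by linarith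
    then have "root 4 (real N) ^ 4 \<le> real (Suc (K N)) ^ 4" by (rule power_mono) simp
    then have "real N \<le> real (Suc (K N) ^ 4)" unfolding rN by simp
    then show "N \<le> Suc (K N) ^ 4" unfolding of_nat_le_iff .
  qed
  have K': "real (K N) ^ 4 \<le> real N" "real N \<le> real (Suc (K N)) ^ 4" for N
    using K [of N] unfolding of_nat_power [symmetric] of_nat_le_iff .
  have Kinf: "filterlim K at_top sequentially"
    unfolding K_def by (rule filterlim_compose [OF filterlim_nat_sequentially], rule
        filterlim_compose [OF filterlim_floor_sequentially]) real_asymp
  have K1: "eventually (\<lambda>N. K N \<ge> 1) sequentially"
    using Kinf by (simp add: filterlim_at_top)
  define lo hi where "lo k = (real k ^ 4 / real (Suc k) ^ 4) powr \<alpha> * u (k ^ 4)"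
    and "hi k = (real (Suc k) ^ 4 / real k ^ 4) powr \<alpha> * u (Suc k ^ 4)" for k
  have r1: "(\<lambda>k. real k ^ 4 / real (Suc k) ^ 4) \<longlonglongrightarrow> 1" by real_asymp
  have r2: "(\<lambda>k. real (Suc k) ^ 4 / real k ^ 4) \<longlonglongrightarrow> 1" by real_asymp
  have "lo \<longlonglongrightarrow> 1 powr \<alpha> * l" unfolding lo_def by (intro tendsto_mult tendsto_powr r1 tendsto_const
      lim) simp
  then have lo: "(\<lambda>N. lo (K N)) \<longlonglongrightarrow> l" using filterlim_compose [OF _ Kinf] by simp
  have "hi \<longlonglongrightarrow> 1 powr \<alpha> * l"
    unfolding hi_def by (intro tendsto_mult tendsto_powr r2 tendsto_const LIMSEQ_Suc [OF lim]) simp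
  then have hi: "(\<lambda>N. hi (K N)) \<longlonglongrightarrow> l" using filterlim_compose [OF _ Kinf] by simp
  show ?thesis
  proof (rule tendsto_sandwich [OF _ _ lo hi])
    show "eventually (\<lambda>N. lo (K N) \<le> u N) sequentially"
      using K1
    proof eventually_elim
      case (elim N)
      have k: "1 \<le> K N ^ 4" using elim by simp
      then have N: "1 \<le> N" using K(1) [of N] by linarith
      have "(real (K N) ^ 4 / real (Suc (K N)) ^ 4) powr \<alpha> * u (K N ^ 4)
          \<le> (real (K N) ^ 4 / real N) powr \<alpha> * u (K N ^ 4)"
        using K'(2) [of N] \<alpha> N nonneg [OF k]
        by (intro mult_right_mono powr_mono2 divide_left_mono) (simp_all del: of_nat_Suc)
      also have "\<dots> = real (K N ^ 4) powr \<alpha> * u (K N ^ 4) / real N powr \<alpha>"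
        using N by (simp add: powr_divide)
      also have "\<dots> \<le> real N powr \<alpha> * u N / real N powr \<alpha>"
        by (intro divide_right_mono mono k K(1)) simp
      finally show ?case using N by (simp add: lo_def)
    qed
    show "eventually (\<lambda>N. u N \<le> hi (K N)) sequentially"
      using K1
    proof eventually_elim
      case (elim N)
      have k: "1 \<le> K N ^ 4" using elim by simp
      then have N: "1 \<le> N" using K(1) [of N] by linarith
      have k': "1 \<le> Suc (K N) ^ 4" by simp
      have "u N = real N powr \<alpha> * u N / real N powr \<alpha>" using N by simp
      also have "\<dots> \<le> real (Suc (K N) ^ 4) powr \<alpha> * u (Suc (K N) ^ 4) / real N powr \<alpha>"
        by (intro divide_right_mono mono N K(2)) simp
      also have "\<dots> = (real (Suc (K N)) ^ 4 / real N) powr \<alpha> * u (Suc (K N) ^ 4)"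
        using N by (simp add: powr_divide)
      also have "\<dots> \<le> hi (K N)"
        unfolding hi_def using K'(1) [of N] \<alpha> N nonneg [OF k'] elim
        by (intro mult_right_mono powr_mono2 divide_left_mono) (simp_all del: of_nat_Suc power_Suc)
      finally show ?case .
    qed
  qed
qed

text \<open>On this event the Hamiltonian is at most 3 times the squared norm. As 6 = 2 * 3, the
  choice of r makes that at most half of the penalty plus r N, hence less than the penalty as soon
  as the penalty exceeds r N. Configurations outside the truncation are then no better than the zero
  configuration.\<close>

lemma truncation:
  assumes p: "p > 2"
  shows "\<exists>r\<ge>0. \<forall>N\<ge>1. \<forall>g. quad_sup N g \<le> 3 * sqrt (real N) \<longrightarrow>
     real N * lagrangian TYPE('k::finite) (\<lambda>i j. g (i, j)) p N 1
         \<le> ham_sup p N (trunc_configs p r N :: (nat \<Rightarrow> real ^ 'k) set) g"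
proof -
  obtain r where r: "r \<ge> 0" "\<And>N (\<sigma> :: nat \<Rightarrow> real ^ 'k). 6 * (\<Sum>i=1..N. (norm (\<sigma> i))\<^sup>2)
      \<le> norm_p2_powr p N \<sigma> + r * real N"
    using square_le_norm_p2 [OF p, of 6] by auto
  obtain C where C: "C \<ge> 0" "\<And>r N (\<sigma> :: nat \<Rightarrow> real ^ 'k). \<sigma> \<in> trunc_configs p r N
      \<Longrightarrow> (\<Sum>i=1..N. (norm (\<sigma> i))\<^sup>2) \<le> (r + C) * real N"
    using trunc_configs_norm [OF p, where 'k = 'k] by blast
  have "real N * lagrangian TYPE('k) (\<lambda>i j. g (i, j)) p N 1
      \<le> ham_sup p N (trunc_configs p r N :: (nat \<Rightarrow> real ^ 'k) set) g"
    if N: "N \<ge> 1" and q: "quad_sup N g \<le> 3 * sqrt (real N)" for N g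
  proof -
    interpret T: affine_family "site_pairs N" "trunc_configs p r N :: (nat \<Rightarrow> real ^ 'k) set"
        "ham_coeff N"
       "\<lambda>\<sigma>. - norm_p2_powr p N \<sigma>" "(r + C) * sqrt (real N)" "r * real N"
      by (rule affine_family_trunc [OF r(1) _ C(2)]) (use r(1) C(1) in auto)
    obtain \<sigma> where \<sigma>: "\<sigma> \<in> (configs N :: (nat \<Rightarrow> real ^ 'k) set)"
        "lagrangian TYPE('k) (\<lambda>i j. g (i, j)) p N 1 = pen_hamiltonian (\<lambda>i j. g (i, j)) p 1 N \<sigma> /
            real N"
      using lagrangian_attained [OF p _ N, of 1, where 'k = 'k and g = "\<lambda>i j. g (i, j)"] by auto
    have eq: "pen_hamiltonian (\<lambda>i j. g (i, j)) p 1 N \<sigma> = (\<Sum>k\<in>site_pairs N. ham_coeff N \<sigma> k * g k) +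
        - norm_p2_powr p N \<sigma>"
      unfolding pen_hamiltonian_def hamiltonian_eq_affine by simp
    have "pen_hamiltonian (\<lambda>i j. g (i, j)) p 1 N \<sigma> \<le> ham_sup p N (trunc_configs p r N :: (nat \<Rightarrow> real
        ^ 'k) set) g"
    proof (cases "\<sigma> \<in> trunc_configs p r N")
      case True
      then show ?thesis unfolding eq ham_sup_def by (rule T.affine_sup_upper)
    next
      case False
      then have big: "norm_p2_powr p N \<sigma> > r * real N" using \<sigma>(1) by (simp add: trunc_configs_def)
      have "quad_sup N g / sqrt (real N) \<le> 3" using q N by (simp add: pos_divide_le_eq)
      then have "quad_sup N g / sqrt (real N) * (\<Sum>i=1..N. (norm (\<sigma> i))\<^sup>2)
          \<le> 3 * (\<Sum>i=1..N. (norm (\<sigma> i))\<^sup>2)"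
        by (rule mult_right_mono) (intro sum_nonneg, simp)
      then have "pen_hamiltonian (\<lambda>i j. g (i, j)) p 1 N \<sigma> \<le> 0"
        using ham_le_quad_sup [of N \<sigma> g] N r(2) [of \<sigma> N] big unfolding eq by linarith
      also have "0 \<le> ham_sup p N (trunc_configs p r N :: (nat \<Rightarrow> real ^ 'k) set) g"
      proof -
        have "ham_coeff N (\<lambda>i\<in>{1..N}. 0 :: real ^ 'k) k = 0" if "k \<in> site_pairs N" for k
          using that by (auto simp: ham_coeff_def site_pairs_def)
        then show ?thesis
          using T.affine_sup_upper [OF zero_config [OF r(1)], of g] by
              (simp add: ham_sup_def norm_p2_powr_def)
      qed
      finally show ?thesis .
    qed
    then show ?thesis using \<sigma>(2) N by simp
  qed
  then show ?thesis using r(1) by blast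
qed

text \<open>The sum of the squares has finite expectation, so almost surely it is finite and its
  terms tend to 0.\<close>

lemma (in prob_space) AE_tendsto_zero_of_summable:
  fixes Z :: "nat \<Rightarrow> 'a \<Rightarrow> real"
  assumes m: "\<And>k. Z k \<in> borel_measurable M" and i: "\<And>k. integrable M (\<lambda>x. (Z k x)\<^sup>2)"
    and le: "\<And>k. expectation (\<lambda>x. (Z k x)\<^sup>2) \<le> e k" and e: "summable e"
  shows "AE x in M. (\<lambda>k. Z k x) \<longlonglongrightarrow> 0"
proof -
  have "(\<integral>\<^sup>+x. (\<Sum>k. ennreal ((Z k x)\<^sup>2)) \<partial>M) = (\<Sum>k. \<integral>\<^sup>+x. ennreal ((Z k x)\<^sup>2) \<partial>M)"
    by (rule nn_integral_suminf) (intro measurable_compose [OF _ measurable_ennreal]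
        borel_measurable_power m)
  also have "\<dots> = (\<Sum>k. ennreal (expectation (\<lambda>x. (Z k x)\<^sup>2)))"
    by (rule suminf_cong, rule nn_integral_eq_integral [OF i]) simp
  also have "\<dots> \<le> (\<Sum>k. ennreal (e k))"
    by (rule suminf_le) (auto intro: ennreal_leI le)
  also have "\<dots> = ennreal (\<Sum>k. e k)"
    by (rule suminf_ennreal2 [OF _ e]) (rule order_trans [OF _ le], rule integral_nonneg_AE, simp)
  finally have fin: "(\<integral>\<^sup>+x. (\<Sum>k. ennreal ((Z k x)\<^sup>2)) \<partial>M) \<noteq> \<infinity>"
    by (metis ennreal_less_top infinity_ennreal_def leD)
  have "AE x in M. (\<Sum>k. ennreal ((Z k x)\<^sup>2)) \<noteq> \<infinity>"
    by (rule nn_integral_PInf_AE [OF _ fin])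
       (intro borel_measurable_suminf_order measurable_compose [OF _ measurable_ennreal]
           borel_measurable_power m)
  then show ?thesis
  proof (rule AE_mp, intro AE_I2 impI)
    fix x assume "(\<Sum>k. ennreal ((Z k x)\<^sup>2)) \<noteq> \<infinity>"
    then have "summable (\<lambda>k. (Z k x)\<^sup>2)" by (intro summable_suminf_not_top) auto
    then have "(\<lambda>k. (Z k x)\<^sup>2) \<longlonglongrightarrow> 0" by (rule summable_LIMSEQ_zero)
    then have "(\<lambda>k. sqrt ((Z k x)\<^sup>2)) \<longlonglongrightarrow> sqrt 0" by (rule tendsto_real_sqrt)
    then show "(\<lambda>k. Z k x) \<longlonglongrightarrow> 0" by (simp add: tendsto_rabs_zero_iff)
  qed
qed

section \<open>Almost sure convergence\<close>

locale gaussian_array = prob_space M for M :: "'a measure" +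
  fixes g :: "nat \<Rightarrow> nat \<Rightarrow> 'a \<Rightarrow> real"
  assumes indep: "indep_vars (\<lambda>_. borel) (\<lambda>(i, j). g i j) ({1..} \<times> {1..})"
    and gauss: "\<And>i j. 1 \<le> i \<Longrightarrow> 1 \<le> j \<Longrightarrow> distributed M lborel (g i j) std_normal_density"
begin

text \<open>Restricting to \<open>site_pairs N\<close> makes the law of the array, for N \<ge> 1,
  exactly \<open>gauss_prod (site_pairs N)\<close>.\<close>

definition array :: "nat \<Rightarrow> 'a \<Rightarrow> nat \<times> nat \<Rightarrow> real" where
  "array N \<omega> = (\<lambda>k\<in>site_pairs N. g (fst k) (snd k) \<omega>)"

lemma distr_entry:
  assumes "k \<in> site_pairs N"
  shows "(\<lambda>(i, j). g i j) k \<in> borel_measurable M" "distr M borel ((\<lambda>(i, j). g i j) k) = std_gauss"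
proof -
  obtain i j where k: "k = (i, j)" "1 \<le> i" "1 \<le> j" using assms by (auto simp: site_pairs_def)
  show "(\<lambda>(i, j). g i j) k \<in> borel_measurable M"
    using distributed_measurable [OF gauss [OF k(2,3)]]
    unfolding k prod.case measurable_cong_sets [OF refl sets_lborel] .
  have "distr M borel (g i j) = distr M lborel (g i j)" by (rule distr_cong) simp_all
  also have "\<dots> = std_gauss" unfolding std_gauss_def by (rule distributed_distr_eq_density [OF gauss
      [OF k(2,3)]])
  finally show "distr M borel ((\<lambda>(i, j). g i j) k) = std_gauss" unfolding k prod.case .
qed

lemma distr_array:
  assumes N: "N \<ge> 1"
  shows "array N \<in> measurable M (gauss_prod (site_pairs N))"
      "distr M (gauss_prod (site_pairs N)) (array N) = gauss_prod (site_pairs N)"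
proof -
  let ?K = "site_pairs N"
  have ne: "?K \<noteq> {}" using N by (auto simp: site_pairs_def)
  have arr: "array N = (\<lambda>\<omega>. \<lambda>k\<in>?K. (\<lambda>(i, j). g i j) k \<omega>)" by
      (auto simp: array_def fun_eq_iff restrict_def split: prod.splits)
  have "indep_vars (\<lambda>_. borel) (\<lambda>(i, j). g i j) ?K"
    by (rule indep_vars_subset [OF indep]) (auto simp: site_pairs_def)
  then have D: "distr M (PiM ?K (\<lambda>_. borel)) (array N) = PiM ?K (\<lambda>k. distr M borel ((\<lambda>(i, j). g i j)
      k))"
    unfolding arr by (subst (asm) indep_vars_iff_distr_eq_PiM' [OF ne]) (use distr_entry in auto)
  have P: "PiM ?K (\<lambda>k. distr M borel ((\<lambda>(i, j). g i j) k)) = gauss_prod ?K"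
    unfolding gauss_prod_def by (rule PiM_cong) (use distr_entry in auto)
  have s: "sets (PiM ?K (\<lambda>_. borel)) = sets (gauss_prod ?K)"
    unfolding gauss_prod_def by (rule sets_PiM_cong) simp_all
  show "distr M (gauss_prod ?K) (array N) = gauss_prod ?K"
    using D unfolding P by (subst distr_cong [OF refl s [symmetric] refl]) 
  have "array N \<in> measurable M (PiM ?K (\<lambda>_. borel))"
    unfolding arr by (rule measurable_restrict) (rule distr_entry)
  then show "array N \<in> measurable M (gauss_prod ?K)" unfolding measurable_cong_sets [OF refl s] .
qed

lemma array_integral:
  fixes f :: "_ \<Rightarrow> real"
  assumes N: "N \<ge> 1" and f: "f \<in> borel_measurable (gauss_prod (site_pairs N))"
  shows "(\<lambda>\<omega>. f (array N \<omega>)) \<in> borel_measurable M"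
    and "(LINT \<omega>|M. f (array N \<omega>)) = integral\<^sup>L (gauss_prod (site_pairs N)) f"
    and "integrable M (\<lambda>\<omega>. f (array N \<omega>)) \<longleftrightarrow> integrable (gauss_prod (site_pairs N)) f"
proof -
  note D = distr_array [OF N]
  show "(\<lambda>\<omega>. f (array N \<omega>)) \<in> borel_measurable M" by (rule measurable_compose [OF D(1) f])
  show "(LINT \<omega>|M. f (array N \<omega>)) = integral\<^sup>L (gauss_prod (site_pairs N)) f"
    using integral_distr [OF D(1) f] unfolding D(2) by (rule sym)
  show "integrable M (\<lambda>\<omega>. f (array N \<omega>)) \<longleftrightarrow> integrable (gauss_prod (site_pairs N)) f"
    using integrable_distr_eq [OF D(1) f] unfolding D(2) by (rule sym)
qed

text \<open>By \<open>site_pairs_variance\<close> and the condition on w, the normalised deviation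
  has second moment of order \<open>1 / sqrt N\<close>, which is 1 / k^2 at N = k^4.
  \<open>nmin\<close> admits families that exist only from some size on, such as the constrained
  ones.\<close>

lemma AE_concentration:
  fixes S :: "nat \<Rightarrow> 's set"
  assumes fam: "\<And>N. N \<ge> nmin \<Longrightarrow> affine_family (site_pairs N) (S N) (a N) (c N) (L N) (C N)"
    and w: "\<And>N. N \<ge> 1 \<Longrightarrow> w N > 0" "\<And>N. N \<ge> nmin \<Longrightarrow> (L N)\<^sup>2 * real N \<le> B * (w N)\<^sup>2"
  shows "AE \<omega> in M. (\<lambda>k. (affine_sup (site_pairs (k ^ 4)) (S (k ^ 4)) (a (k ^ 4)) (c (k ^ 4)) (array
      (k ^ 4) \<omega>)
      - integral\<^sup>L (gauss_prod (site_pairs (k ^ 4))) (affine_sup (site_pairs (k ^ 4)) (S (k ^ 4)) (a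
          (k ^ 4)) (c (k ^ 4)))) / w (k ^ 4)) \<longlonglongrightarrow> 0"
proof -
  let ?f = "\<lambda>N. affine_sup (site_pairs N) (S N) (a N) (c N)"
  let ?m = "\<lambda>N. integral\<^sup>L (gauss_prod (site_pairs N)) (?f N)"
  \<comment> \<open>The shift makes every size at least 1 and at least \<open>nmin\<close>;
    \<open>LIMSEQ_offset\<close> removes it at the end.\<close>
  define n where "n k = (k + Suc nmin) ^ 4" for k
  have n: "n k \<ge> 1" "n k \<ge> nmin" "real (n k) = (real (k + Suc nmin))\<^sup>2 * (real (k + Suc nmin))\<^sup>2"
      for k
  proof -
    show "n k \<ge> 1" by (simp add: n_def)
    have "k + Suc nmin \<le> n k" unfolding n_def by (rule self_le_power) auto
    then show "n k \<ge> nmin" by simp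
    show "real (n k) = (real (k + Suc nmin))\<^sup>2 * (real (k + Suc nmin))\<^sup>2"
      unfolding n_def of_nat_power by (simp only: power_add [symmetric]) simp
  qed
  define Z where "Z k \<omega> = (?f (n k) (array (n k) \<omega>) - ?m (n k)) / w (n k)" for k \<omega>
  define V where "V = gauss_var_const * \<bar>B\<bar>"
  have "AE \<omega> in M. (\<lambda>k. Z k \<omega>) \<longlonglongrightarrow> 0"
  proof (rule AE_tendsto_zero_of_summable)
    fix k
    let ?N = "n k"
    interpret F: affine_family "site_pairs ?N" "S ?N" "a ?N" "c ?N" "L ?N" "C ?N"
        by (rule fam [OF n(2)])
    interpret P: prob_space "gauss_prod (site_pairs ?N)" by (rule prob_space_gauss_prod)
    have w0: "w ?N > 0" by (rule w(1) [OF n(1)])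
    have m1: "(\<lambda>x. (?f ?N x - ?m ?N) / w ?N) \<in> borel_measurable (gauss_prod (site_pairs ?N))"
      by (intro borel_measurable_divide borel_measurable_diff F.affine_sup_measurable
          borel_measurable_const)
    show "Z k \<in> borel_measurable M"
      using array_integral(1) [OF n(1) m1] unfolding Z_def .
    have m2: "(\<lambda>x. ((?f ?N x - ?m ?N) / w ?N)\<^sup>2) \<in> borel_measurable (gauss_prod (site_pairs ?N))"
      by (rule borel_measurable_power [OF m1])
    have i2: "integrable (gauss_prod (site_pairs ?N)) (\<lambda>x. ((?f ?N x - ?m ?N) / w ?N)\<^sup>2)"
      unfolding power_divide power2_diff mult.assoc
      by (intro integrable_divide Bochner_Integration.integrable_diff
          Bochner_Integration.integrable_add integrable_mult_right
          integrable_mult_left F.affine_sup_square_integrable F.affine_sup_integrable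
              P.integrable_const)
    show "integrable M (\<lambda>\<omega>. (Z k \<omega>)\<^sup>2)"
      using array_integral(3) [OF n(1) m2] i2 unfolding Z_def by simp
    have "expectation (\<lambda>\<omega>. (Z k \<omega>)\<^sup>2) = (LINT x|gauss_prod (site_pairs ?N). (?f ?N x
        - ?m ?N)\<^sup>2) / (w ?N)\<^sup>2"
      using array_integral(2) [OF n(1) m2] unfolding Z_def power_divide integral_divide_zero .
    also have "\<dots> \<le> (gauss_var_const * (L ?N)\<^sup>2 * sqrt (real ?N)) / (w ?N)\<^sup>2"
      using n(1) [of k] by (intro divide_right_mono site_pairs_variance [OF fam [OF n(2)]]) auto
    also have "\<dots> \<le> V / (real (k + Suc nmin))\<^sup>2"
    proof -
      let ?q = "(real (k + Suc nmin))\<^sup>2"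
      have q: "sqrt (real ?N) = ?q" unfolding n(3) real_sqrt_abs2 by simp
      have q0: "?q > 0" by (rule zero_less_power) simp
      have "(L ?N)\<^sup>2 * (?q * ?q) \<le> \<bar>B\<bar> * (w ?N)\<^sup>2"
      proof -
        have "B * (w ?N)\<^sup>2 \<le> \<bar>B\<bar> * (w ?N)\<^sup>2" by (intro mult_right_mono) auto
        then show ?thesis using w(2) [OF n(2), of k] unfolding n(3) by (rule order_trans [rotated])
      qed
      then have "gauss_var_const * ((L ?N)\<^sup>2 * (?q * ?q)) \<le> gauss_var_const * (\<bar>B\<bar> * (w ?N)\<^sup>2)"
        by (rule mult_left_mono [OF _ gauss_var_const_nonneg])
      then show ?thesis unfolding q V_def using w0 q0
        by (simp add: divide_simps mult_ac)
    qed
    finally show "expectation (\<lambda>\<omega>. (Z k \<omega>)\<^sup>2) \<le> V / (real (k + Suc nmin))\<^sup>2" .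
  next
    have "summable (\<lambda>k. 1 / (real (k + Suc nmin))\<^sup>2)"
      using inverse_power_summable [of 2, where 'a = real] by (subst summable_iff_shift)
          (simp add: inverse_eq_divide)
    then show "summable (\<lambda>k. V / (real (k + Suc nmin))\<^sup>2)"
      using summable_mult [of "\<lambda>k. 1 / (real (k + Suc nmin))\<^sup>2" V] by simp
  qed
  then show ?thesis
  proof (rule AE_mp, intro AE_I2 impI)
    fix \<omega> assume "(\<lambda>k. Z k \<omega>) \<longlonglongrightarrow> 0"
    then have "(\<lambda>k. (?f ((k + Suc nmin) ^ 4) (array ((k + Suc nmin) ^ 4) \<omega>) - ?m ((k
        + Suc nmin) ^ 4)) / w ((k + Suc nmin) ^ 4)) \<longlonglongrightarrow> 0"
      unfolding Z_def n_def .
    then show "(\<lambda>k. (?f (k ^ 4) (array (k ^ 4) \<omega>) - ?m (k ^ 4)) / w (k ^ 4)) \<longlonglongrightarrow> 0"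
      by (rule LIMSEQ_offset)
  qed
qed

section \<open>Transfer between the given array and the canonical product measure\<close>

lemma lagrangian_array:
  "lagrangian TYPE('k::finite) (\<lambda>i j. array N \<omega> (i, j)) p N t
      = lagrangian TYPE('k) (\<lambda>i j. g i j \<omega>) p N t"
proof -
  have "hamiltonian (\<lambda>i j. array N \<omega> (i, j)) N \<sigma> = hamiltonian (\<lambda>i j. g i j \<omega>) N \<sigma>" for \<sigma> ::
      "nat \<Rightarrow> real ^ 'k"
    unfolding hamiltonian_def by (intro arg_cong2 [where f = "(*)"] sum.cong refl)
        (auto simp: array_def site_pairs_def)
  then show ?thesis by (simp add: lagrangian_def pen_hamiltonian_def)
qed

lemma lagrangian_overlap_array:
  "real N * lagrangian_overlap (\<lambda>i j. g i j \<omega>) p D N 1 = (if N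
      = 0 then 0 else ham_sup p N (overlap_configs N D) (array N \<omega>))"
proof -
  have "hamiltonian (\<lambda>i j. array N \<omega> (i, j)) N \<sigma> = hamiltonian (\<lambda>i j. g i j \<omega>) N \<sigma>" for \<sigma> ::
      "nat \<Rightarrow> real ^ 'b"
    unfolding hamiltonian_def by (intro arg_cong2 [where f = "(*)"] sum.cong refl)
        (auto simp: array_def site_pairs_def)
  then show ?thesis by (simp add: lagrangian_overlap_def ham_sup_eq pen_hamiltonian_def)
qed

lemma mean_lagrangian_overlap:
  fixes D :: "real ^ 'k ^ 'k"
  assumes p: "p > 0" and D: "D \<in> psd_matrices" and N: "N \<ge> CARD('k)"
  shows "(LINT \<omega>|M. lagrangian_overlap (\<lambda>i j. g i j \<omega>) p D N 1) = mean_ham_sup p N D / real N"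
proof -
  have "CARD('k) > 0" by simp
  with N have N1: "N \<ge> 1" by linarith
  interpret X: affine_family "site_pairs N" "overlap_configs N D" "ham_coeff N" "\<lambda>\<sigma>.
      - norm_p2_powr p N \<sigma>"
     "trace D * sqrt (real N)" "real N * sqrt (trace D * real N) powr p"
    by (rule affine_family_overlap [OF p D overlap_configs_nonempty [OF D N]])
  have "(LINT \<omega>|M. lagrangian_overlap (\<lambda>i j. g i j \<omega>) p D N 1)
      = (LINT \<omega>|M. ham_sup p N (overlap_configs N D) (array N \<omega>) / real N)"
    using lagrangian_overlap_array [of N _ p D] N1 by (intro Bochner_Integration.integral_cong)
        (auto simp: field_simps)
  also have "\<dots> = (LINT \<omega>|M. ham_sup p N (overlap_configs N D) (array N \<omega>)) / real N"
      by (rule integral_divide_zero)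
  also have "(LINT \<omega>|M. ham_sup p N (overlap_configs N D) (array N \<omega>)) = mean_ham_sup p N D"
    unfolding mean_ham_sup_def ham_sup_def by (rule array_integral(2) [OF N1
        X.affine_sup_measurable])
  finally show ?thesis .
qed

lemma lim_lagrangian_overlap_scale:
  fixes D :: "real ^ 'k ^ 'k"
  assumes p: "p > 2" and D: "D \<in> psd_matrices" and l: "l > 0" "t * l powr p = l\<^sup>2"
  shows "lim_lagrangian_overlap M g p (l\<^sup>2 *\<^sub>R D) t = l\<^sup>2 * lim_overlap p D"
proof -
  have "(\<lambda>N. l\<^sup>2 * (mean_ham_sup p N D / real N)) \<longlonglongrightarrow> l\<^sup>2 * lim_overlap p D"
    by (intro tendsto_mult tendsto_const mean_ham_sup_limit(1) p D)
  moreover have "eventually (\<lambda>N. l\<^sup>2 * (mean_ham_sup p N D / real N)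
      = (LINT \<omega>|M. lagrangian_overlap (\<lambda>i j. g i j \<omega>) p (l\<^sup>2 *\<^sub>R D) N t)) sequentially"
    using eventually_ge_at_top [of "CARD('k)"]
  proof eventually_elim
    case (elim N)
    have "CARD('k) > 0" by simp
    with elim have N1: "N \<ge> 1" by linarith
    have p0: "p > 0" using p by simp
    have "(LINT \<omega>|M. lagrangian_overlap (\<lambda>i j. g i j \<omega>) p (l\<^sup>2 *\<^sub>R D) N t)
        = (LINT \<omega>|M. l\<^sup>2 * lagrangian_overlap (\<lambda>i j. g i j \<omega>) p D N 1)"
      using lagrangian_overlap_scale [OF p0 l N1 overlap_configs_nonempty [OF D elim]] by simp
    then show ?case unfolding integral_mult_right_zero mean_lagrangian_overlap [OF p0 D elim]
        by simp
  qed
  ultimately have "(\<lambda>N. LINT \<omega>|M. lagrangian_overlap (\<lambda>i j. g i j \<omega>) p (l\<^sup>2 *\<^sub>R D) N t)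
      \<longlonglongrightarrow> l\<^sup>2 * lim_overlap p D"
    by (rule Lim_transform_eventually)
  then show ?thesis unfolding lim_lagrangian_overlap_def by (rule limI)
qed

lemma mat_1_pd: "mat 1 \<in> (pd_matrices :: (real ^ 'k ^ 'k) set)"
  by (simp add: pd_matrices_def transpose_mat)

text \<open>The equality of the two suprema is deterministic but is obtained along a single outcome:
  at large fourth powers the same random value is at least S1 - \<open>\<eta>\<close> and at most S2
  + \<open>\<eta>\<close>.\<close>

lemma AE_lagrangian_limit:
  assumes p: "p > 2"
  shows "AE \<omega> in M. (\<lambda>N. lagrangian TYPE('k::finite) (\<lambda>i j. g i j \<omega>) p N 1)
      \<longlonglongrightarrow> (\<Squnion>D\<in>(psd_matrices :: (real ^ 'k ^ 'k) set). lim_overlap p D)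
    \<and> (\<Squnion>D\<in>(psd_matrices :: (real ^ 'k ^ 'k) set). lim_overlap p D)
        = (\<Squnion>D\<in>(pd_matrices :: (real ^ 'k ^ 'k) set). lim_overlap p D)"
proof -
  let ?psd = "psd_matrices :: (real ^ 'k ^ 'k) set" and ?pd = "pd_matrices :: (real ^ 'k ^ 'k) set"
  define S1 where "S1 = (\<Squnion>D\<in>?psd. lim_overlap p D)"
  define S2 where "S2 = (\<Squnion>D\<in>?pd. lim_overlap p D)"
  have p0: "p > 0" using p by simp
  have sq: "(x * sqrt (real N))\<^sup>2 * real N = x\<^sup>2 * (real N)\<^sup>2" for x N
    unfolding power_mult_distrib by (simp add: power2_eq_square [of "real N"])
  have sub: "?pd \<subseteq> ?psd" using pd_imp_psd by auto
  have bdd: "bdd_above (lim_overlap p ` ?psd)" by (rule lim_overlap_bounded [OF p])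
  have bdd2: "bdd_above (lim_overlap p ` ?pd)" by (rule bdd_above_mono [OF bdd]) (use sub in auto)
  have S21: "S2 \<le> S1" unfolding S1_def S2_def
    by (rule cSUP_subset_mono [OF _ bdd sub]) (use mat_1_pd in auto)
  have S2: "mean_ham_sup p N D \<le> S2 * real N" if "D \<in> ?pd" "N \<ge> CARD('k)" for D N
  proof -
    have "mean_ham_sup p N D \<le> lim_overlap p D * real N"
      using that by (intro mean_ham_sup_limit(2) p pd_imp_psd)
    also have "\<dots> \<le> S2 * real N"
      unfolding S2_def using that by (intro mult_right_mono cSUP_upper bdd2) auto
    finally show ?thesis .
  qed
  \<comment> \<open>A sequence of nearly optimal matrices suffices for the lower bound, so only
    countably many null sets are discarded.\<close>
  have "\<exists>D\<in>?psd. S1 - 1 / real (Suc n) < lim_overlap p D" for n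
    using less_cSUP_iff [OF _ bdd, of "S1 - 1 / real (Suc n)"] mat_1_pd sub
        unfolding S1_def [symmetric] by auto
  then obtain D where D: "\<And>n. D n \<in> ?psd" "\<And>n. S1 - 1 / real (Suc n) < lim_overlap p (D n)" by metis
  obtain r where r: "r \<ge> 0" "\<And>N g. N \<ge> 1 \<Longrightarrow> quad_sup N g \<le> 3 * sqrt (real N) \<Longrightarrow>
     real N * lagrangian TYPE('k) (\<lambda>i j. g (i, j)) p N 1
         \<le> ham_sup p N (trunc_configs p r N :: (nat \<Rightarrow> real ^ 'k) set) g"
    using truncation [OF p, where 'k = 'k] by blast
  obtain C where C: "C \<ge> 0" "\<And>r N (\<sigma> :: nat \<Rightarrow> real ^ 'k). \<sigma> \<in> trunc_configs p r N
      \<Longrightarrow> (\<Sum>i=1..N. (norm (\<sigma> i))\<^sup>2) \<le> (r + C) * real N"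
    using trunc_configs_norm [OF p, where 'k = 'k] by blast
  have "AE \<omega> in M. (\<lambda>k. (ham_sup p (k ^ 4) (trunc_configs p r (k ^ 4) :: (nat \<Rightarrow> real ^ 'k) set)
      (array (k ^ 4) \<omega>)
      - mean_trunc_sup TYPE('k) p r (k ^ 4)) / real (k ^ 4)) \<longlonglongrightarrow> 0"
    unfolding ham_sup_def mean_trunc_sup_def
  proof (rule AE_concentration [where w = real and nmin = 1])
    fix N :: nat assume "N \<ge> 1"
    show "affine_family (site_pairs N) (trunc_configs p r N :: (nat \<Rightarrow> real ^ 'k) set) (ham_coeff N)
       (\<lambda>\<sigma>. - norm_p2_powr p N \<sigma>) ((r + C) * sqrt (real N)) (r * real N)"
      by (rule affine_family_trunc [OF r(1) _ C(2)]) (use r(1) C(1) in auto)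
    show "((r + C) * sqrt (real N))\<^sup>2 * real N \<le> (r + C)\<^sup>2 * (real N)\<^sup>2"
      unfolding sq ..
  qed simp
  moreover have "AE \<omega> in M. (\<lambda>k. (quad_sup (k ^ 4) (array (k ^ 4) \<omega>)
      - integral\<^sup>L (gauss_prod (site_pairs (k ^ 4))) (quad_sup (k ^ 4))) / sqrt (real (k ^ 4))) \<longlonglongrightarrow> 0"
    unfolding quad_sup_def
    by (rule AE_concentration [where w = "\<lambda>N. sqrt (real N)" and nmin = 1 and B
        = 1, OF affine_family_quadratic]) auto
  moreover have "AE \<omega> in M. \<forall>n. (\<lambda>k. (ham_sup p (k ^ 4) (overlap_configs (k ^ 4) (D n)) (array (k ^
      4) \<omega>)
      - mean_ham_sup p (k ^ 4) (D n)) / real (k ^ 4)) \<longlonglongrightarrow> 0"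
    unfolding ham_sup_def mean_ham_sup_def AE_all_countable
  proof (intro allI, rule AE_concentration [where w = real and nmin = "CARD('k)"])
    fix n N assume N: "N \<ge> CARD('k)"
    show "affine_family (site_pairs N) (overlap_configs N (D n)) (ham_coeff N) (\<lambda>\<sigma>.
        - norm_p2_powr p N \<sigma>)
       (trace (D n) * sqrt (real N)) (real N * sqrt (trace (D n) * real N) powr p)"
      by (rule affine_family_overlap [OF p0 D(1) overlap_configs_nonempty [OF D(1) N]])
    show "(trace (D n) * sqrt (real N))\<^sup>2 * real N \<le> (trace (D n))\<^sup>2 * (real N)\<^sup>2"
      unfolding sq ..
  qed simp
  ultimately show ?thesis
  proof eventually_elim
    case (elim \<omega>)
    let ?u = "\<lambda>N. lagrangian TYPE('k) (\<lambda>i j. g i j \<omega>) p N 1"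
    have inf4: "filterlim (\<lambda>k::nat. k ^ 4) at_top sequentially" 
      by (rule filterlim_subseq) (auto simp: strict_mono_def intro: power_strict_mono)
    have pos: "eventually (\<lambda>k::nat. k \<ge> 1) sequentially" by (rule eventually_ge_at_top)
    have up: "eventually (\<lambda>k. ?u (k ^ 4) \<le> S2 + \<eta>) sequentially" if \<eta>: "\<eta> > 0" for \<eta>
    proof -
      have 1: "eventually (\<lambda>k. mean_trunc_sup TYPE('k) p r (k ^ 4) / real (k ^ 4) \<le> S2
          + \<eta> / 2) sequentially"
        using \<eta> by (intro eventually_compose_filterlim [OF mean_trunc_sup_upper [OF p r(1) _ S2]
            inf4]) auto
      have 2: "eventually (\<lambda>k. (ham_sup p (k ^ 4) (trunc_configs p r (k ^ 4) :: (nat \<Rightarrow> real ^ 'k)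
          set) (array (k ^ 4) \<omega>)
        - mean_trunc_sup TYPE('k) p r (k ^ 4)) / real (k ^ 4) < \<eta> / 2) sequentially"
        using \<eta> by (intro order_tendstoD(2) [OF elim(1)]) auto
      have 3: "eventually (\<lambda>k. (quad_sup (k ^ 4) (array (k ^ 4) \<omega>)
        - integral\<^sup>L (gauss_prod (site_pairs (k ^ 4))) (quad_sup (k ^ 4))) / sqrt (real (k ^ 4))
            < 1) sequentially"
        by (intro order_tendstoD(2) [OF elim(2)]) auto
      from 1 2 3 pos show ?thesis
      proof eventually_elim
        case (elim k)
        let ?N = "k ^ 4"
        have N: "?N \<ge> 1" "real ?N > 0" using elim(4) by simp_all
        \<comment> \<open>The mean of the spherical maximum is at most \<open>2 * sqrt N\<close> and
          its deviation less than \<open>sqrt N\<close>; together they give the 3 in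
          \<open>truncation\<close>.\<close>
        have "sqrt 2 \<le> (2::real)" by (rule real_le_lsqrt) auto
        then have "sqrt 2 * sqrt (real ?N) \<le> 2 * sqrt (real ?N)" by (rule mult_right_mono) simp
        moreover have "quad_sup ?N (array ?N \<omega>) - integral\<^sup>L (gauss_prod (site_pairs ?N)) (quad_sup
            ?N) < sqrt (real ?N)"
          using elim(3) N by (simp add: pos_divide_less_eq)
        moreover have "integral\<^sup>L (gauss_prod (site_pairs ?N)) (quad_sup ?N)
            \<le> sqrt 2 * sqrt (real ?N)"
          using N by (intro mean_quad_sup) simp
        ultimately have "quad_sup ?N (array ?N \<omega>) \<le> 3 * sqrt (real ?N)" by linarith
        from r(2) [OF N(1) this] have "real ?N * ?u ?N \<le> ham_sup p ?N (trunc_configs p r ?N :: (nat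
            \<Rightarrow> real ^ 'k) set) (array ?N \<omega>)"
          unfolding lagrangian_array .
        then have "?u ?N \<le> ham_sup p ?N (trunc_configs p r ?N :: (nat \<Rightarrow> real ^ 'k) set) (array ?N \<omega>)
            / real ?N"
          using N by (simp add: pos_le_divide_eq mult.commute)
        then show ?case using elim(1,2) unfolding diff_divide_distrib by linarith
      qed
    qed
    have low: "eventually (\<lambda>k. S1 - \<eta> \<le> ?u (k ^ 4)) sequentially" if \<eta>: "\<eta> > 0" for \<eta>
    proof -
      obtain n where n: "1 / real (Suc n) < \<eta> / 2" using \<eta> nat_approx_posE [of "\<eta> / 2"] by auto
      have "(\<lambda>k. mean_ham_sup p (k ^ 4) (D n) / real (k ^ 4)) \<longlonglongrightarrow> lim_overlap p (D n)"
        by (rule filterlim_compose [OF mean_ham_sup_limit(1) [OF p D(1)] inf4])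
      from tendsto_add [OF spec [OF elim(3), of n] this]
      have "(\<lambda>k. ham_sup p (k ^ 4) (overlap_configs (k ^ 4) (D n)) (array (k ^ 4) \<omega>) / real (k ^ 4))
          \<longlonglongrightarrow> lim_overlap p (D n)"
        by (simp add: diff_divide_distrib)
      moreover have "S1 - \<eta> < lim_overlap p (D n)" using D(2) [of n] n \<eta> by linarith
      ultimately have 1: "eventually (\<lambda>k. S1 - \<eta> < ham_sup p (k ^ 4) (overlap_configs (k ^ 4) (D n))
          (array (k ^ 4) \<omega>) / real (k ^ 4)) sequentially"
        by (rule order_tendstoD(1))
      have 2: "eventually (\<lambda>k::nat. k ^ 4 \<ge> CARD('k)) sequentially"
        using inf4 unfolding filterlim_at_top by blast
      from 1 2 pos show ?thesis
      proof eventually_elim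
        case (elim k)
        let ?N = "k ^ 4"
        have N: "?N \<ge> 1" "real ?N > 0" using elim(3) by simp_all
        have "ham_sup p ?N (overlap_configs ?N (D n)) (array ?N \<omega>) \<le> real ?N * ?u ?N"
          unfolding ham_sup_eq lagrangian_array [of ?N \<omega>, symmetric]
        proof (rule cSUP_least [OF overlap_configs_nonempty [OF D(1) elim(2)]])
          fix \<sigma> assume "\<sigma> \<in> overlap_configs ?N (D n)"
          then show "pen_hamiltonian (\<lambda>i j. array ?N \<omega> (i, j)) p 1 ?N \<sigma>
              \<le> real ?N * lagrangian TYPE('k) (\<lambda>i j. array ?N \<omega> (i, j)) p ?N 1"
            by (intro lagrangian_upper p N) (auto simp: overlap_configs_def)
        qed
        then have "ham_sup p ?N (overlap_configs ?N (D n)) (array ?N \<omega>) / real ?N \<le> ?u ?N"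
          using N by (simp add: pos_divide_le_eq mult.commute)
        then show ?case using elim(1) by linarith
      qed
    qed
    have "S1 \<le> S2"
    proof (rule field_le_epsilon)
      fix e :: real assume "e > 0"
      then have e: "e / 2 > 0" by simp
      from eventually_conj [OF up [OF e] low [OF e]] obtain k where "?u (k ^ 4) \<le> S2 + e / 2" "S1
          - e / 2 \<le> ?u (k ^ 4)"
        by (auto dest!: eventually_happens)
      then show "S1 \<le> S2 + e" by linarith
    qed
    with S21 have S: "S1 = S2" by simp
    have "(\<lambda>k. ?u (k ^ 4)) \<longlonglongrightarrow> S1"
    proof (rule tendstoI)
      fix e :: real assume "e > 0"
      then have e: "e / 2 > 0" by simp
      from up [OF e] low [OF e] show "eventually (\<lambda>k. dist (?u (k ^ 4)) S1 < e) sequentially"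
      proof eventually_elim
        case (elim k)
        then show ?case using \<open>e > 0\<close> S unfolding dist_real_def by linarith
      qed
    qed
    then have "?u \<longlonglongrightarrow> S1"
    proof (rule convergent_from_fourth_powers [rotated 3])
      show "0 \<le> 1 + p / (2 * (p - 2))" using p by simp
      show "0 \<le> ?u N" if "N \<ge> 1" for N by (rule lagrangian_nonneg [OF p zero_less_one that])
      show "real N powr (1 + p / (2 * (p - 2))) * ?u N \<le> real N' powr (1 + p / (2 * (p
          - 2))) * ?u N'"
        if "1 \<le> N" "N \<le> N'" for N N' by (rule lagrangian_monotone [OF p that])
    qed
    then show ?case using S unfolding S1_def S2_def by blast
  qed
qed

text \<open>The scaling identity holds for every outcome, so the exceptional null set of t = 1
  serves all t at once. Both cones of matrices are invariant under positive multiples, so the two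
  suprema rescale by the same factor.\<close>

lemma AE_lagrangian_limit_all:
  assumes p: "p > 2"
  shows "AE \<omega> in M. \<forall>t>0. (\<lambda>N. lagrangian TYPE('k::finite) (\<lambda>i j. g i j \<omega>) p N t)
      \<longlonglongrightarrow> (\<Squnion>D\<in>(psd_matrices :: (real ^ 'k ^ 'k) set). lim_lagrangian_overlap M g p D t)
    \<and> (\<Squnion>D\<in>(psd_matrices :: (real ^ 'k ^ 'k) set). lim_lagrangian_overlap M g p D t)
        = (\<Squnion>D\<in>(pd_matrices :: (real ^ 'k ^ 'k) set). lim_lagrangian_overlap M g p D t)"
  using AE_lagrangian_limit [OF p, where 'k = 'k]
proof eventually_elim
  case (elim \<omega>)
  show ?case
  proof (intro allI impI)
    fix t :: real assume t: "t > 0"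
    define l where "l = t powr (- 1 / (p - 2))"
    have l: "l > 0" "t * l powr p = l\<^sup>2"
    proof -
      show l0: "l > 0" using t by (simp add: l_def)
      have "l powr (p - 2) = t powr - 1" using p by (simp add: l_def powr_powr)
      then have "t * l powr (p - 2) = 1" using t by (simp add: powr_minus_divide)
      moreover have "l powr p = l powr (p - 2) * l\<^sup>2" using l0 by (simp flip: powr_numeral powr_add)
      ultimately show "t * l powr p = l\<^sup>2" by (simp flip: mult.assoc)
    qed
    let ?psd = "psd_matrices :: (real ^ 'k ^ 'k) set" and ?pd =
        "pd_matrices :: (real ^ 'k ^ 'k) set"
    have scale: "(\<lambda>D. l\<^sup>2 *\<^sub>R D) ` X = X" if "\<And>c D. c > 0 \<Longrightarrow> D \<in> X \<Longrightarrow> c *\<^sub>R D \<in> X" for X ::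
        "(real ^ 'k ^ 'k) set"
    proof (intro equalityI subsetI)
      fix D assume "D \<in> X"
      then have "(1 / l\<^sup>2) *\<^sub>R D \<in> X" using l by (intro that) auto
      then show "D \<in> (\<lambda>D. l\<^sup>2 *\<^sub>R D) ` X" using l by (intro image_eqI [of _ _
          "(1 / l\<^sup>2) *\<^sub>R D"]) auto
    qed (use l that in auto)
    have q: "x \<bullet> ((c *\<^sub>R D) *v x) = c * (x \<bullet> (D *v x))" for c and x :: "real ^ 'k" and D ::
        "real ^ 'k ^ 'k"
      by (simp add: scaleR_matrix_vector_assoc [symmetric])
    have tr: "transpose (c *\<^sub>R D) = c *\<^sub>R transpose D" for c and D :: "real ^ 'k ^ 'k"
      by (simp add: transpose_def vec_eq_iff)
    have sc: "(\<lambda>D. l\<^sup>2 *\<^sub>R D) ` ?psd = ?psd" "(\<lambda>D. l\<^sup>2 *\<^sub>R D) ` ?pd = ?pd"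
      by (rule scale; simp add: psd_matrices_def pd_matrices_def q tr)+
    have bdd: "bdd_above (lim_overlap p ` ?psd)" by (rule lim_overlap_bounded [OF p])
    have sup: "(\<Squnion>D\<in>X. lim_lagrangian_overlap M g p D t) = l\<^sup>2 * (\<Squnion>D\<in>X. lim_overlap p D)"
      if X: "X \<subseteq> ?psd" "X \<noteq> {}" "(\<lambda>D. l\<^sup>2 *\<^sub>R D) ` X = X" for X
    proof -
      have "(\<Squnion>D\<in>X. lim_lagrangian_overlap M g p D t) = (\<Squnion>D\<in>(\<lambda>D. l\<^sup>2 *\<^sub>R D) ` X.
          lim_lagrangian_overlap M g p D t)"
        unfolding X(3) ..
      also have "\<dots> = (\<Squnion>D\<in>X. l\<^sup>2 * lim_overlap p D)"
        unfolding image_comp o_def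
        by (intro arg_cong [where f = Sup] image_cong refl lim_lagrangian_overlap_scale p l)
            (use X in auto)
      also have "\<dots> = l\<^sup>2 * (\<Squnion>D\<in>X. lim_overlap p D)"
        using X l by (intro cSUP_mult_left bdd_above_mono [OF bdd]) auto
      finally show ?thesis .
    qed
    have ne: "?pd \<noteq> {}" "?psd \<noteq> {}" "?pd \<subseteq> ?psd"
      using mat_1_pd [where 'k = 'k] pd_imp_psd [where 'a = 'k] by blast+
    from elim have L: "(\<lambda>N. lagrangian TYPE('k) (\<lambda>i j. g i j \<omega>) p N 1) \<longlonglongrightarrow> (\<Squnion>D\<in>?psd. lim_overlap p D)"
      by (rule conjunct1)
    have "(\<lambda>N. l\<^sup>2 * lagrangian TYPE('k) (\<lambda>i j. g i j \<omega>) p N 1) \<longlonglongrightarrow> l\<^sup>2 * (\<Squnion>D\<in>?psd. lim_overlap p D)"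
      by (rule tendsto_mult_left [OF L])
    moreover have "eventually (\<lambda>N. l\<^sup>2 * lagrangian TYPE('k) (\<lambda>i j. g i j \<omega>) p N 1
        = lagrangian TYPE('k) (\<lambda>i j. g i j \<omega>) p N t) sequentially"
      using eventually_ge_at_top [of "1::nat"] by eventually_elim (rule lagrangian_scale [OF p l,
          symmetric])
    ultimately have "(\<lambda>N. lagrangian TYPE('k) (\<lambda>i j. g i j \<omega>) p N t)
        \<longlonglongrightarrow> l\<^sup>2 * (\<Squnion>D\<in>?psd. lim_overlap p D)"
      by (rule Lim_transform_eventually)
    then show "(\<lambda>N. lagrangian TYPE('k) (\<lambda>i j. g i j \<omega>) p N t)
        \<longlonglongrightarrow> (\<Squnion>D\<in>?psd. lim_lagrangian_overlap M g p D t)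
      \<and> (\<Squnion>D\<in>?psd. lim_lagrangian_overlap M g p D t) = (\<Squnion>D\<in>?pd. lim_lagrangian_overlap M g p D t)"
      using elim sup [OF order_refl ne(2) sc(1)] sup [OF ne(3,1) sc(2)] by simp
  qed
qed

end

theorem theorem1p2:
  fixes M :: "'a measure"
    and g :: "nat \<Rightarrow> nat \<Rightarrow> 'a \<Rightarrow> real"
    and p :: real
  assumes "prob_space M"
    and "prob_space.indep_vars M (\<lambda>_. borel) (\<lambda>(i, j). g i j) ({1..} \<times> {1..})"
    and "\<And>i j. 1 \<le> i \<Longrightarrow> 1 \<le> j \<Longrightarrow> distributed M lborel (g i j) std_normal_density"
    and "2 < p"
  shows "(AE \<omega> in M. \<forall>t>0.
            convergent (\<lambda>N. lagrangian TYPE('k::finite) (\<lambda>i j. g i j \<omega>) p N t)) \<and>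
         (AE \<omega> in M. \<forall>t>0.
            lim_lagrangian TYPE('k) g p t \<omega>
              = (\<Squnion>D\<in>(psd_matrices :: (real ^ 'k ^ 'k) set). lim_lagrangian_overlap M g p D t) \<and>
            (\<Squnion>D\<in>(psd_matrices :: (real ^ 'k ^ 'k) set). lim_lagrangian_overlap M g p D t)
              = (\<Squnion>D\<in>(pd_matrices :: (real ^ 'k ^ 'k) set). lim_lagrangian_overlap M g p D t))"
proof -
  interpret gaussian_array M g
    using assms(1-3) by (simp add: gaussian_array_def gaussian_array_axioms_def)
  note lim = AE_lagrangian_limit_all [OF assms(4), where 'k = 'k]
  from lim have "AE \<omega> in M. \<forall>t>0. convergent (\<lambda>N. lagrangian TYPE('k) (\<lambda>i j. g i j \<omega>) p N t)"
  proof eventually_elim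
    case (elim \<omega>)
    show ?case by (intro allI impI) (rule convergentI [OF conjunct1 [OF elim [rule_format]]])
  qed
  moreover from lim have "AE \<omega> in M. \<forall>t>0.
            lim_lagrangian TYPE('k) g p t \<omega>
              = (\<Squnion>D\<in>(psd_matrices :: (real ^ 'k ^ 'k) set). lim_lagrangian_overlap M g p D t) \<and>
            (\<Squnion>D\<in>(psd_matrices :: (real ^ 'k ^ 'k) set). lim_lagrangian_overlap M g p D t)
              = (\<Squnion>D\<in>(pd_matrices :: (real ^ 'k ^ 'k) set). lim_lagrangian_overlap M g p D t)"
  proof eventually_elim
    case (elim \<omega>)
    show ?case
    proof (intro allI impI)
      fix t :: real assume "t > 0"
      from elim [rule_format, OF this]
      show "lim_lagrangian TYPE('k) g p t \<omega>
              = (\<Squnion>D\<in>(psd_matrices :: (real ^ 'k ^ 'k) set). lim_lagrangian_overlap M g p D t) \<and>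
            (\<Squnion>D\<in>(psd_matrices :: (real ^ 'k ^ 'k) set). lim_lagrangian_overlap M g p D t)
              = (\<Squnion>D\<in>(pd_matrices :: (real ^ 'k ^ 'k) set). lim_lagrangian_overlap M g p D t)"
        unfolding lim_lagrangian_def by (metis limI)
    qed
  qed
  ultimately show ?thesis by (rule conjI)
qed

end
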